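(* Let $p\colon\mathbb{R}\to\mathbb{R}$ be bounded and uniformly continuous, assume that $x'=-x^2+p(t)$ has exactly two hyperbolic solutions, and take $c>0$. Suppose that the equation $$y'=-\Big(y-\frac{2}{\pi}\arctan(ct)\Big)^2+p(t)\qquad(E_c)$$ has no bounded solutions (Case C). Then, with $\mathfrak{a}_c,\mathfrak{r}_c,\mathcal{R}_c^\pm,\tilde{\mathfrak{a}}^\pm,\tilde{\mathfrak{r}}^\pm$ as in the context: (C1) $\mathcal{R}_c^-=(-\infty,l_c^-)$ for some $l_c^-\in\mathbb{R}$ and $\mathcal{R}_c^+=(l_c^+,\infty)$ for some $l_c^+\in\mathbb{R}$, so that $\lim_{t\to(l_c^-)^-}\mathfrak{a}_c(t)=-\infty$ and $\lim_{t\to(l_c^+)^+}\mathfrak{r}_c(t)=\infty$. (C2) The solutions $\mathfrak{a}_c$ and $\mathfrak{r}_c$ of $(E_c)$ are respectively locally pullback attractive and locally pullback repulsive. (C3) $\lim_{t\to-\infty}|\tilde{\mathfrak{a}}^-(t)-\mathfrak{a}_c(t)|=0$ and $\lim_{t\to\infty}|\tilde{\mathfrak{r}}^+(t)-\mathfrak{r}_c(t)|=0$. (C4) Let $s\in\mathcal{R}_c^-$. Then $y_c(t,s,y_0)$ is bounded for $t\to-\infty$ if and only if $y_0\le\mathfrak{a}_c(s)$; and $\lim_{t\to-\infty}|\tilde{\mathfrak{r}}^-(t)-y_c(t,s,y_0)|=0$ if and only if $y_0<\mathfrak{a}_c(s)$. (C5) Let $s\in\mathcal{R}_c^+$. Then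 $y_c(t,s,y_0)$ is bounded for $t\to\infty$ if and only if $y_0\ge\mathfrak{r}_c(s)$; and $\lim_{t\to\infty}|\tilde{\mathfrak{a}}^+(t)-y_c(t,s,y_0)|=0$ if and only if $y_0>\mathfrak{r}_c(s)$. (C6) There exist solutions $y_c(t,s,y_0)$ which are unbounded at both endpoints of their maximal intervals of definition. More precisely, this situation corresponds to those points $(s,y_0)$ such that either $s<l_c^-$ and $y_0>\mathfrak{a}_c(s)$, or $l_c^-\le s\le l_c^+$ and $y_0\in\mathbb{R}$ (if $l_c^-\le l_c^+$), or $l_c^+<s$ and $y_0<\mathfrak{r}_c(s)$.
   Context: "Bounded solution" means defined and bounded on $\mathbb{R}$. $t\mapsto y_c(t,s,y_0)$ is the maximal solution of $(E_c)$ with $y_c(s,s,y_0)=y_0$. "Bounded for $t\to-\infty$" (resp. $t\to\infty$) means defined and bounded on $(-\infty,s]$ (resp. $[s,\infty)$). A globally defined solution $\tilde b$ of a scalar equation $x'=h(t,x)$ is hyperbolic if there are $k\ge1$, $\beta>0$ such that either $\exp\int_s^t\frac{\partial h}{\partial x}(l,\tilde b(l))\,dl\le k\,e^{-\beta(t-s)}$ whenever $t\ge s$ (attractive), or $\exp\int_s^t\frac{\partial h}{\partial x}(l,\tilde b(l))\,dl\le k\,e^{\beta(t-s)}$ whenever $t\le s$ (repulsive). The two hyperbolic solutions of $x'=-x^2+p(t)$ are denoted $\tilde a$ (attractive) and $\tilde r$ (repulsive); then $\inf_{t\in\mathbb R}(\tilde a(t)-\tilde r(t))>0$. Put $\tilde{\mathfrak{a}}^\pm:=\tilde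 a\pm1$ and $\tilde{\mathfrak{r}}^\pm:=\tilde r\pm1$; these are the hyperbolic solutions of the limit equations $y'=-(y\mp1)^2+p(t)$. $\mathcal{R}_c^-$ is the set of $s\in\mathbb{R}$ for which there is $y_0$ such that $y_c(\cdot,s,y_0)$ is bounded above on the part of its maximal interval to the left of $s$, and $\mathfrak{a}_c(s)$ is the maximum of these $y_0$. $\mathcal{R}_c^+$ is the set of $s$ for which there is $y_0$ such that $y_c(\cdot,s,y_0)$ is bounded below on the part of its maximal interval to the right of $s$, and $\mathfrak{r}_c(s)$ is the minimum of these $y_0$. Under the assumption on $p$, $\mathfrak{a}_c\colon\mathcal{R}_c^-\to\mathbb{R}$ and $\mathfrak{r}_c\colon\mathcal{R}_c^+\to\mathbb{R}$ exist for every $c>0$ and are solutions of $(E_c)$. A solution $\bar a\colon(-\infty,\beta)\to\mathbb{R}$ ($\beta\le\infty$) of $y'=h(t,y)$, with maximal solutions $y(t,s,y_0)$, is locally pullback attractive if there exist $s_0<\beta$ and $\delta>0$ such that if $s\le s_0$ and $|y_0-\bar a(s)|<\delta$ then $y(t,s,y_0)$ is defined for $t\in[s,s_0]$, and in addition $\lim_{s\to-\infty}\max_{y_0\in[\bar a(s)-\delta,\bar a(s)+\delta]}|\bar a(t)-y(t,s,y_0)|=0$ for all $t\le s_0$; equivalently (scalar case), if $s\le s_0$ then $y(t,s,\bar a(s)\pm\delta)$ are defined for $t\in[s,s_0]$ and $\lim_{s\to-\infty}|\bar a(t)-y(t,s,\bar a(s)\pm\delta)|=0$ for all $t\le s_0$.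 A solution $\bar r\colon(\alpha,\infty)\to\mathbb{R}$ ($\alpha\ge-\infty$) is locally pullback repulsive if $t\mapsto\bar r(-t)$ is a locally pullback attractive solution of the time-reversed equation $y'=-h(-t,y)$; equivalently, there exist $s_0>\alpha$ and $\delta>0$ such that if $s\ge s_0$ then $y(t,s,\bar r(s)\pm\delta)$ are defined for $t\in[s_0,s]$ and $\lim_{s\to\infty}|\bar r(t)-y(t,s,\bar r(s)\pm\delta)|=0$ for all $t\ge s_0$.
   Formalization: In (C6), if l_c^+ < s < l_c^-, the formal list requires both y_0 > a_c(s) and y_0 < r_c(s); the list as stated is false there, since points with y_0 ≥ r_c(s) or y_0 ≤ a_c(s) give solutions bounded at one end (e.g. p = 1/2, c large). *)

theory Defs
  imports "HOL-Analysis.Analysis"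
begin

section \<open>Scalar differential equations \<open>y' = h(t,y)\<close>\<close>

definition solves_on :: "(real \<Rightarrow> real \<Rightarrow> real) \<Rightarrow> (real \<Rightarrow> real) \<Rightarrow> real set \<Rightarrow> bool" where
  "solves_on h y I \<longleftrightarrow> (\<forall>t\<in>I. (y has_real_derivative h t (y t)) (at t within I))"

definition solves_ivp ::
  "(real \<Rightarrow> real \<Rightarrow> real) \<Rightarrow> real \<Rightarrow> real \<Rightarrow> real set \<Rightarrow> (real \<Rightarrow> real) \<Rightarrow> bool" where
  "solves_ivp h s y0 I y \<longleftrightarrow> open I \<and> is_interval I \<and> s \<in> I \<and> solves_on h y I \<and> y s = y0"

text \<open>
  The maximal solution \<open>t \<mapsto> y(t,s,y0)\<close> is encoded by its maximal interval of definition
  \<open>maxdom h s y0\<close> and by the values \<open>maxsol h t s y0\<close>, which are meaningful only for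
  \<open>t \<in> maxdom h s y0\<close> and when solutions of initial value problems are unique. Whenever a
  statement presupposes that the solution is defined somewhere, this is therefore required
  explicitly through \<open>maxdom\<close>.
\<close>

definition maxdom :: "(real \<Rightarrow> real \<Rightarrow> real) \<Rightarrow> real \<Rightarrow> real \<Rightarrow> real set" where
  "maxdom h s y0 = \<Union> {I. \<exists>y. solves_ivp h s y0 I y}"

definition maxsol :: "(real \<Rightarrow> real \<Rightarrow> real) \<Rightarrow> real \<Rightarrow> real \<Rightarrow> real \<Rightarrow> real" where
  "maxsol h t s y0 = (THE v. \<exists>I y. solves_ivp h s y0 I y \<and> t \<in> I \<and> v = y t)"

definition bounded_solution :: "(real \<Rightarrow> real \<Rightarrow> real) \<Rightarrow> (real \<Rightarrow> real) \<Rightarrow> bool" where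
  "bounded_solution h y \<longleftrightarrow> solves_on h y UNIV \<and> bounded (range y)"

definition bounded_to_minus_infinity :: "(real \<Rightarrow> real \<Rightarrow> real) \<Rightarrow> real \<Rightarrow> real \<Rightarrow> bool" where
  "bounded_to_minus_infinity h s y0 \<longleftrightarrow>
     {..s} \<subseteq> maxdom h s y0 \<and> bounded ((\<lambda>t. maxsol h t s y0) ` {..s})"

definition bounded_to_plus_infinity :: "(real \<Rightarrow> real \<Rightarrow> real) \<Rightarrow> real \<Rightarrow> real \<Rightarrow> bool" where
  "bounded_to_plus_infinity h s y0 \<longleftrightarrow>
     {s..} \<subseteq> maxdom h s y0 \<and> bounded ((\<lambda>t. maxsol h t s y0) ` {s..})"

definition approaches_at_minus_infinity ::
  "(real \<Rightarrow> real \<Rightarrow> real) \<Rightarrow> real \<Rightarrow> real \<Rightarrow> (real \<Rightarrow> real) \<Rightarrow> bool" where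
  "approaches_at_minus_infinity h s y0 g \<longleftrightarrow>
     {..s} \<subseteq> maxdom h s y0 \<and> ((\<lambda>t. \<bar>g t - maxsol h t s y0\<bar>) \<longlongrightarrow> 0) at_bot"

definition approaches_at_plus_infinity ::
  "(real \<Rightarrow> real \<Rightarrow> real) \<Rightarrow> real \<Rightarrow> real \<Rightarrow> (real \<Rightarrow> real) \<Rightarrow> bool" where
  "approaches_at_plus_infinity h s y0 g \<longleftrightarrow>
     {s..} \<subseteq> maxdom h s y0 \<and> ((\<lambda>t. \<bar>g t - maxsol h t s y0\<bar>) \<longlongrightarrow> 0) at_top"

text \<open>
  A solution is continuous, hence bounded on compact subintervals of its domain: being unbounded on
  the part of the domain to one side of \<open>s\<close> means being unbounded near that endpoint.
\<close>

definition unbounded_at_both_ends :: "(real \<Rightarrow> real \<Rightarrow> real) \<Rightarrow> real \<Rightarrow> real \<Rightarrow> bool" where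
  "unbounded_at_both_ends h s y0 \<longleftrightarrow>
     \<not> bounded ((\<lambda>t. maxsol h t s y0) ` (maxdom h s y0 \<inter> {..s})) \<and>
     \<not> bounded ((\<lambda>t. maxsol h t s y0) ` (maxdom h s y0 \<inter> {s..}))"


section \<open>Hyperbolic solutions\<close>

text \<open>\<open>LBINT l=s..t\<close> is the oriented integral, so it changes sign when \<open>t < s\<close>.\<close>

definition hyperbolic_attractive :: "(real \<Rightarrow> real \<Rightarrow> real) \<Rightarrow> (real \<Rightarrow> real) \<Rightarrow> bool" where
  "hyperbolic_attractive h b \<longleftrightarrow> solves_on h b UNIV \<and>
     (\<exists>k\<ge>1. \<exists>\<beta>>0. \<forall>s t. s \<le> t \<longrightarrow>
        exp (LBINT l=ereal s..ereal t. deriv (h l) (b l)) \<le> k * exp (- \<beta> * (t - s)))"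

definition hyperbolic_repulsive :: "(real \<Rightarrow> real \<Rightarrow> real) \<Rightarrow> (real \<Rightarrow> real) \<Rightarrow> bool" where
  "hyperbolic_repulsive h b \<longleftrightarrow> solves_on h b UNIV \<and>
     (\<exists>k\<ge>1. \<exists>\<beta>>0. \<forall>s t. t \<le> s \<longrightarrow>
        exp (LBINT l=ereal s..ereal t. deriv (h l) (b l)) \<le> k * exp (\<beta> * (t - s)))"

definition hyperbolic :: "(real \<Rightarrow> real \<Rightarrow> real) \<Rightarrow> (real \<Rightarrow> real) \<Rightarrow> bool" where
  "hyperbolic h b \<longleftrightarrow> hyperbolic_attractive h b \<or> hyperbolic_repulsive h b"


section \<open>Local pullback attraction and repulsion\<close>

text \<open>
  The supremum is the maximum of a continuous function on a compact interval; for it to make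
  sense, the solutions have to be defined for all \<open>y0\<close> in the closed interval
  \<open>[b(s) - \<delta>, b(s) + \<delta>]\<close>.
\<close>

definition locally_pullback_attractive ::
  "(real \<Rightarrow> real \<Rightarrow> real) \<Rightarrow> ereal \<Rightarrow> (real \<Rightarrow> real) \<Rightarrow> bool" where
  "locally_pullback_attractive h \<beta> b \<longleftrightarrow>
     solves_on h b {t. ereal t < \<beta>} \<and>
     (\<exists>s0 \<delta>. ereal s0 < \<beta> \<and> \<delta> > 0 \<and>
        (\<forall>s\<le>s0. \<forall>y0. \<bar>y0 - b s\<bar> \<le> \<delta> \<longrightarrow> {s..s0} \<subseteq> maxdom h s y0) \<and>
        (\<forall>t\<le>s0. ((\<lambda>s. SUP y0\<in>{b s - \<delta>..b s + \<delta>}. \<bar>b t - maxsol h t s y0\<bar>) \<longlongrightarrow> 0) at_bot))"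

definition locally_pullback_repulsive ::
  "(real \<Rightarrow> real \<Rightarrow> real) \<Rightarrow> ereal \<Rightarrow> (real \<Rightarrow> real) \<Rightarrow> bool" where
  "locally_pullback_repulsive h \<alpha> b \<longleftrightarrow>
     solves_on h b {t. \<alpha> < ereal t} \<and>
     locally_pullback_attractive (\<lambda>t y. - h (- t) y) (- \<alpha>) (\<lambda>t. b (- t))"


section \<open>The quadratic equations\<close>

definition quad :: "(real \<Rightarrow> real) \<Rightarrow> real \<Rightarrow> real \<Rightarrow> real" where
  "quad p t x = - x\<^sup>2 + p t"

definition Ec :: "(real \<Rightarrow> real) \<Rightarrow> real \<Rightarrow> real \<Rightarrow> real \<Rightarrow> real" where
  "Ec p c t y = - (y - 2 / pi * arctan (c * t))\<^sup>2 + p t"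

text \<open>
  When \<open>x' = - x\<^sup>2 + p(t)\<close> has exactly two hyperbolic solutions, exactly one of them is attractive
  and the other one is repulsive.
\<close>

definition a_tilde :: "(real \<Rightarrow> real) \<Rightarrow> real \<Rightarrow> real" where
  "a_tilde p = (THE b. hyperbolic_attractive (quad p) b)"

definition r_tilde :: "(real \<Rightarrow> real) \<Rightarrow> real \<Rightarrow> real" where
  "r_tilde p = (THE b. hyperbolic_repulsive (quad p) b)"

definition a_plus :: "(real \<Rightarrow> real) \<Rightarrow> real \<Rightarrow> real" where
  "a_plus p t = a_tilde p t + 1"

definition a_minus :: "(real \<Rightarrow> real) \<Rightarrow> real \<Rightarrow> real" where
  "a_minus p t = a_tilde p t - 1"

definition r_plus :: "(real \<Rightarrow> real) \<Rightarrow> real \<Rightarrow> real" where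
  "r_plus p t = r_tilde p t + 1"

definition r_minus :: "(real \<Rightarrow> real) \<Rightarrow> real \<Rightarrow> real" where
  "r_minus p t = r_tilde p t - 1"

definition bdd_above_left :: "(real \<Rightarrow> real) \<Rightarrow> real \<Rightarrow> real \<Rightarrow> real \<Rightarrow> bool" where
  "bdd_above_left p c s y0 \<longleftrightarrow>
     bdd_above ((\<lambda>t. maxsol (Ec p c) t s y0) ` (maxdom (Ec p c) s y0 \<inter> {..s}))"

definition bdd_below_right :: "(real \<Rightarrow> real) \<Rightarrow> real \<Rightarrow> real \<Rightarrow> real \<Rightarrow> bool" where
  "bdd_below_right p c s y0 \<longleftrightarrow>
     bdd_below ((\<lambda>t. maxsol (Ec p c) t s y0) ` (maxdom (Ec p c) s y0 \<inter> {s..}))"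

definition R_minus :: "(real \<Rightarrow> real) \<Rightarrow> real \<Rightarrow> real set" where
  "R_minus p c = {s. \<exists>y0. bdd_above_left p c s y0}"

definition R_plus :: "(real \<Rightarrow> real) \<Rightarrow> real \<Rightarrow> real set" where
  "R_plus p c = {s. \<exists>y0. bdd_below_right p c s y0}"

text \<open>Meaningful on \<open>R_minus p c\<close> and \<open>R_plus p c\<close>, respectively.\<close>

definition a_c :: "(real \<Rightarrow> real) \<Rightarrow> real \<Rightarrow> real \<Rightarrow> real" where
  "a_c p c s = (GREATEST y0. bdd_above_left p c s y0)"

definition r_c :: "(real \<Rightarrow> real) \<Rightarrow> real \<Rightarrow> real \<Rightarrow> real" where
  "r_c p c s = (LEAST y0. bdd_below_right p c s y0)"

end

theory Submission
  imports Defs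
begin

text \<open>
  Write \<open>g(t) = 2/\<pi> arctan(ct)\<close>. The substitution \<open>x = y - g(t)\<close> turns \<open>(E_c)\<close> into the Riccati equation
  \<open>x' = -x\<^sup>2 + p(t) - \<epsilon>(t)\<close> with \<open>\<epsilon> = g'\<close>: a perturbation of \<open>x' = -x\<^sup>2 + p(t)\<close> by a strictly negative
  forcing that vanishes at both ends. Since \<open>g \<rightarrow> -1\<close> at \<open>-\<infinity>\<close>, the statements about \<open>y\<close> there say that
  \<open>x\<close> approaches the attractive solution \<open>a\<close> or the repulsive solution \<open>r\<close> of the unperturbed equation.
  The reflection \<open>z(t) = -y(-t)\<close> maps \<open>(E_c)\<close> to the same equation for \<open>p(-t)\<close> and interchanges
  attraction and repulsion, so only the behaviour at \<open>-\<infinity>\<close> has to be studied.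

  A Riccati equation \<open>x' = -x\<^sup>2 + q\<close> is linear in disguise: \<open>x = w'/w\<close> with \<open>w'' = q w\<close>. Linear solutions
  exist globally, so a maximal solution \<open>x\<close> lives exactly as long as \<open>w > 0\<close>, and it can only be lost
  backwards by blowing up to \<open>+\<infinity>\<close>. Boundedness above to the left of \<open>s\<close> therefore means positivity
  of \<open>w\<close> on \<open>(-\<infinity>,s]\<close>. This condition is closed in the initial value, because a limit of positive
  solutions is nonnegative and a nontrivial solution has no double zero. Hence the set of good initial
  values is a half-line \<open>(-\<infinity>, \<alpha>(s)]\<close> (\<open>left_global_iff_le_top\<close>), and \<open>\<alpha>\<close> is a solution that must die by
  running to \<open>-\<infinity>\<close> at a finite time: otherwise it would be a bounded solution of \<open>(E_c)\<close>
  (\<open>left_domain_halfline\<close>).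

  Besides singling out \<open>a\<close> and \<open>r\<close>, hyperbolicity enters only through the gap \<open>a - r \<ge> d0 > 0\<close>
  (\<open>hyperbolic_gap\<close>). Differences of solutions divided by \<open>a - r\<close> satisfy scalar linear equations
  whose coefficient and forcing have a sign in the regions of interest. The
  curves \<open>r + \<kappa>(a - r)\<close> with \<open>0 < \<kappa> < 1\<close> are crossed upwards only, as soon as \<open>\<epsilon>\<close> is small. Everything
  below such a curve therefore extends to \<open>-\<infinity>\<close>; letting \<open>\<kappa> \<rightarrow> 1\<close> gives \<open>\<alpha> - a \<rightarrow> 0\<close>
  (\<open>top_left_tendsto_a\<close>), and letting \<open>\<kappa> \<rightarrow> 0\<close> shows that everything below \<open>\<alpha>\<close> approaches \<open>r\<close>
  (\<open>below_top_tendsto_r\<close>). Solutions starting near \<open>\<alpha>\<close> are trapped above the curve \<open>\<kappa> = 1/2\<close>, where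
  distances to \<open>\<alpha>\<close> contract exponentially (\<open>top_left_pullback\<close>). A solution is unbounded at both ends
  exactly when it lies neither on or below \<open>\<alpha>\<close> nor on or above its mirror image, wherever these are
  defined, which is the last assertion.
\<close>

section \<open>Differential inequalities\<close>

text \<open>
  At the last point where \<open>f \<ge> 0\<close> the function vanishes, and its positive derivative there makes it
  positive again. As only zeros of \<open>f\<close> are constrained, starting on the barrier is permitted.
\<close>

lemma nonneg_barrier:
  fixes f f' :: "real \<Rightarrow> real"
  assumes ab: "a \<le> b"
    and der: "\<And>t. a \<le> t \<Longrightarrow> t \<le> b \<Longrightarrow> (f has_real_derivative f' t) (at t)"
    and up: "\<And>t. a \<le> t \<Longrightarrow> t \<le> b \<Longrightarrow> f t = 0 \<Longrightarrow> f' t > 0"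
    and fa: "f a \<ge> 0"
  shows "f b \<ge> 0"
proof (rule ccontr)
  assume "\<not> f b \<ge> 0"
  then have fb: "f b < 0" by simp
  have cont: "continuous_on {a..b} f"
    using der by (meson DERIV_isCont atLeastAtMost_iff continuous_at_imp_continuous_on)
  define S where "S = {t \<in> {a..b}. f t \<ge> 0}"
  have "closed S"
    unfolding S_def using continuous_on_closed_Collect_le[OF continuous_on_const cont closed_atLeastAtMost, of 0]
    by simp
  then have "compact S"
    unfolding S_def by (metis (no_types, lifting) bounded_closed_interval bounded_subset compact_eq_bounded_closed mem_Collect_eq subsetI)
  moreover have "a \<in> S" using fa ab by (simp add: S_def)
  ultimately obtain m where m: "m \<in> S" "\<And>t. t \<in> S \<Longrightarrow> t \<le> m"
    using compact_attains_sup[of S] by blast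
  have mb: "m < b" using m(1) fb by (cases "m = b") (auto simp: S_def)
  have am: "a \<le> m" using m(1) by (auto simp: S_def)
  have neg: "f t < 0" if "m < t" "t \<le> b" for t
    using m(2)[of t] that am by (auto simp: S_def not_le[symmetric])
  have "f m = 0"
  proof (rule ccontr)
    assume "f m \<noteq> 0"
    then have "f m > 0" using m(1) by (auto simp: S_def)
    moreover have "continuous_on {m..b} f" using cont am by (auto intro: continuous_on_subset)
    ultimately obtain t where "m \<le> t" "t \<le> b" "f t = 0"
      using IVT2'[of f b 0 m] fb mb by force
    then show False using neg[of t] \<open>f m > 0\<close> by (cases "t = m") auto
  qed
  then have "f' m > 0" using up am mb by simp
  then obtain e where e: "e > 0" "\<And>h. h > 0 \<Longrightarrow> h < e \<Longrightarrow> f m < f (m + h)"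
    using DERIV_pos_inc_right[OF der[of m]] am mb by force
  define h where "h = min (e/2) (b - m)"
  have "h > 0" "h < e" "m + h \<le> b" using e(1) mb by (auto simp: h_def)
  then have "f m < f (m + h)" "f (m + h) < 0" using e(2) neg[of "m + h"] by auto
  then show False using \<open>f m = 0\<close> by simp
qed

lemma nonneg_barrier_backward:
  fixes f f' :: "real \<Rightarrow> real"
  assumes ab: "a \<le> b"
    and der: "\<And>t. a \<le> t \<Longrightarrow> t \<le> b \<Longrightarrow> (f has_real_derivative f' t) (at t)"
    and down: "\<And>t. a \<le> t \<Longrightarrow> t \<le> b \<Longrightarrow> f t = 0 \<Longrightarrow> f' t < 0"
    and fb: "f b \<ge> 0"
  shows "f a \<ge> 0"
proof -
  have "f (- (- a)) \<ge> 0"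
  proof (rule nonneg_barrier[where a = "- b" and f = "\<lambda>t. f (- t)" and f' = "\<lambda>t. - f' (- t)"])
    fix t :: real assume "- b \<le> t" "t \<le> - a"
    then have "(f has_real_derivative f' (- t)) (at (- t))" using der[of "- t"] by simp
    then show "((\<lambda>t. f (- t)) has_real_derivative - f' (- t)) (at t)"
      using DERIV_mirror by blast
  qed (use assms in auto)
  then show ?thesis by simp
qed

lemma exp_growth_ge:
  fixes f f' :: "real \<Rightarrow> real"
  assumes ab: "a \<le> b"
    and der: "\<And>t. a \<le> t \<Longrightarrow> t \<le> b \<Longrightarrow> (f has_real_derivative f' t) (at t)"
    and ge: "\<And>t. a \<le> t \<Longrightarrow> t \<le> b \<Longrightarrow> f' t \<ge> k * f t"
  shows "f b \<ge> f a * exp (k * (b - a))"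
proof -
  have "(\<lambda>t. f t * exp (- k * t)) a \<le> (\<lambda>t. f t * exp (- k * t)) b"
  proof (rule DERIV_nonneg_imp_nondecreasing[OF ab])
    fix t assume t: "a \<le> t" "t \<le> b"
    have "((\<lambda>t. f t * exp (- k * t)) has_real_derivative (f' t - k * f t) * exp (- k * t)) (at t)"
      using der[OF t] by (auto intro!: derivative_eq_intros simp: algebra_simps)
    then show "\<exists>y. ((\<lambda>t. f t * exp (- k * t)) has_real_derivative y) (at t) \<and> 0 \<le> y"
      using ge[OF t] by (metis diff_ge_0_iff_ge exp_ge_zero mult_nonneg_nonneg)
  qed
  then have "f a * exp (- k * a) * exp (k * b) \<le> f b * exp (- k * b) * exp (k * b)"
    by (simp add: mult_right_mono)
  moreover have "exp (- k * a) * exp (k * b) = exp (k * (b - a))"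
    by (simp add: exp_add[symmetric] algebra_simps)
  moreover have "exp (- k * b) * exp (k * b) = 1"
    by (simp add: exp_add[symmetric])
  ultimately show ?thesis by (metis mult.assoc mult.right_neutral)
qed

lemma exp_growth_le:
  fixes f f' :: "real \<Rightarrow> real"
  assumes ab: "a \<le> b"
    and der: "\<And>t. a \<le> t \<Longrightarrow> t \<le> b \<Longrightarrow> (f has_real_derivative f' t) (at t)"
    and le: "\<And>t. a \<le> t \<Longrightarrow> t \<le> b \<Longrightarrow> f' t \<le> k * f t"
  shows "f b \<le> f a * exp (k * (b - a))"
proof -
  have "(\<lambda>t. - f t) b \<ge> (\<lambda>t. - f t) a * exp (k * (b - a))"
    using der le by (intro exp_growth_ge[OF ab, where f' = "\<lambda>t. - f' t"]) (auto intro: DERIV_minus)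
  then show ?thesis by simp
qed

lemma continuous_real_antiderivative:
  fixes f :: "real \<Rightarrow> real"
  assumes "continuous_on UNIV f"
  obtains F where "F s = 0" "\<And>t. (F has_real_derivative f t) (at t)"
proof -
  have "\<exists>F. \<forall>x::real. -\<infinity> < ereal x \<longrightarrow> ereal x < \<infinity> \<longrightarrow> (F has_vector_derivative f x) (at x)"
    by (rule einterval_antiderivative) (use assms in \<open>auto simp: continuous_on_eq_continuous_at\<close>)
  then obtain F where F: "\<And>t. (F has_real_derivative f t) (at t)"
    by (auto simp: has_real_derivative_iff_has_vector_derivative)
  have "((\<lambda>t. F t - F s) has_real_derivative f t) (at t)" for t
    using F[of t] by (auto intro!: derivative_eq_intros)
  then show ?thesis using that[of "\<lambda>t. F t - F s"] by simp
qed

text \<open>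
  The factor is the exponential of the integral of \<open>k\<close>. Its positivity is all that matters: a solution
  of a linear homogeneous equation keeps its sign, and it vanishes identically if it vanishes once.
\<close>

lemma linear_homogeneous_factor:
  fixes n k :: "real \<Rightarrow> real"
  assumes ab: "a \<le> b"
    and der: "\<And>t. a \<le> t \<Longrightarrow> t \<le> b \<Longrightarrow> (n has_real_derivative k t * n t) (at t)"
    and cont: "continuous_on {a..b} k"
  obtains E where "E > 0" "n b = E * n a"
proof (cases "a = b")
  case True then show ?thesis using that[of 1] by simp
next
  case False
  then have ab': "a < b" using ab by simp
  obtain g where g: "\<And>x. x \<in> {a..b} \<Longrightarrow> (g has_vector_derivative k x) (at x within {a..b})"
    using antiderivative_continuous[OF cont] by blast
  have "(g has_real_derivative k x) (at x)" if "a < x" "x < b" for x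
    using g[of x] that at_within_Icc_at[of a x b] by (simp add: has_real_derivative_iff_has_vector_derivative)
  then have der0: "((\<lambda>t. n t * exp (- g t)) has_real_derivative 0) (at x)" if "a < x" "x < b" for x
    using der[of x] that by (auto intro!: derivative_eq_intros)
  have "continuous_on {a..b} n"
    using der by (meson DERIV_isCont atLeastAtMost_iff continuous_at_imp_continuous_on)
  moreover have "continuous_on {a..b} g"
    using g by (meson continuous_on_vector_derivative)
  ultimately have "continuous_on {a..b} (\<lambda>t. n t * exp (- g t))"
    by (intro continuous_on_mult continuous_on_exp continuous_on_minus)
  from DERIV_isconst_end[OF ab' this der0] have "n b * exp (- g b) = n a * exp (- g a)" .
  then have "n b = exp (g b - g a) * n a"
    by (simp add: exp_diff exp_minus field_simps)
  then show ?thesis by (rule that[OF exp_gt_zero])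
qed

lemma linear_homogeneous_factor_interval:
  fixes n k :: "real \<Rightarrow> real"
  assumes I: "is_interval I" "s \<in> I" "t \<in> I"
    and der: "\<And>t. t \<in> I \<Longrightarrow> (n has_real_derivative k t * n t) (at t)"
    and cont: "continuous_on I k"
  obtains E where "E > 0" "n t = E * n s"
proof (cases "s \<le> t")
  case True
  then have sub: "{s..t} \<subseteq> I" using I mem_is_interval_1_I[of I s t] by auto
  obtain E where "E > 0" "n t = E * n s"
    by (rule linear_homogeneous_factor[OF True, of n k])
      (use der sub cont in \<open>auto intro: continuous_on_subset\<close>)
  then show ?thesis by (rule that)
next
  case False
  then have ts: "t \<le> s" by simp
  then have sub: "{t..s} \<subseteq> I" using I mem_is_interval_1_I[of I t s] by auto
  obtain E where "E > 0" "n s = E * n t"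
    by (rule linear_homogeneous_factor[OF ts, of n k])
      (use der sub cont in \<open>auto intro: continuous_on_subset\<close>)
  then show ?thesis using that[of "1 / E"] by simp
qed

text \<open>
  Backwards in time \<open>f\<close> grows at least exponentially, so a positive value contradicts the bound. This is
  how trajectories are excluded from regions in which they would be repelled for all negative times.
\<close>

lemma no_backward_growth:
  fixes f f' :: "real \<Rightarrow> real"
  assumes der: "\<And>t. t \<le> s \<Longrightarrow> (f has_real_derivative f' t) (at t)"
    and dec: "\<And>t. t \<le> s \<Longrightarrow> f' t \<le> - k * f t" and k: "k > 0"
    and bd: "\<And>t. t \<le> s \<Longrightarrow> f t \<le> B"
  shows "f s \<le> 0"
proof (rule ccontr)
  assume "\<not> f s \<le> 0"
  then have fs: "f s > 0" by simp
  then have B: "B > 0" using bd[of s] by simp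
  \<comment> \<open>Going back by \<open>h\<close>, already the linear part of the exponential exceeds the bound \<open>B\<close>.\<close>
  define h where "h = B / (f s * k)"
  have h: "h > 0" using B fs k by (simp add: h_def)
  have "f s \<le> f (s - h) * exp (- k * (s - (s - h)))"
  proof (rule exp_growth_le[where f' = f'])
    show "s - h \<le> s" using h by simp
  qed (blast intro: der dec)+
  also have "\<dots> \<le> B * exp (- k * h)" using bd[of "s - h"] h by (simp add: mult_right_mono)
  finally have "f s * exp (k * h) \<le> B" by (simp add: exp_minus field_simps)
  moreover have "f s * (1 + k * h) \<le> f s * exp (k * h)" using fs exp_ge_add_one_self[of "k * h"]
    by (simp add: mult_left_mono)
  moreover have "f s * (1 + k * h) = f s + B" using fs k by (simp add: h_def field_simps)
  ultimately show False using fs by simp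
qed

section \<open>Changes of variables\<close>

text \<open>
  The right-hand side of the equation satisfied by \<open>z(t) = \<rho> y(\<sigma>t) + G(\<sigma>t)\<close> when \<open>y' = h(t,y)\<close> and
  \<open>\<sigma>, \<rho> \<in> {1,-1}\<close>. It covers the shift by a function of time, the reflection \<open>-y(-t)\<close> and the change
  of sign \<open>-y(t)\<close>.
\<close>

definition conjugate_rhs ::
  "real \<Rightarrow> real \<Rightarrow> (real \<Rightarrow> real) \<Rightarrow> (real \<Rightarrow> real) \<Rightarrow> (real \<Rightarrow> real \<Rightarrow> real) \<Rightarrow> real \<Rightarrow> real \<Rightarrow> real" where
  "conjugate_rhs \<sigma> \<rho> G G' h t z = \<sigma> * (\<rho> * h (\<sigma> * t) (\<rho> * (z - G (\<sigma> * t))) + G' (\<sigma> * t))"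

definition unique_solutions :: "(real \<Rightarrow> real \<Rightarrow> real) \<Rightarrow> bool" where
  "unique_solutions h \<longleftrightarrow> (\<forall>s y0 I J y z t. solves_ivp h s y0 I y \<longrightarrow> solves_ivp h s y0 J z \<longrightarrow>
     t \<in> I \<longrightarrow> t \<in> J \<longrightarrow> y t = z t)"

lemma solves_ivp_iff:
  "solves_ivp h s y0 I y \<longleftrightarrow> open I \<and> is_interval I \<and> s \<in> I \<and> y s = y0 \<and>
     (\<forall>t\<in>I. (y has_real_derivative h t (y t)) (at t))"
  unfolding solves_ivp_def solves_on_def using at_within_open[of _ I] by auto

lemma maxsol_eqI:
  assumes "unique_solutions h" "solves_ivp h s y0 I y" "t \<in> I"
  shows "maxsol h t s y0 = y t"
  unfolding maxsol_def using assms unfolding unique_solutions_def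
  by (intro the_equality) blast+

locale conjugacy =
  fixes \<sigma> \<rho> :: real and G G' :: "real \<Rightarrow> real" and h h' :: "real \<Rightarrow> real \<Rightarrow> real"
  assumes sgn: "\<sigma> = 1 \<or> \<sigma> = -1" "\<rho> = 1 \<or> \<rho> = -1"
    and G: "\<And>t. (G has_real_derivative G' t) (at t)"
    and h': "h' = conjugate_rhs \<sigma> \<rho> G G' h"
begin

lemma solves_ivp_forward:
  assumes "solves_ivp h s y0 I y"
  shows "solves_ivp h' (\<sigma> * s) (\<rho> * y0 + G s) ((*) \<sigma> ` I) (\<lambda>t. \<rho> * y (\<sigma> * t) + G (\<sigma> * t))"
proof -
  have \<sigma>\<sigma>: "\<sigma> * (\<sigma> * t) = t" "\<rho> * (\<rho> * t) = t" for t using sgn by auto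
  have img: "(*) \<sigma> ` I = {t. \<sigma> * t \<in> I}" 
    by (auto simp: \<sigma>\<sigma>(1) image_iff intro!: bexI[of _ "\<sigma> * _"])
  have I: "open I" "is_interval I" "s \<in> I" "y s = y0"
    and der: "\<And>t. t \<in> I \<Longrightarrow> (y has_real_derivative h t (y t)) (at t)"
    using assms by (auto simp: solves_ivp_iff)
  have "open {t. \<sigma> * t \<in> I}"
    using open_vimage[OF I(1), of "(*) \<sigma>"] by (simp add: vimage_def continuous_on_mult_left)
  moreover have "is_interval ((*) \<sigma> ` I)"
    using I(2) by (simp add: is_interval_convex_1 convex_linear_image)
  moreover have "((\<lambda>t. \<rho> * y (\<sigma> * t) + G (\<sigma> * t)) has_real_derivative
      h' t (\<rho> * y (\<sigma> * t) + G (\<sigma> * t))) (at t)" if "\<sigma> * t \<in> I" for t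
  proof -
    have "((\<lambda>t. y (\<sigma> * t)) has_real_derivative h (\<sigma> * t) (y (\<sigma> * t)) * \<sigma>) (at t)"
      by (rule DERIV_chain'[of "(*) \<sigma>" \<sigma>]) (use der[OF that] in \<open>auto intro!: derivative_eq_intros\<close>)
    moreover have "((\<lambda>t. G (\<sigma> * t)) has_real_derivative G' (\<sigma> * t) * \<sigma>) (at t)"
      by (rule DERIV_chain'[of "(*) \<sigma>" \<sigma>]) (use G in \<open>auto intro!: derivative_eq_intros\<close>)
    ultimately show ?thesis
      by (auto intro!: derivative_eq_intros simp: h' conjugate_rhs_def \<sigma>\<sigma> algebra_simps)
  qed
  ultimately show ?thesis
    using I by (simp add: solves_ivp_iff img \<sigma>\<sigma>)
qed

text \<open>
  The inverse of such a change of variables is again one with the same signs, so transport in one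
  direction yields transport in the other.
\<close>

lemma inverse_conjugacy: "conjugacy \<sigma> \<rho> (\<lambda>t. - \<rho> * G (\<sigma> * t)) (\<lambda>t. - \<sigma> * \<rho> * G' (\<sigma> * t)) h' h"
proof
  fix t
  show "((\<lambda>t. - \<rho> * G (\<sigma> * t)) has_real_derivative - \<sigma> * \<rho> * G' (\<sigma> * t)) (at t)"
    using DERIV_chain'[of "(*) \<sigma>" \<sigma> t UNIV G "G' (\<sigma> * t)"] G
    by (auto intro!: derivative_eq_intros)
qed (use sgn in \<open>auto simp: fun_eq_iff h' conjugate_rhs_def algebra_simps\<close>)

lemma solves_ivp_backward:
  assumes "solves_ivp h' (\<sigma> * s) (\<rho> * y0 + G s) J z"
  shows "solves_ivp h s y0 ((*) \<sigma> ` J) (\<lambda>t. \<rho> * (z (\<sigma> * t) - G t))"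
proof -
  have \<sigma>\<sigma>: "\<sigma> * (\<sigma> * t) = t" "\<rho> * (\<rho> * t) = t" for t using sgn by auto
  show ?thesis
    using conjugacy.solves_ivp_forward[OF inverse_conjugacy assms]
    by (simp add: \<sigma>\<sigma> right_diff_distrib distrib_left)
qed

lemma maxdom_eq: "maxdom h' (\<sigma> * s) (\<rho> * y0 + G s) = (*) \<sigma> ` maxdom h s y0"
proof -
  have \<sigma>\<sigma>: "\<sigma> * (\<sigma> * t) = t" for t using sgn by auto
  show ?thesis
  proof (intro equalityI subsetI)
    fix t assume "t \<in> maxdom h' (\<sigma> * s) (\<rho> * y0 + G s)"
    then obtain J z where "solves_ivp h' (\<sigma> * s) (\<rho> * y0 + G s) J z" "t \<in> J"
      by (auto simp: maxdom_def)
    then have "\<sigma> * t \<in> maxdom h s y0"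
      unfolding maxdom_def using solves_ivp_backward by blast
    then show "t \<in> (*) \<sigma> ` maxdom h s y0" using \<sigma>\<sigma>[of t] by (metis imageI)
  next
    fix t assume "t \<in> (*) \<sigma> ` maxdom h s y0"
    then obtain I y u where "solves_ivp h s y0 I y" "u \<in> I" "t = \<sigma> * u"
      by (auto simp: maxdom_def)
    then show "t \<in> maxdom h' (\<sigma> * s) (\<rho> * y0 + G s)"
      unfolding maxdom_def using solves_ivp_forward by blast
  qed
qed

lemma unique_solutions_conjugate:
  assumes "unique_solutions h"
  shows "unique_solutions h'"
  unfolding unique_solutions_def
proof (intro allI impI)
  fix s y0 I J y z t
  assume *: "solves_ivp h' s y0 I y" "solves_ivp h' s y0 J z" "t \<in> I" "t \<in> J"
  have \<sigma>\<sigma>: "\<sigma> * (\<sigma> * t) = t" "\<rho> * (\<rho> * t) = t" for t using sgn by auto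
  define s' y' where "s' = \<sigma> * s" and "y' = \<rho> * (y0 - G s')"
  have eq: "s = \<sigma> * s'" "y0 = \<rho> * y' + G s'" by (simp_all add: s'_def y'_def \<sigma>\<sigma>)
  have "\<rho> * (y (\<sigma> * (\<sigma> * t)) - G (\<sigma> * t)) = \<rho> * (z (\<sigma> * (\<sigma> * t)) - G (\<sigma> * t))"
    using assms solves_ivp_backward[OF *(1)[unfolded eq]] solves_ivp_backward[OF *(2)[unfolded eq]] *(3,4)
    unfolding unique_solutions_def by blast
  then show "y t = z t" using sgn by (auto simp: \<sigma>\<sigma>)
qed

text \<open>
  The value of \<open>maxsol\<close> is a definite description: outside \<open>maxdom\<close>, or without uniqueness, it is an
  unspecified number about which nothing can be transported.
\<close>

lemma maxsol_eq:
  assumes "unique_solutions h" "t \<in> maxdom h s y0"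
  shows "maxsol h' (\<sigma> * t) (\<sigma> * s) (\<rho> * y0 + G s) = \<rho> * maxsol h t s y0 + G t"
proof -
  have \<sigma>\<sigma>: "\<sigma> * (\<sigma> * t) = t" for t using sgn by auto
  obtain I y where y: "solves_ivp h s y0 I y" "t \<in> I" using assms(2) by (auto simp: maxdom_def)
  show ?thesis
    using maxsol_eqI[OF unique_solutions_conjugate[OF assms(1)] solves_ivp_forward[OF y(1)], of "\<sigma> * t"]
      maxsol_eqI[OF assms(1) y] imageI[OF y(2), of "(*) \<sigma>"]
    by (simp only: \<sigma>\<sigma>)
qed

end

section \<open>The second order linear equation\<close>

text \<open>
  The equation \<open>w'' = q w\<close> as a first order system with \<open>v = w'\<close>.
\<close>

definition hill_pair :: "(real \<Rightarrow> real) \<Rightarrow> (real \<Rightarrow> real) \<Rightarrow> (real \<Rightarrow> real) \<Rightarrow> bool" where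
  "hill_pair q w v \<longleftrightarrow> (\<forall>t. (w has_real_derivative v t) (at t) \<and> (v has_real_derivative q t * w t) (at t))"

definition antideriv :: "real \<Rightarrow> (real \<Rightarrow> real) \<Rightarrow> real \<Rightarrow> real" where
  "antideriv s f = (SOME F. F s = 0 \<and> (\<forall>t. (F has_real_derivative f t) (at t)))"

lemma antideriv:
  assumes "continuous_on UNIV f"
  shows "antideriv s f s = 0" "(antideriv s f has_real_derivative f t) (at t)"
proof -
  have "\<exists>F. F s = 0 \<and> (\<forall>t. (F has_real_derivative f t) (at t))"
    using continuous_real_antiderivative[OF assms] by metis
  from someI_ex[OF this]
  show "antideriv s f s = 0" "(antideriv s f has_real_derivative f t) (at t)"
    unfolding antideriv_def by auto
qed

text \<open>
  Integrating against an exponential weight of rate \<open>L\<close> gains the factor \<open>1/L\<close>, which makes the terms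
  of the Picard series decay geometrically and not merely on short intervals.
\<close>

lemma antideriv_exp_bound:
  fixes f F :: "real \<Rightarrow> real"
  assumes F: "F s = 0" "\<And>t. (F has_real_derivative f t) (at t)"
    and bd: "\<And>t. \<bar>f t\<bar> \<le> C * exp (L * \<bar>t - s\<bar>)" and L: "L > 0"
  shows "\<bar>F t\<bar> \<le> C / L * exp (L * \<bar>t - s\<bar>)"
proof -
  have C: "C \<ge> 0" using bd[of s] by simp
  have one: "H t \<le> C / L * exp (L * \<bar>t - s\<bar>)"
    if H: "H s = 0" "\<And>t. (H has_real_derivative h t) (at t)" and hb: "\<And>t. \<bar>h t\<bar> \<le> C * exp (L * \<bar>t - s\<bar>)"
    for H h
  proof (cases "s \<le> t")
    case True
    have "(\<lambda>u. C / L * exp (L * (u - s)) - H u) s \<le> (\<lambda>u. C / L * exp (L * (u - s)) - H u) t"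
    proof (rule DERIV_nonneg_imp_nondecreasing[OF True])
      fix u assume "s \<le> u" "u \<le> t"
      have "((\<lambda>u. C / L * exp (L * (u - s)) - H u) has_real_derivative C * exp (L * (u - s)) - h u) (at u)"
        using L H(2)[of u] by (auto intro!: derivative_eq_intros)
      moreover have "C * exp (L * (u - s)) - h u \<ge> 0" using hb[of u] \<open>s \<le> u\<close> by simp
      ultimately show "\<exists>y. ((\<lambda>u. C / L * exp (L * (u - s)) - H u) has_real_derivative y) (at u) \<and> 0 \<le> y"
        by blast
    qed
    moreover have "C / L \<ge> 0" using C L by simp
    ultimately show ?thesis using H(1) True by simp
  next
    case False
    then have ts: "t \<le> s" by simp
    have "(\<lambda>u. C / L * exp (L * (s - u)) - H u) t \<ge> (\<lambda>u. C / L * exp (L * (s - u)) - H u) s"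
    proof (rule DERIV_nonpos_imp_nonincreasing[OF ts])
      fix u assume "t \<le> u" "u \<le> s"
      have "((\<lambda>u. C / L * exp (L * (s - u)) - H u) has_real_derivative - C * exp (L * (s - u)) - h u) (at u)"
        using L H(2)[of u] by (auto intro!: derivative_eq_intros)
      moreover have "- C * exp (L * (s - u)) - h u \<le> 0" using hb[of u] \<open>u \<le> s\<close> by (simp add: abs_minus_commute)
      ultimately show "\<exists>y. ((\<lambda>u. C / L * exp (L * (s - u)) - H u) has_real_derivative y) (at u) \<and> y \<le> 0"
        by blast
    qed
    moreover have "C / L \<ge> 0" using C L by simp
    ultimately show ?thesis using H(1) False by simp
  qed
  have "F t \<le> C / L * exp (L * \<bar>t - s\<bar>)" by (rule one[OF F bd])
  moreover have "- F t \<le> C / L * exp (L * \<bar>t - s\<bar>)"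
    by (rule one[where h = "\<lambda>t. - f t" and H = "\<lambda>t. - F t"]) (use F bd in \<open>auto intro: DERIV_minus\<close>)
  ultimately show ?thesis by linarith
qed

text \<open>
  The increments of the Picard iteration for \<open>w'' = q w\<close>, \<open>w(s) = A\<close>, \<open>w'(s) = B\<close>; the solution is
  their sum.
\<close>

primrec hill_terms ::
  "(real \<Rightarrow> real) \<Rightarrow> real \<Rightarrow> real \<Rightarrow> real \<Rightarrow> nat \<Rightarrow> (real \<Rightarrow> real) \<times> (real \<Rightarrow> real)" where
  "hill_terms q s A B 0 = (\<lambda>_. A, \<lambda>_. B)"
| "hill_terms q s A B (Suc n) =
     (antideriv s (snd (hill_terms q s A B n)), antideriv s (\<lambda>t. q t * fst (hill_terms q s A B n) t))"

locale bounded_coefficient =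
  fixes q :: "real \<Rightarrow> real" and M :: real
  assumes cont: "continuous_on UNIV q" and bound: "\<And>t. \<bar>q t\<bar> \<le> M"
begin

lemma M_nonneg: "0 \<le> M"
  using bound[of 0] by linarith

text \<open>
  With the weight \<open>exp(2K|t - s|)\<close>, where \<open>K\<close> dominates \<open>1\<close> and \<open>|q|\<close>, the bound for the Picard
  increments is halved in each step. The series and its derivative therefore converge uniformly on bounded
  intervals, and the sum is a solution on the whole line.
\<close>

lemma hill_pair_exists: obtains w v where "hill_pair q w v" "w s = A" "v s = B"
proof -
  define U V where "U n = fst (hill_terms q s A B n)" and "V n = snd (hill_terms q s A B n)" for n
  have U0: "U 0 = (\<lambda>_. A)" "V 0 = (\<lambda>_. B)" by (simp_all add: U_def V_def)
  have US: "U (Suc n) = antideriv s (V n)" "V (Suc n) = antideriv s (\<lambda>t. q t * U n t)" for n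
    by (simp_all add: U_def V_def)
  have cUV: "continuous_on UNIV (U n) \<and> continuous_on UNIV (V n)" for n
  proof (induction n)
    case 0 then show ?case by (simp add: U0)
  next
    case (Suc n)
    have "continuous_on UNIV (\<lambda>t. q t * U n t)" using cont Suc by (intro continuous_on_mult) auto
    then show ?case
      using antideriv(2) Suc unfolding US
      by (meson DERIV_isCont continuous_at_imp_continuous_on)
  qed
  have cqU: "continuous_on UNIV (\<lambda>t. q t * U n t)" for n
    using cont cUV by (intro continuous_on_mult) auto
  have dU: "(U (Suc n) has_real_derivative V n t) (at t)"
    and dV: "(V (Suc n) has_real_derivative q t * U n t) (at t)"
    and s0: "U (Suc n) s = 0" "V (Suc n) s = 0" for n t
    using antideriv[of "V n"] antideriv[OF cqU] cUV unfolding US by auto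
  \<comment> \<open>One constant bounds both entries of the system \<open>w' = v\<close>, \<open>v' = q w\<close>.\<close>
  define K where "K = max 1 M"
  have K: "K \<ge> 1" "\<And>t. \<bar>q t\<bar> \<le> K" using bound by (auto simp: K_def intro: le_max_iff_disj[THEN iffD2])
  define C where "C = max \<bar>A\<bar> \<bar>B\<bar>"
  define e where "e t = exp (2 * K * \<bar>t - s\<bar>)" for t
  have e1: "e t \<ge> 1" for t using K by (simp add: e_def)
  have bdUV: "(\<forall>t. \<bar>U n t\<bar> \<le> C * (1/2)^n * e t) \<and> (\<forall>t. \<bar>V n t\<bar> \<le> C * (1/2)^n * e t)" for n
  proof (induction n)
    case 0
    have "\<bar>A\<bar> \<le> C * e t" "\<bar>B\<bar> \<le> C * e t" for t
      using mult_mono[of C C 1 "e t"] e1[of t] by (auto simp: C_def)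
    then show ?case by (simp add: U0)
  next
    case (Suc n)
    have Cn: "0 \<le> C * (1/2)^n * e t" for t by (simp add: C_def e_def)
    have a: "\<bar>V n t\<bar> \<le> (K * C * (1/2)^n) * exp (2 * K * \<bar>t - s\<bar>)" for t
    proof -
      have "\<bar>V n t\<bar> \<le> C * (1/2)^n * e t" using Suc by blast
      also have "\<dots> \<le> K * (C * (1/2)^n * e t)" using mult_right_mono[OF K(1) Cn] by simp
      finally show ?thesis by (simp add: e_def mult.assoc)
    qed
    have b: "\<bar>q t * U n t\<bar> \<le> (K * C * (1/2)^n) * exp (2 * K * \<bar>t - s\<bar>)" for t
    proof -
      have "\<bar>q t\<bar> * \<bar>U n t\<bar> \<le> K * (C * (1/2)^n * e t)" using Suc K by (intro mult_mono) auto
      then show ?thesis by (simp add: e_def mult.assoc abs_mult)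
    qed
    have h: "K * C * (1/2)^n / (2 * K) = C * (1/2)^Suc n" using K by simp
    have K2: "2 * K > 0" using K by simp
    have "\<bar>U (Suc n) t\<bar> \<le> C * (1/2)^Suc n * e t" "\<bar>V (Suc n) t\<bar> \<le> C * (1/2)^Suc n * e t" for t
      using antideriv_exp_bound[OF s0(1) dU a K2, of t] antideriv_exp_bound[OF s0(2) dV b K2, of t]
      unfolding h e_def by blast+
    then show ?case by blast
  qed
  \<comment> \<open>The derivatives of the terms are the terms of the other series, shifted by one index.\<close>
  define D where "D n = (case n of 0 \<Rightarrow> (\<lambda>_. 0) | Suc m \<Rightarrow> V m)" for n
  define E where "E n = (case n of 0 \<Rightarrow> (\<lambda>_. 0) | Suc m \<Rightarrow> (\<lambda>t. q t * U m t))" for n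
  have dU': "(U n has_real_derivative D n t) (at t)" for n t
    by (cases n) (auto simp: D_def U0 dU)
  have dV': "(V n has_real_derivative E n t) (at t)" for n t
    by (cases n) (auto simp: E_def U0 dV)
  have bD: "\<bar>D n t\<bar> \<le> 2 * K * C * e t * (1/2)^n" and bE: "\<bar>E n t\<bar> \<le> 2 * K * C * e t * (1/2)^n" for n t
  proof -
    have *: "C * (1/2)^m * e t \<le> K * (C * (1/2)^m * e t)" for m
      using mult_right_mono[OF K(1), of "C * (1/2)^m * e t"] by (simp add: C_def e_def)
    show "\<bar>D n t\<bar> \<le> 2 * K * C * e t * (1/2)^n"
      using K e1[of t] bdUV order_trans[OF _ *] by (cases n) (auto simp: D_def C_def mult_ac)
    have "\<bar>q t * U m t\<bar> \<le> K * (C * (1/2)^m * e t)" for m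
      unfolding abs_mult using bdUV K by (intro mult_mono) auto
    then show "\<bar>E n t\<bar> \<le> 2 * K * C * e t * (1/2)^n"
      using K e1[of t] by (cases n) (auto simp: E_def C_def mult_ac)
  qed
  have sumD: "summable (\<lambda>n. D n t)" and sumE: "summable (\<lambda>n. E n t)" for t
    by (rule summable_comparison_test'[of "\<lambda>n. 2 * K * C * e t * (1/2)^n" 0];
        use bD bE in \<open>auto intro!: summable_mult summable_geometric\<close>)+
  have sD: "(\<Sum>n. D n t) = (\<Sum>n. V n t)" and sE: "(\<Sum>n. E n t) = q t * (\<Sum>n. U n t)" for t
  proof -
    show "(\<Sum>n. D n t) = (\<Sum>n. V n t)"
      using suminf_split_head[OF sumD[of t]] by (simp add: D_def)
    have sumU: "summable (\<lambda>n. U n t)"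
      by (rule summable_comparison_test'[of "\<lambda>n. C * e t * (1/2)^n" 0])
        (use bdUV in \<open>auto intro!: summable_mult summable_geometric simp: mult_ac\<close>)
    show "(\<Sum>n. E n t) = q t * (\<Sum>n. U n t)"
      using suminf_split_head[OF sumE[of t]] suminf_mult[OF sumU, of "q t"] by (simp add: E_def)
  qed
  have unif: "uniformly_convergent_on {s - R<..<s + R} (\<lambda>n x. \<Sum>i<n. F i x)"
    if "\<And>n t. \<bar>F n t\<bar> \<le> 2 * K * C * e t * (1/2)^n" for F R
  proof (rule Weierstrass_m_test')
    show "norm (F n t) \<le> 2 * K * C * exp (2 * K * R) * (1/2)^n" if t: "t \<in> {s - R<..<s + R}" for n t
    proof -
      have "e t \<le> exp (2 * K * R)" using t K by (auto simp: e_def)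
      then have "2 * K * C * e t * (1/2)^n \<le> 2 * K * C * exp (2 * K * R) * (1/2)^n"
        using K by (intro mult_right_mono mult_left_mono) (auto simp: C_def)
      then show ?thesis using \<open>\<bar>F n t\<bar> \<le> _\<close> by simp
    qed
    show "summable (\<lambda>n. 2 * K * C * exp (2 * K * R) * (1 / 2) ^ n)"
      by (intro summable_mult summable_geometric) auto
  qed
  have sums0: "summable (\<lambda>n. U n s)" "summable (\<lambda>n. V n s)"
    by (rule summable_comparison_test'[of "\<lambda>n. C * e s * (1/2)^n" 0];
        use bdUV in \<open>auto intro!: summable_mult summable_geometric simp: mult_ac\<close>)+
  define w v where "w t = (\<Sum>n. U n t)" and "v t = (\<Sum>n. V n t)" for t
  have "(w has_real_derivative v t) (at t) \<and> (v has_real_derivative q t * w t) (at t)" for t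
  proof -
    define R where "R = \<bar>t - s\<bar> + 1"
    have t: "t \<in> interior {s - R<..<s + R}" "s \<in> {s - R<..<s + R}" by (auto simp: R_def)
    have "(w has_real_derivative (\<Sum>n. D n t)) (at t)"
      unfolding w_def
      by (rule has_field_derivative_series'(2)[OF _ _ unif t(2) _ t(1)])
        (use dU' bD sums0 in \<open>auto intro: has_field_derivative_at_within\<close>)
    moreover have "(v has_real_derivative (\<Sum>n. E n t)) (at t)"
      unfolding v_def
      by (rule has_field_derivative_series'(2)[OF _ _ unif t(2) _ t(1)])
        (use dV' bE sums0 in \<open>auto intro: has_field_derivative_at_within\<close>)
    ultimately show ?thesis by (simp add: sD sE v_def w_def)
  qed
  then have "hill_pair q w v" by (simp add: hill_pair_def)
  moreover have "w s = A" "v s = B"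
    using suminf_split_head[OF sums0(1)] suminf_split_head[OF sums0(2)]
    by (simp_all add: w_def v_def s0 U0)
  ultimately show ?thesis using that by blast
qed

end

section \<open>Riccati equations as quotients of linear solutions\<close>

context bounded_coefficient
begin

abbreviation Dom :: "real \<Rightarrow> real \<Rightarrow> real set" where
  "Dom s x0 \<equiv> maxdom (quad q) s x0"

abbreviation X :: "real \<Rightarrow> real \<Rightarrow> real \<Rightarrow> real" where
  "X s x0 t \<equiv> maxsol (quad q) t s x0"

lemma wronskian_constant:
  assumes "hill_pair q w v" "hill_pair q u z"
  shows "w t * z t - v t * u t = w s * z s - v s * u s"
proof -
  have "((\<lambda>t. w t * z t - v t * u t) has_real_derivative 0) (at t)" for t
    using assms unfolding hill_pair_def by (auto intro!: derivative_eq_intros)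
  then show ?thesis using DERIV_isconst_all[of "\<lambda>t. w t * z t - v t * u t"] by blast
qed

text \<open>
  A double zero would make the Wronskian with every other solution vanish, but the Wronskian with the
  solution that starts at \<open>s\<close> with value \<open>0\<close> and slope \<open>1\<close> equals \<open>w(s)\<close>.
\<close>

lemma no_double_zero:
  assumes "hill_pair q w v" "w s \<noteq> 0" "w t = 0"
  shows "v t \<noteq> 0"
proof
  assume "v t = 0"
  obtain u z where uz: "hill_pair q u z" "u s = 0" "z s = 1"
    using hill_pair_exists[of s 0 1] by blast
  show False using wronskian_constant[OF assms(1) uz(1), of t s] uz assms \<open>v t = 0\<close> by simp
qed

text \<open>
  The defect \<open>n = v - x w\<close> satisfies \<open>n' = -x n\<close> and vanishes at \<open>s\<close>, hence everywhere. Then \<open>w' = x w\<close>,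
  so \<open>w\<close> keeps the sign that it has at \<open>s\<close>.
\<close>

lemma solution_is_quotient:
  assumes wv: "hill_pair q w v" "w s = 1" "v s = x0"
    and x: "solves_ivp (quad q) s x0 I x" and t: "t \<in> I"
  shows "w t > 0" "x t = v t / w t"
proof -
  have I: "is_interval I" "s \<in> I" "x s = x0"
    and dx: "\<And>t. t \<in> I \<Longrightarrow> (x has_real_derivative - (x t)\<^sup>2 + q t) (at t)"
    using x by (auto simp: solves_ivp_iff quad_def)
  have dw: "(w has_real_derivative v t) (at t)" and dv: "(v has_real_derivative q t * w t) (at t)" for t
    using wv by (auto simp: hill_pair_def)
  have cx: "continuous_on I x" using dx by (meson DERIV_isCont continuous_at_imp_continuous_on)
  have zero: "v u - x u * w u = 0" if "u \<in> I" for u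
  proof -
    have "((\<lambda>t. v t - x t * w t) has_real_derivative - x t * (v t - x t * w t)) (at t)" if "t \<in> I" for t
      using dx[OF that] dw[of t] dv[of t]
      by (auto intro!: derivative_eq_intros simp: algebra_simps power2_eq_square)
    then obtain E where "v u - x u * w u = E * (v s - x s * w s)"
      using linear_homogeneous_factor_interval[OF I(1,2) \<open>u \<in> I\<close>, of "\<lambda>t. v t - x t * w t" "\<lambda>t. - x t"]
        continuous_on_minus[OF cx] by blast
    then show ?thesis using wv I by simp
  qed
  have "(w has_real_derivative x t * w t) (at t)" if "t \<in> I" for t
    using dw[of t] zero[OF that] by simp
  then obtain E where "E > 0" "w t = E * w s"
    using linear_homogeneous_factor_interval[OF I(1,2) t _ cx, of w] by blast
  then show "w t > 0" using wv by simp
  then show "x t = v t / w t" using zero[OF t] by (simp add: field_simps)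
qed

lemma unique_solutions_quad: "unique_solutions (quad q)"
  unfolding unique_solutions_def
proof (intro allI impI)
  fix s y0 I J y z t
  assume *: "solves_ivp (quad q) s y0 I y" "solves_ivp (quad q) s y0 J z" "t \<in> I" "t \<in> J"
  obtain w v where wv: "hill_pair q w v" "w s = 1" "v s = y0" by (rule hill_pair_exists)
  show "y t = z t"
    using solution_is_quotient(2)[OF wv *(1,3)] solution_is_quotient(2)[OF wv *(2,4)] by simp
qed

lemma quotient_solves:
  assumes wv: "hill_pair q w v" "w s = 1" "v s = x0"
  shows "solves_ivp (quad q) s x0 (connected_component_set {t. 0 < w t} s) (\<lambda>t. v t / w t)"
proof -
  have dw: "(w has_real_derivative v t) (at t)" and dv: "(v has_real_derivative q t * w t) (at t)" for t
    using wv by (auto simp: hill_pair_def)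
  then have "continuous_on UNIV w" by (meson DERIV_isCont continuous_at_imp_continuous_on)
  then have "open {t. 0 < w t}" by (intro open_Collect_less) (auto intro: continuous_on_const)
  then have "open (connected_component_set {t. 0 < w t} s)" by (rule open_connected_component)
  moreover have "is_interval (connected_component_set {t. 0 < w t} s)"
    by (simp add: is_interval_connected_1)
  moreover have "s \<in> connected_component_set {t. 0 < w t} s" using wv by simp
  moreover have "((\<lambda>t. v t / w t) has_real_derivative quad q t (v t / w t)) (at t)"
    if "t \<in> connected_component_set {t. 0 < w t} s" for t
  proof -
    have "w t > 0" using that connected_component_in by fastforce
    then show ?thesis using dw[of t] dv[of t]
      by (auto intro!: derivative_eq_intros simp: quad_def field_simps power2_eq_square)
  qed
  ultimately show ?thesis using wv by (simp add: solves_ivp_iff)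
qed

lemma Dom_eq_component:
  assumes wv: "hill_pair q w v" "w s = 1" "v s = x0"
  shows "Dom s x0 = connected_component_set {t. 0 < w t} s"
proof
  show "connected_component_set {t. 0 < w t} s \<subseteq> Dom s x0"
    unfolding maxdom_def using quotient_solves[OF wv] by blast
  show "Dom s x0 \<subseteq> connected_component_set {t. 0 < w t} s"
  proof
    fix t assume "t \<in> Dom s x0"
    then obtain I x where x: "solves_ivp (quad q) s x0 I x" "t \<in> I" by (auto simp: maxdom_def)
    have I: "is_interval I" "s \<in> I" using x by (auto simp: solves_ivp_iff)
    have "closed_segment s t \<subseteq> I" using I x(2) is_interval_convex_1 by (simp add: closed_segment_subset)
    then have "closed_segment s t \<subseteq> {t. 0 < w t}" using solution_is_quotient(1)[OF wv x(1)] by blast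
    then show "t \<in> connected_component_set {t. 0 < w t} s" by (simp add: connected_component_1)
  qed
qed

lemma mem_Dom_iff:
  assumes "hill_pair q w v" "w s = 1" "v s = x0"
  shows "t \<in> Dom s x0 \<longleftrightarrow> closed_segment s t \<subseteq> {t. 0 < w t}"
  using Dom_eq_component[OF assms] by (simp add: connected_component_1)

lemma X_eq_quotient:
  assumes "hill_pair q w v" "w s = 1" "v s = x0" "t \<in> Dom s x0"
  shows "X s x0 t = v t / w t"
  using maxsol_eqI[OF unique_solutions_quad quotient_solves[OF assms(1-3)]] assms(4)
  by (simp add: Dom_eq_component[OF assms(1-3)])

lemma X_solves: "solves_ivp (quad q) s x0 (Dom s x0) (X s x0)"
proof -
  obtain w v where wv: "hill_pair q w v" "w s = 1" "v s = x0" by (rule hill_pair_exists)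
  have *: "solves_ivp (quad q) s x0 (Dom s x0) (\<lambda>t. v t / w t)"
    using quotient_solves[OF wv] Dom_eq_component[OF wv] by simp
  have "(X s x0 has_real_derivative quad q t (X s x0 t)) (at t)" if t: "t \<in> Dom s x0" for t
  proof (rule has_field_derivative_transform_within_open[OF _ _ t])
    show "((\<lambda>t. v t / w t) has_real_derivative quad q t (X s x0 t)) (at t)"
      using * t X_eq_quotient[OF wv t] by (simp add: solves_ivp_iff)
    show "open (Dom s x0)" using * by (simp add: solves_ivp_iff)
  qed (simp add: X_eq_quotient[OF wv])
  then show ?thesis using * X_eq_quotient[OF wv, of s] by (simp add: solves_ivp_iff)
qed

lemma open_Dom: "open (Dom s x0)" and interval_Dom: "is_interval (Dom s x0)"
  and s_in_Dom [simp]: "s \<in> Dom s x0" and X_initial [simp]: "X s x0 s = x0"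
  and X_deriv: "t \<in> Dom s x0 \<Longrightarrow> (X s x0 has_real_derivative - (X s x0 t)\<^sup>2 + q t) (at t)"
  using X_solves[of s x0] by (auto simp: solves_ivp_iff quad_def)

lemma Dom_between: "t \<in> Dom s x0 \<Longrightarrow> u \<in> Dom s x0 \<Longrightarrow> t \<le> l \<Longrightarrow> l \<le> u \<Longrightarrow> l \<in> Dom s x0"
  using interval_Dom mem_is_interval_1_I by blast

lemma subset_Dom:
  assumes "solves_ivp (quad q) s x0 I x"
  shows "I \<subseteq> Dom s x0" and "t \<in> I \<Longrightarrow> X s x0 t = x t"
  using assms maxsol_eqI[OF unique_solutions_quad assms] by (auto simp: maxdom_def)

text \<open>
  Restarting a maximal solution at one of its points reproduces the same maximal solution.
\<close>

lemma flow:
  assumes u: "u \<in> Dom s x0"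
  shows "Dom u (X s x0 u) = Dom s x0" and "t \<in> Dom s x0 \<Longrightarrow> X u (X s x0 u) t = X s x0 t"
proof -
  have *: "solves_ivp (quad q) u (X s x0 u) (Dom s x0) (X s x0)"
    using X_solves[of s x0] u by (simp add: solves_ivp_iff)
  note sub = subset_Dom[OF *]
  have "solves_ivp (quad q) s x0 (Dom u (X s x0 u)) (X u (X s x0 u))"
    using X_solves[of u "X s x0 u"] sub by (auto simp: solves_ivp_iff)
  from subset_Dom(1)[OF this] sub(1) show "Dom u (X s x0 u) = Dom s x0" by blast
  show "t \<in> Dom s x0 \<Longrightarrow> X u (X s x0 u) t = X s x0 t" by (rule sub(2))
qed

text \<open>
  While \<open>w'/w \<le> K\<close> the function \<open>w(t) exp(-Kt)\<close> is nonincreasing, so moving to the left \<open>w\<close> cannot reach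
  its first zero: a solution is lost to the left only by becoming unbounded above.
\<close>

lemma continue_left:
  assumes t1: "t1 \<le> s" and bd: "\<And>t. t \<in> Dom s x0 \<Longrightarrow> t1 \<le> t \<Longrightarrow> t \<le> s \<Longrightarrow> X s x0 t \<le> K"
  shows "{t1..s} \<subseteq> Dom s x0"
proof (rule ccontr)
  assume "\<not> {t1..s} \<subseteq> Dom s x0"
  then obtain t where t: "t1 \<le> t" "t \<le> s" "t \<notin> Dom s x0"
    by (metis atLeastAtMost_iff subsetI)
  obtain w v where wv: "hill_pair q w v" "w s = 1" "v s = x0" by (rule hill_pair_exists)
  have dw: "(w has_real_derivative v t) (at t)" for t using wv by (auto simp: hill_pair_def)
  then have cw: "continuous_on A w" for A by (meson DERIV_isCont continuous_at_imp_continuous_on)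
  define S where "S = {u \<in> {t1..s}. w u \<le> 0}"
  have "closed S"
    unfolding S_def using continuous_on_closed_Collect_le[OF cw continuous_on_const closed_atLeastAtMost, of t1 s 0]
    by simp
  moreover have "bounded S" by (rule bounded_subset[of "{t1..s}"]) (auto simp: S_def)
  moreover have "S \<noteq> {}"
  proof -
    obtain l where "l \<in> closed_segment s t" "w l \<le> 0"
      using t(3) unfolding mem_Dom_iff[OF wv] by (metis mem_Collect_eq not_less subsetI)
    then have "l \<in> S" using t by (auto simp: S_def closed_segment_eq_real_ivl split: if_splits)
    then show ?thesis by blast
  qed
  ultimately obtain z where z: "z \<in> S" "\<And>u. u \<in> S \<Longrightarrow> u \<le> z"
    using compact_attains_sup[of S] compact_eq_bounded_closed by blast
  have zs: "z < s" using z(1) wv(2) by (cases "z = s") (auto simp: S_def)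
  have pos: "w u > 0" if "z < u" "u \<le> s" for u
    using z(2)[of u] z(1) that by (auto simp: S_def not_le[symmetric])
  have Dom: "u \<in> Dom s x0" if "z < u" "u \<le> s" for u
    using pos that by (auto simp: mem_Dom_iff[OF wv] closed_segment_eq_real_ivl)
  have "(\<lambda>u. w u * exp (- K * u)) z \<ge> (\<lambda>u. w u * exp (- K * u)) s"
  proof (rule DERIV_nonpos_imp_decreasing_open[where f = "\<lambda>u. w u * exp (- K * u)"])
    fix u assume u: "z < u" "u < s"
    have "v u / w u \<le> K" using bd[of u] Dom[of u] u z(1) X_eq_quotient[OF wv, of u] by (auto simp: S_def)
    then have "v u \<le> K * w u" using pos[of u] u by (simp add: field_simps)
    moreover have "((\<lambda>u. w u * exp (- K * u)) has_real_derivative (v u - K * w u) * exp (- K * u)) (at u)"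
      using dw[of u] by (auto intro!: derivative_eq_intros simp: algebra_simps)
    ultimately show "\<exists>y. ((\<lambda>u. w u * exp (- K * u)) has_real_derivative y) (at u) \<and> y \<le> 0"
      by (metis diff_le_0_iff_le exp_ge_zero mult_nonpos_nonneg)
  qed (use zs in \<open>auto intro!: continuous_on_mult continuous_on_exp continuous_on_minus cw\<close>)
  moreover have "w z * exp (- K * z) \<le> 0" using z(1) by (simp add: S_def mult_nonpos_nonneg)
  moreover have "w s * exp (- K * s) > 0" using wv by simp
  ultimately show False by linarith
qed

lemma continue_right:
  assumes t1: "s \<le> t1" and bd: "\<And>t. t \<in> Dom s x0 \<Longrightarrow> s \<le> t \<Longrightarrow> t \<le> t1 \<Longrightarrow> K \<le> X s x0 t"
  shows "{s..t1} \<subseteq> Dom s x0"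
proof (rule ccontr)
  assume "\<not> {s..t1} \<subseteq> Dom s x0"
  then obtain t where t: "t \<le> t1" "s \<le> t" "t \<notin> Dom s x0"
    by (metis atLeastAtMost_iff subsetI)
  obtain w v where wv: "hill_pair q w v" "w s = 1" "v s = x0" by (rule hill_pair_exists)
  have dw: "(w has_real_derivative v t) (at t)" for t using wv by (auto simp: hill_pair_def)
  then have cw: "continuous_on A w" for A by (meson DERIV_isCont continuous_at_imp_continuous_on)
  define S where "S = {u \<in> {s..t1}. w u \<le> 0}"
  have "closed S"
    unfolding S_def using continuous_on_closed_Collect_le[OF cw continuous_on_const closed_atLeastAtMost, of s t1 0]
    by simp
  moreover have "bounded S" by (rule bounded_subset[of "{s..t1}"]) (auto simp: S_def)
  moreover have "S \<noteq> {}"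
  proof -
    obtain l where "l \<in> closed_segment s t" "w l \<le> 0"
      using t(3) unfolding mem_Dom_iff[OF wv] by (metis mem_Collect_eq not_less subsetI)
    then have "l \<in> S" using t by (auto simp: S_def closed_segment_eq_real_ivl split: if_splits)
    then show ?thesis by blast
  qed
  ultimately obtain z where z: "z \<in> S" "\<And>u. u \<in> S \<Longrightarrow> z \<le> u"
    using compact_attains_inf[of S] compact_eq_bounded_closed by blast
  have zs: "s < z" using z(1) wv(2) by (cases "z = s") (auto simp: S_def)
  have pos: "w u > 0" if "u < z" "s \<le> u" for u
    using z(2)[of u] z(1) that by (auto simp: S_def not_le[symmetric])
  have Dom: "u \<in> Dom s x0" if "u < z" "s \<le> u" for u
    using pos that by (auto simp: mem_Dom_iff[OF wv] closed_segment_eq_real_ivl)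
  have "(\<lambda>u. w u * exp (- K * u)) s \<le> (\<lambda>u. w u * exp (- K * u)) z"
  proof (rule DERIV_nonneg_imp_increasing_open[where f = "\<lambda>u. w u * exp (- K * u)"])
    fix u assume u: "s < u" "u < z"
    have "K \<le> v u / w u" using bd[of u] Dom[of u] u z(1) X_eq_quotient[OF wv, of u] by (auto simp: S_def)
    then have "K * w u \<le> v u" using pos[of u] u by (simp add: field_simps)
    moreover have "((\<lambda>u. w u * exp (- K * u)) has_real_derivative (v u - K * w u) * exp (- K * u)) (at u)"
      using dw[of u] by (auto intro!: derivative_eq_intros simp: algebra_simps)
    ultimately show "\<exists>y. ((\<lambda>u. w u * exp (- K * u)) has_real_derivative y) (at u) \<and> 0 \<le> y"
      by (metis diff_ge_0_iff_ge exp_ge_zero mult_nonneg_nonneg)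
  qed (use zs in \<open>auto intro!: continuous_on_mult continuous_on_exp continuous_on_minus cw\<close>)
  moreover have "w z * exp (- K * z) \<le> 0" using z(1) by (simp add: S_def mult_nonpos_nonneg)
  moreover have "w s * exp (- K * s) > 0" using wv by simp
  ultimately show False by linarith
qed

text \<open>
  The difference of two solutions \<open>x\<close>, \<open>z\<close> satisfies the linear equation \<open>u' = -(x + z) u\<close>.
\<close>

lemma riccati_order:
  assumes I: "is_interval I" "s \<in> I" "t \<in> I"
    and x: "\<And>t. t \<in> I \<Longrightarrow> (x has_real_derivative - (x t)\<^sup>2 + q t) (at t)"
    and z: "\<And>t. t \<in> I \<Longrightarrow> (z has_real_derivative - (z t)\<^sup>2 + q t) (at t)"
  shows "x s < z s \<longleftrightarrow> x t < z t"
proof -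
  have cx: "continuous_on I x" and cz: "continuous_on I z"
    using x z by (meson DERIV_isCont continuous_at_imp_continuous_on)+
  have der: "((\<lambda>t. z t - x t) has_real_derivative - (x t + z t) * (z t - x t)) (at t)" if "t \<in> I" for t
    using x[OF that] z[OF that] by (auto intro!: derivative_eq_intros simp: algebra_simps power2_eq_square)
  have cont: "continuous_on I (\<lambda>t. - (x t + z t))" by (intro continuous_intros cx cz)
  obtain E where "E > 0" "z t - x t = E * (z s - x s)"
    using linear_homogeneous_factor_interval[OF I, of "\<lambda>t. z t - x t" "\<lambda>t. - (x t + z t)"] der cont by blast
  then have "0 < z t - x t \<longleftrightarrow> 0 < z s - x s" by (simp add: zero_less_mult_iff)
  then show ?thesis by simp
qed

text \<open>
  Above the level \<open>M + 1\<close> the reciprocal \<open>1/x\<close> has slope at least \<open>1/2\<close>, so going backwards it would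
  reach \<open>0\<close>, that is, \<open>x\<close> would blow up, within bounded time.
\<close>

lemma upper_bound_left:
  assumes x: "\<And>t. t \<le> s \<Longrightarrow> (x has_real_derivative - (x t)\<^sup>2 + q t) (at t)"
  shows "x s \<le> M + 1"
proof (rule ccontr)
  assume "\<not> x s \<le> M + 1"
  then have xs: "x s > M + 1" by simp
  have ge: "x t \<ge> M + 1" if t: "t \<le> s" for t
  proof -
    have "x t - (M + 1) \<ge> 0"
    proof (rule nonneg_barrier_backward[OF t, where f = "\<lambda>t. x t - (M + 1)" and f' = "\<lambda>t. - (x t)\<^sup>2 + q t"])
      fix u assume u: "t \<le> u" "u \<le> s"
      show "((\<lambda>t. x t - (M + 1)) has_real_derivative - (x u)\<^sup>2 + q u) (at u)"
        using x[of u] u by (auto intro!: derivative_eq_intros)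
      assume "x u - (M + 1) = 0"
      then have "x u = M + 1" by simp
      then show "- (x u)\<^sup>2 + q u < 0" using bound[of u] M_nonneg by (simp add: power2_eq_square algebra_simps abs_le_iff)
         (smt (verit) mult_nonneg_nonneg)
    qed (use xs in simp)
    then show ?thesis by simp
  qed
  \<comment> \<open>Since \<open>1/x(s) \<le> 1\<close>, a slope of at least \<open>1/2\<close> over a time span of \<open>3\<close> makes \<open>1/x\<close> negative.\<close>
  have "(\<lambda>t. 1 / x t - t / 2) (s - 3) \<le> (\<lambda>t. 1 / x t - t / 2) s"
  proof (rule DERIV_nonneg_imp_nondecreasing[where f = "\<lambda>t. 1 / x t - t / 2"])
    fix u assume u: "s - 3 \<le> u" "u \<le> s"
    have xu: "x u \<ge> M + 1" "x u > 0" using ge[of u] u M_nonneg by auto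
    have sq: "(x u)\<^sup>2 > 0" using xu by simp
    have "((\<lambda>t. 1 / x t - t / 2) has_real_derivative ((x u)\<^sup>2 - q u) / (x u)\<^sup>2 - 1 / 2) (at u)"
      using x[of u] u xu by (auto intro!: derivative_eq_intros simp: power2_eq_square)
    moreover have "((x u)\<^sup>2 - q u) / (x u)\<^sup>2 - 1 / 2 \<ge> 0"
    proof -
      have "(M + 1) * (M + 1) \<le> x u * x u" using xu M_nonneg by (intro mult_mono) auto
      then have "2 * q u \<le> (x u)\<^sup>2" using bound[of u] M_nonneg
        by (simp add: power2_eq_square algebra_simps abs_le_iff) (smt (verit) mult_nonneg_nonneg)
      then show ?thesis using sq by (simp add: field_simps)
    qed
    ultimately show "\<exists>y. ((\<lambda>t. 1 / x t - t / 2) has_real_derivative y) (at u) \<and> 0 \<le> y" by blast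
  qed simp
  moreover have "1 / x s \<le> 1" "1 / x (s - 3) > 0"
    using ge[of s] ge[of "s - 3"] M_nonneg by (auto simp: field_simps)
  moreover have "False" if "a - (s - 3) / 2 \<le> b - s / 2" "b \<le> 1" "0 < a" for a b :: real
    using that by (simp add: field_simps)
  ultimately show False by blast
qed

lemma lower_bound_left:
  assumes t: "t \<le> s"
    and x: "\<And>u. t \<le> u \<Longrightarrow> u \<le> s \<Longrightarrow> (x has_real_derivative - (x u)\<^sup>2 + q u) (at u)"
  shows "min (x s) (- (M + 1)) \<le> x t"
proof -
  define m where "m = min (x s) (- (M + 1))"
  have "x t - m \<ge> 0"
  proof (rule nonneg_barrier_backward[OF t, where f = "\<lambda>t. x t - m" and f' = "\<lambda>t. - (x t)\<^sup>2 + q t"])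
    fix u assume u: "t \<le> u" "u \<le> s"
    show "((\<lambda>t. x t - m) has_real_derivative - (x u)\<^sup>2 + q u) (at u)"
      using x[OF u] by (auto intro!: derivative_eq_intros)
    assume "x u - m = 0"
    then have "- x u \<ge> M + 1" by (simp add: m_def)
    then have "(M + 1) * (M + 1) \<le> (- x u) * (- x u)" using M_nonneg by (intro mult_mono) auto
    then show "- (x u)\<^sup>2 + q u < 0" using bound[of u] M_nonneg
      by (simp add: power2_eq_square algebra_simps abs_le_iff) (smt (verit) mult_nonneg_nonneg)
  qed (simp add: m_def)
  then show ?thesis by (simp add: m_def)
qed

end

section \<open>Solutions defined on a left half-line\<close>

context bounded_coefficient
begin

definition left_global :: "real \<Rightarrow> real \<Rightarrow> bool" where
  "left_global s x0 \<longleftrightarrow> {..s} \<subseteq> Dom s x0"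

lemma left_globalD: "left_global s x0 \<Longrightarrow> t \<le> s \<Longrightarrow> t \<in> Dom s x0"
  by (auto simp: left_global_def)

lemma left_global_upper:
  assumes "left_global s x0" "t \<le> s"
  shows "X s x0 t \<le> M + 1"
proof (rule upper_bound_left[where x = "X s x0"])
  fix u assume "u \<le> t"
  then have "u \<in> Dom s x0" using left_globalD[OF assms(1)] assms(2) by simp
  then show "(X s x0 has_real_derivative - (X s x0 u)\<^sup>2 + q u) (at u)" by (rule X_deriv)
qed

lemma left_global_lower:
  assumes "left_global s x0" "t \<le> s"
  shows "min x0 (- (M + 1)) \<le> X s x0 t"
  using lower_bound_left[OF assms(2), of "X s x0"] X_deriv left_globalD[OF assms(1)] by simp

lemma left_global_bounded:
  assumes "left_global s x0"
  shows "bounded (X s x0 ` {..s})"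
proof -
  have "\<bar>X s x0 t\<bar> \<le> \<bar>x0\<bar> + M + 1" if "t \<le> s" for t
    using left_global_upper[OF assms that] left_global_lower[OF assms that] M_nonneg by linarith
  then show ?thesis by (auto simp: bounded_iff)
qed

lemma left_global_if_bdd_above:
  assumes "bdd_above (X s x0 ` (Dom s x0 \<inter> {..s}))"
  shows "left_global s x0"
proof -
  obtain K where K: "\<And>t. t \<in> Dom s x0 \<Longrightarrow> t \<le> s \<Longrightarrow> X s x0 t \<le> K"
    using assms by (auto simp: bdd_above_def)
  have "t \<in> Dom s x0" if t: "t \<le> s" for t
    using continue_left[OF t, of x0 K] K t by auto
  then show ?thesis by (auto simp: left_global_def)
qed

lemma left_global_iff_bdd_above:
  "left_global s x0 \<longleftrightarrow> bdd_above (X s x0 ` (Dom s x0 \<inter> {..s}))"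
proof
  assume "left_global s x0"
  then show "bdd_above (X s x0 ` (Dom s x0 \<inter> {..s}))"
    using bounded_imp_bdd_above[OF left_global_bounded, of s x0] by (meson Int_lower2 bdd_above_mono image_mono)
qed (rule left_global_if_bdd_above)

lemma X_less_iff:
  assumes "is_interval I" "I \<subseteq> Dom s x0" "I \<subseteq> Dom s' x1" "t \<in> I" "u \<in> I"
  shows "X s x0 t < X s' x1 t \<longleftrightarrow> X s x0 u < X s' x1 u"
  by (rule riccati_order[OF assms(1,4,5)]; rule X_deriv) (use assms in auto)

text \<open>
  A lower solution is dominated by the given one, which is bounded above on the left, so it has no way
  to blow up.
\<close>

lemma left_global_mono:
  assumes "left_global s x0" "x1 \<le> x0"
  shows "left_global s x1"
proof (rule left_global_if_bdd_above, rule bdd_aboveI2)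
  fix t assume t: "t \<in> Dom s x1 \<inter> {..s}"
  have "{t..s} \<subseteq> Dom s x1" "{t..s} \<subseteq> Dom s x0"
    using Dom_between[of t s x1 s] t left_globalD[OF assms(1)] by auto
  then have "X s x0 t < X s x1 t \<longleftrightarrow> X s x0 s < X s x1 s"
    using t by (intro X_less_iff[of "{t..s}"]) (auto simp: is_interval_cc)
  then have "X s x1 t \<le> X s x0 t" using assms(2) by simp
  also have "\<dots> \<le> M + 1" using left_global_upper[OF assms(1)] t by simp
  finally show "X s x1 t \<le> M + 1" .
qed

lemma left_global_iff_pos:
  assumes "hill_pair q w v" "w s = 1" "v s = x0"
  shows "left_global s x0 \<longleftrightarrow> (\<forall>t\<le>s. w t > 0)"
  unfolding left_global_def subset_iff mem_Dom_iff[OF assms] closed_segment_eq_real_ivl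
  by (auto split: if_splits)

text \<open>
  The linear solution depends affinely on the slope at \<open>s\<close>, so a limit of positive solutions is
  nonnegative. A zero of the limit would be a minimum, hence a double zero.
\<close>

lemma left_global_closed: "closed {x0. left_global s x0}"
proof -
  obtain A VA where A: "hill_pair q A VA" "A s = 1" "VA s = 0" by (rule hill_pair_exists)
  obtain B VB where B: "hill_pair q B VB" "B s = 0" "VB s = 1" by (rule hill_pair_exists)
  have comb: "hill_pair q (\<lambda>t. A t + x * B t) (\<lambda>t. VA t + x * VB t)" for x
    using A(1) B(1) unfolding hill_pair_def
    by (auto intro!: derivative_eq_intros simp: algebra_simps)
  have pos: "left_global s x \<longleftrightarrow> (\<forall>t\<le>s. A t + x * B t > 0)" for x
    by (rule left_global_iff_pos[OF comb]) (use A B in auto)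
  have "left_global s x0" if lg: "\<And>n. left_global s (xs n)" and lim: "xs \<longlonglongrightarrow> x0" for xs x0
  proof -
    define w where "w t = A t + x0 * B t" for t
    have nonneg: "w t \<ge> 0" if "t \<le> s" for t
    proof (rule tendsto_lowerbound)
      show "(\<lambda>n. A t + xs n * B t) \<longlonglongrightarrow> w t" unfolding w_def by (intro tendsto_intros lim)
      show "\<forall>\<^sub>F n in sequentially. 0 \<le> A t + xs n * B t"
        using lg that unfolding pos by (intro always_eventually allI less_imp_le) blast
    qed simp
    have "w t \<noteq> 0" if "t \<le> s" for t
    proof
      assume 0: "w t = 0"
      have ws: "w s = 1" using A B by (simp add: w_def)
      then have ts: "t < s" using 0 that by (cases "t = s") auto
      have hp: "hill_pair q w (\<lambda>t. VA t + x0 * VB t)" using comb[of x0] by (simp add: w_def[abs_def])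
      then have "VA t + x0 * VB t \<noteq> 0" using no_double_zero[of w _ s t] ws 0 by simp
      moreover have "VA t + x0 * VB t = 0"
      proof (rule DERIV_local_min[of w _ t "s - t"])
        show "(w has_real_derivative VA t + x0 * VB t) (at t)" using hp by (simp add: hill_pair_def)
        show "\<forall>y. \<bar>t - y\<bar> < s - t \<longrightarrow> w t \<le> w y" using nonneg 0 by auto
      qed (use ts in simp)
      ultimately show False by simp
    qed
    then show ?thesis unfolding pos using nonneg by (simp add: w_def order_less_le)
  qed
  then show ?thesis unfolding closed_sequential_limits by blast
qed

definition left_domain :: "real set" where
  "left_domain = {s. \<exists>x0. left_global s x0}"

definition top_left :: "real \<Rightarrow> real" where
  "top_left s = (GREATEST x0. left_global s x0)"

text \<open>
  The good initial values form a down-closed closed set bounded above by \<open>M + 1\<close>, hence a half-line that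
  contains its endpoint.
\<close>

lemma left_global_iff_le_top:
  assumes s: "s \<in> left_domain"
  shows "left_global s x0 \<longleftrightarrow> x0 \<le> top_left s"
proof -
  define S where "S = {x0. left_global s x0}"
  have ne: "S \<noteq> {}" using s by (auto simp: S_def left_domain_def)
  have bd: "x \<le> M + 1" if "x \<in> S" for x
    using left_global_upper[of s x s] that by (simp add: S_def)
  have "Sup S \<in> S"
    by (rule closed_contains_Sup[OF ne bdd_aboveI[OF bd]]) (use left_global_closed in \<open>auto simp: S_def\<close>)
  moreover have "x \<le> Sup S" if "x \<in> S" for x
    using that bd by (meson bdd_aboveI cSup_upper)
  ultimately have lgS: "left_global s (Sup S)" and le: "\<And>x. left_global s x \<Longrightarrow> x \<le> Sup S"
    by (simp_all add: S_def)
  have "top_left s = Sup S" unfolding top_left_def by (rule Greatest_equality) (rule lgS, rule le)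
  then show ?thesis using le left_global_mono[OF lgS] by metis
qed

lemma left_global_top: "s \<in> left_domain \<Longrightarrow> left_global s (top_left s)"
  by (simp add: left_global_iff_le_top)

lemma left_global_flow:
  assumes "left_global s x0" "t \<in> Dom s x0"
  shows "left_global t (X s x0 t)"
proof -
  have "u \<in> Dom s x0" if "u \<le> t" for u
    using that assms Dom_between[of "min s u" s x0 t u] left_globalD[OF assms(1), of "min s u"] by auto
  then show ?thesis using flow(1)[OF assms(2)] by (auto simp: left_global_def)
qed

text \<open>
  The maximal good values at different times lie on one solution: a larger good value at time \<open>t\<close>
  could be transported to time \<open>s\<close>, where it would exceed the maximum. When \<open>t < s\<close> this forward
  transport is possible because the larger solution stays above the existing one.
\<close>

lemma top_left_flow:
  assumes s: "s \<in> left_domain" and t: "t \<in> Dom s (top_left s)"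
  shows "t \<in> left_domain" "top_left t = X s (top_left s) t"
proof -
  let ?\<alpha> = "X s (top_left s)"
  have lg: "left_global t (?\<alpha> t)" by (rule left_global_flow[OF left_global_top[OF s] t])
  then show tl: "t \<in> left_domain" by (auto simp: left_domain_def)
  show "top_left t = ?\<alpha> t"
  proof (rule ccontr)
    assume "top_left t \<noteq> ?\<alpha> t"
    then have less: "?\<alpha> t < top_left t" using lg left_global_iff_le_top[OF tl] by fastforce
    let ?x = "X t (top_left t)" and ?l = "min s t" and ?u = "max s t"
    have lgt: "left_global t (top_left t)" by (rule left_global_top[OF tl])
    have subD: "{?l..?u} \<subseteq> Dom s (top_left s)"
      using Dom_between[of t s "top_left s" s] Dom_between[of s s "top_left s" t] t by (auto simp: min_def max_def split: if_splits)
    have order: "?\<alpha> u < ?x u" if "u \<in> I" "t \<in> I" "is_interval I" "I \<subseteq> {?l..?u}" "I \<subseteq> Dom t (top_left t)" for u I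
      using X_less_iff[of I s "top_left s" t "top_left t" t u] that subD less by auto
    have "{?l..?u} \<subseteq> Dom t (top_left t)"
    proof (cases "s \<le> t")
      case True then show ?thesis using left_globalD[OF lgt] by auto
    next
      case False
      have "compact (?\<alpha> ` {t..s})"
        using subD False X_deriv
        by (intro compact_continuous_image compact_Icc)
          (meson DERIV_isCont continuous_at_imp_continuous_on subset_iff atLeastAtMost_iff min.cobounded2 max.cobounded1 order_trans)
      then obtain K where K: "\<And>u. t \<le> u \<Longrightarrow> u \<le> s \<Longrightarrow> K \<le> ?\<alpha> u"
        using bounded_imp_bdd_below[OF compact_imp_bounded] unfolding bdd_below_def
        by (metis atLeastAtMost_iff imageI)
      have "{t..s} \<subseteq> Dom t (top_left t)"
      proof (rule continue_right)
        fix u assume u: "u \<in> Dom t (top_left t)" "t \<le> u" "u \<le> s"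
        have "{t..u} \<subseteq> Dom t (top_left t)" using Dom_between[OF s_in_Dom u(1)] by auto
        then have "?\<alpha> u < ?x u" using order[of u "{t..u}"] u False by (auto simp: is_interval_cc)
        then show "K \<le> ?x u" using K[OF u(2,3)] by simp
      qed (use False in simp)
      then show ?thesis using False by simp
    qed
    then have "?\<alpha> s < ?x s" "s \<in> Dom t (top_left t)"
      using order[of s "{?l..?u}"] by (auto simp: is_interval_cc)
    moreover have "left_global s (?x s)" by (rule left_global_flow[OF lgt]) fact
    ultimately show False using left_global_iff_le_top[OF s] by simp
  qed
qed

text \<open>
  The solution through \<open>(s, top_left s)\<close> extends over exactly the times at which good values exist,
  because any good solution at a later time, followed from time \<open>s\<close> on, lies below it and prevents its
  escape to \<open>-\<infinity>\<close>. At its right endpoint \<open>l\<close> the denominator \<open>w\<close> has a simple zero with negative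
  slope, so \<open>w'/w\<close> tends to \<open>-\<infinity>\<close>.
\<close>

theorem left_domain_halfline:
  assumes ne: "left_domain \<noteq> {}" and noglobal: "\<And>x0. Dom 0 x0 \<noteq> UNIV"
  obtains l where "left_domain = {..<l}"
    "\<And>t. t < l \<Longrightarrow> (top_left has_real_derivative - (top_left t)\<^sup>2 + q t) (at t)"
    "filterlim top_left at_bot (at_left l)"
proof -
  obtain s where s: "s \<in> left_domain" using ne by blast
  let ?\<alpha> = "X s (top_left s)"
  define D where "D = Dom s (top_left s)"
  have lg: "left_global s (top_left s)" by (rule left_global_top[OF s])
  have sub: "t \<in> D" if "t \<le> s" for t unfolding D_def using left_globalD[OF lg that] .
  have "D \<noteq> UNIV"
  proof
    assume "D = UNIV"
    then show False using flow(1)[of 0 s "top_left s"] noglobal by (simp add: D_def)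
  qed
  then obtain b where b: "b \<notin> D" by auto
  have Db: "t < b" if "t \<in> D" for t
    using Dom_between[of s s "top_left s" t b] sub[of b] b that unfolding D_def by (meson not_le s_in_Dom linear)
  define l where "l = Sup D"
  have bdd: "bdd_above D" using Db by (meson bdd_aboveI less_imp_le)
  have Dne: "s \<in> D" by (simp add: D_def)
  have "l \<notin> D"
  proof
    assume "l \<in> D"
    then obtain e where "e > 0" "cball l e \<subseteq> D"
      using open_Dom[of s "top_left s"] unfolding D_def open_contains_cball by blast
    then have "l + e \<in> D" by (auto simp: dist_real_def)
    then have "l + e \<le> l" unfolding l_def by (rule cSup_upper[OF _ bdd])
    then show False using \<open>e > 0\<close> by simp
  qed
  have D_eq: "D = {..<l}"
  proof (intro equalityI subsetI)
    fix t assume "t \<in> D"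
    then have "t \<le> l" unfolding l_def by (rule cSup_upper[OF _ bdd])
    then show "t \<in> {..<l}" using \<open>l \<notin> D\<close> \<open>t \<in> D\<close> by (cases "t = l") auto
  next
    fix t assume "t \<in> {..<l}"
    then obtain u where u: "u \<in> D" "t < u" unfolding l_def using less_cSup_iff[OF _ bdd] Dne by auto
    show "t \<in> D" using sub[of t] Dom_between[of s s "top_left s" u t] u unfolding D_def by (cases "t \<le> s") auto
  qed
  have DL: "t \<in> left_domain" "top_left t = ?\<alpha> t" if "t \<in> D" for t
    using top_left_flow[OF s, of t] that unfolding D_def by blast+
  have LD: "t \<in> D" if t: "t \<in> left_domain" for t
  proof (cases "t \<le> s")
    case True then show ?thesis by (rule sub)
  next
    case False
    let ?x = "X t (top_left t)"
    have lgt: "left_global t (top_left t)" by (rule left_global_top[OF t])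
    have st: "s \<in> Dom t (top_left t)" using left_globalD[OF lgt, of s] False by simp
    have "left_global s (?x s)" by (rule left_global_flow[OF lgt st])
    then have le: "?x s \<le> ?\<alpha> s" using left_global_iff_le_top[OF s] by simp
    have "compact (?x ` {s..t})"
      using left_globalD[OF lgt] X_deriv
      by (intro compact_continuous_image compact_Icc)
        (meson DERIV_isCont continuous_at_imp_continuous_on atLeastAtMost_iff)
    then obtain K where K: "\<And>u. s \<le> u \<Longrightarrow> u \<le> t \<Longrightarrow> K \<le> ?x u"
      using bounded_imp_bdd_below[OF compact_imp_bounded] unfolding bdd_below_def
      by (metis atLeastAtMost_iff imageI)
    have "{s..t} \<subseteq> Dom s (top_left s)"
    proof (rule continue_right)
      fix u assume u: "u \<in> Dom s (top_left s)" "s \<le> u" "u \<le> t"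
      have "{s..u} \<subseteq> Dom s (top_left s)" "{s..u} \<subseteq> Dom t (top_left t)"
        using Dom_between[OF s_in_Dom u(1)] left_globalD[OF lgt] u by auto
      then have "?\<alpha> s < ?x s \<longleftrightarrow> ?\<alpha> u < ?x u"
        using u by (intro X_less_iff[of "{s..u}"]) (auto simp: is_interval_cc)
      then show "K \<le> ?\<alpha> u" using K[OF u(2,3)] le by simp
    qed (use False in simp)
    then show ?thesis using False by (auto simp: D_def)
  qed
  have L_eq: "left_domain = {..<l}" using DL LD D_eq by blast
  have top_eq: "top_left t = ?\<alpha> t" if "t < l" for t using DL that D_eq by auto
  have "(top_left has_real_derivative - (top_left t)\<^sup>2 + q t) (at t)" if t: "t < l" for t
  proof (rule has_field_derivative_transform_within_open[of ?\<alpha> _ t "{..<l}"])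
    show "(?\<alpha> has_real_derivative - (top_left t)\<^sup>2 + q t) (at t)"
      using X_deriv[of t s "top_left s"] t D_eq top_eq[OF t] by (auto simp: D_def)
  qed (use t top_eq in auto)
  moreover have "filterlim top_left at_bot (at_left l)"
  proof -
    obtain w v where wv: "hill_pair q w v" "w s = 1" "v s = top_left s" by (rule hill_pair_exists)
    have dw: "(w has_real_derivative v t) (at t)" and dv: "(v has_real_derivative q t * w t) (at t)" for t
      using wv by (auto simp: hill_pair_def)
    have sl: "s < l" using Dne D_eq by auto
    have pos: "w t > 0" if "t < l" for t
      using that D_eq mem_Dom_iff[OF wv, of t] by (auto simp: D_def)
    have "w l \<le> 0"
      using mem_Dom_iff[OF wv, of l] \<open>l \<notin> D\<close> sl pos unfolding D_def closed_segment_eq_real_ivl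
      by (auto simp: subset_iff) (metis less_eq_real_def not_le)
    have cw: "(w \<longlongrightarrow> w l) (at_left l)" and cv: "(v \<longlongrightarrow> v l) (at_left l)"
      using DERIV_isCont[OF dw] DERIV_isCont[OF dv] by (auto simp: isCont_def intro: tendsto_mono[OF at_le])
    have ev: "\<forall>\<^sub>F t in at_left l. w t > 0" by (rule eventually_at_leftI[OF _ sl]) (use pos in auto)
    have "w l \<ge> 0" by (rule tendsto_lowerbound[OF cw]) (use ev in \<open>auto elim: eventually_mono\<close>)
    then have wl: "w l = 0" using \<open>w l \<le> 0\<close> by simp
    have "v l \<le> 0"
    proof (rule ccontr)
      assume "\<not> v l \<le> 0"
      then obtain e where e: "e > 0" "\<And>h. 0 < h \<Longrightarrow> h < e \<Longrightarrow> w (l - h) < w l"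
        using DERIV_pos_inc_left[OF dw[of l]] by auto
      show False using e(2)[of "e / 2"] e(1) pos[of "l - e / 2"] wl by simp
    qed
    moreover have "v l \<noteq> 0" using no_double_zero[OF wv(1) _ wl, of s] wv by simp
    ultimately have vl: "v l < 0" by simp
    have "filterlim (\<lambda>t. inverse (w t)) at_top (at_left l)"
      by (rule filterlim_inverse_at_top) (use cw wl ev in auto)
    then have "filterlim (\<lambda>t. v t * inverse (w t)) at_bot (at_left l)"
      by (rule filterlim_tendsto_neg_mult_at_bot[OF cv vl])
    then show ?thesis
    proof (rule filterlim_mono_eventually[OF _ order_refl order_refl])
      show "\<forall>\<^sub>F t in at_left l. v t * inverse (w t) = top_left t"
        by (rule eventually_at_leftI[OF _ sl])
          (metis X_eq_quotient[OF wv] top_eq D_eq D_def divide_inverse greaterThanLessThan_iff lessThan_iff)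
    qed
  qed
  ultimately show ?thesis using that L_eq by blast
qed

end

section \<open>Hyperbolic solutions\<close>

text \<open>
  Hyperbolic attraction with its constants exposed. The antiderivative \<open>P\<close> of the linearization \<open>-2b\<close>
  replaces the oriented integrals by differences \<open>P t - P s\<close>.
\<close>

definition decaying_linearization ::
  "(real \<Rightarrow> real) \<Rightarrow> (real \<Rightarrow> real) \<Rightarrow> (real \<Rightarrow> real) \<Rightarrow> real \<Rightarrow> real \<Rightarrow> bool" where
  "decaying_linearization p b P k \<beta> \<longleftrightarrow>
     (\<forall>t. (b has_real_derivative - (b t)\<^sup>2 + p t) (at t)) \<and>
     (\<forall>t. (P has_real_derivative - 2 * b t) (at t)) \<and> k \<ge> 1 \<and> \<beta> > 0 \<and>
     (\<forall>s t. s \<le> t \<longrightarrow> exp (P t - P s) \<le> k * exp (- \<beta> * (t - s)))"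

lemma deriv_quad: "deriv (quad p l) x = - 2 * x"
proof (rule DERIV_imp_deriv)
  have "quad p l = (\<lambda>x. - x\<^sup>2 + p l)" by (simp add: fun_eq_iff quad_def)
  then show "(quad p l has_real_derivative - 2 * x) (at x)"
    by (auto intro!: derivative_eq_intros)
qed

lemma LBINT_deriv_quad:
  assumes b: "continuous_on UNIV b" and P: "\<And>t. (P has_real_derivative - 2 * b t) (at t)"
  shows "(LBINT l=ereal s..ereal t. deriv (quad p l) (b l)) = P t - P s"
proof -
  have "(LBINT l=ereal s..ereal t. - 2 * b l) = P t - P s"
  proof (rule interval_integral_FTC_finite)
    show "continuous_on {min s t..max s t} (\<lambda>l. - 2 * b l)"
      by (intro continuous_intros continuous_on_subset[OF b]) auto
    show "(P has_vector_derivative - 2 * b u) (at u within {min s t..max s t})" for u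
      using P[of u] by (simp add: has_real_derivative_iff_has_vector_derivative has_vector_derivative_at_within)
  qed
  then show ?thesis by (simp add: deriv_quad)
qed

lemma solves_on_quad_UNIV:
  "solves_on (quad p) b UNIV \<longleftrightarrow> (\<forall>t. (b has_real_derivative - (b t)\<^sup>2 + p t) (at t))"
  by (simp add: solves_on_def quad_def)

lemma global_solution_continuous:
  "\<forall>t. (b has_real_derivative f t) (at t) \<Longrightarrow> continuous_on UNIV b"
  by (meson DERIV_isCont continuous_at_imp_continuous_on)

lemma linearization_exists:
  assumes "\<forall>t. (b has_real_derivative f t) (at t)"
  obtains P where "\<And>t. (P has_real_derivative - 2 * b t) (at t)"
proof -
  have "continuous_on UNIV (\<lambda>t. - 2 * b t)"
    by (intro continuous_intros global_solution_continuous[OF assms])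
  from continuous_real_antiderivative[OF this] show ?thesis using that by metis
qed

lemma hyperbolic_attractive_iff:
  "hyperbolic_attractive (quad p) b \<longleftrightarrow> (\<exists>P k \<beta>. decaying_linearization p b P k \<beta>)"
proof
  assume h: "hyperbolic_attractive (quad p) b"
  then have b: "\<forall>t. (b has_real_derivative - (b t)\<^sup>2 + p t) (at t)"
    by (simp add: hyperbolic_attractive_def solves_on_quad_UNIV)
  then obtain P where P: "\<And>t. (P has_real_derivative - 2 * b t) (at t)"
    by (rule linearization_exists) blast
  show "\<exists>P k \<beta>. decaying_linearization p b P k \<beta>"
    using h b P unfolding hyperbolic_attractive_def decaying_linearization_def
      LBINT_deriv_quad[OF global_solution_continuous[OF b] P] by blast
next
  assume "\<exists>P k \<beta>. decaying_linearization p b P k \<beta>"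
  then obtain P k \<beta> where h: "decaying_linearization p b P k \<beta>" by blast
  then have b: "\<forall>t. (b has_real_derivative - (b t)\<^sup>2 + p t) (at t)"
    and P: "\<And>t. (P has_real_derivative - 2 * b t) (at t)" by (simp_all add: decaying_linearization_def)
  show "hyperbolic_attractive (quad p) b"
    using h b unfolding hyperbolic_attractive_def decaying_linearization_def
      LBINT_deriv_quad[OF global_solution_continuous[OF b] P] solves_on_quad_UNIV by blast
qed

lemma reflected_solution:
  assumes "(b has_real_derivative - (b (- t))\<^sup>2 + p (- t)) (at (- t))"
  shows "((\<lambda>t. - b (- t)) has_real_derivative - (- b (- t))\<^sup>2 + p (- t)) (at t)"
proof -
  have "((\<lambda>t. b (- t)) has_real_derivative - (- (b (- t))\<^sup>2 + p (- t))) (at t)"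
    using assms by (simp only: DERIV_mirror)
  from DERIV_minus[OF this] show ?thesis by simp
qed

lemma decaying_linearization_reflect:
  "decaying_linearization (\<lambda>t. p (- t)) (\<lambda>t. - b (- t)) (\<lambda>t. P (- t)) k \<beta> \<longleftrightarrow>
     (\<forall>t. (b has_real_derivative - (b t)\<^sup>2 + p t) (at t)) \<and>
     (\<forall>t. (P has_real_derivative - 2 * b t) (at t)) \<and> k \<ge> 1 \<and> \<beta> > 0 \<and>
     (\<forall>s t. t \<le> s \<longrightarrow> exp (P t - P s) \<le> k * exp (\<beta> * (t - s)))"
proof -
  have "(\<forall>t. ((\<lambda>t. - b (- t)) has_real_derivative - (- b (- t))\<^sup>2 + p (- t)) (at t)) \<longleftrightarrow>
      (\<forall>t. (b has_real_derivative - (b t)\<^sup>2 + p t) (at t))" (is "?l = ?r")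
  proof
    assume ?r then show ?l using reflected_solution[of b] by blast
  next
    assume l: ?l
    show ?r
    proof
      fix t
      show "(b has_real_derivative - (b t)\<^sup>2 + p t) (at t)"
        using reflected_solution[of "\<lambda>t. - b (- t)" t "\<lambda>t. p (- t)"] l[rule_format, of "- t"] by simp
    qed
  qed
  moreover have "(\<forall>t. ((\<lambda>t. P (- t)) has_real_derivative - 2 * (- b (- t))) (at t)) \<longleftrightarrow>
      (\<forall>t. (P has_real_derivative - 2 * b t) (at t))"
  proof -
    have "((\<lambda>t. P (- t)) has_real_derivative - 2 * (- b (- t))) (at t) \<longleftrightarrow>
        (P has_real_derivative - 2 * b (- t)) (at (- t))" for t
      using DERIV_mirror[of P "- 2 * b (- t)" t] by simp
    then show ?thesis by (metis add.inverse_inverse)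
  qed
  moreover have "(\<forall>s t. s \<le> t \<longrightarrow> exp (P (- t) - P (- s)) \<le> k * exp (- \<beta> * (t - s))) \<longleftrightarrow>
     (\<forall>s t. t \<le> s \<longrightarrow> exp (P t - P s) \<le> k * exp (\<beta> * (t - s)))" (is "?A = ?B")
  proof
    assume A: ?A
    show ?B
    proof (intro allI impI)
      fix s t :: real assume "t \<le> s"
      then show "exp (P t - P s) \<le> k * exp (\<beta> * (t - s))"
        using A[rule_format, of "- s" "- t"] by (simp add: algebra_simps)
    qed
  next
    assume B: ?B
    show ?A
    proof (intro allI impI)
      fix s t :: real assume "s \<le> t"
      then show "exp (P (- t) - P (- s)) \<le> k * exp (- \<beta> * (t - s))"
        using B[rule_format, of "- t" "- s"] by (simp add: algebra_simps)
    qed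
  qed
  ultimately show ?thesis unfolding decaying_linearization_def by blast
qed

text \<open>
  Reflection in time turns repulsive hyperbolic solutions into attractive ones, so that only the latter
  need to be analysed.
\<close>

lemma hyperbolic_repulsive_iff:
  "hyperbolic_repulsive (quad p) b \<longleftrightarrow>
     hyperbolic_attractive (quad (\<lambda>t. p (- t))) (\<lambda>t. - b (- t))"
proof
  assume h: "hyperbolic_repulsive (quad p) b"
  then have b: "\<forall>t. (b has_real_derivative - (b t)\<^sup>2 + p t) (at t)"
    by (simp add: hyperbolic_repulsive_def solves_on_quad_UNIV)
  then obtain P where P: "\<And>t. (P has_real_derivative - 2 * b t) (at t)"
    by (rule linearization_exists) blast
  obtain k \<beta> where "k \<ge> 1" "\<beta> > 0" "\<forall>s t. t \<le> s \<longrightarrow> exp (P t - P s) \<le> k * exp (\<beta> * (t - s))"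
    using h unfolding hyperbolic_repulsive_def
      LBINT_deriv_quad[OF global_solution_continuous[OF b] P] by blast
  then show "hyperbolic_attractive (quad (\<lambda>t. p (- t))) (\<lambda>t. - b (- t))"
    unfolding hyperbolic_attractive_iff using decaying_linearization_reflect[of p b P k \<beta>] b P by blast
next
  assume "hyperbolic_attractive (quad (\<lambda>t. p (- t))) (\<lambda>t. - b (- t))"
  then obtain P k \<beta> where "decaying_linearization (\<lambda>t. p (- t)) (\<lambda>t. - b (- t)) P k \<beta>"
    by (auto simp: hyperbolic_attractive_iff)
  then have h: "\<forall>t. (b has_real_derivative - (b t)\<^sup>2 + p t) (at t)"
     "\<And>t. ((\<lambda>t. P (- t)) has_real_derivative - 2 * b t) (at t)" "k \<ge> 1" "\<beta> > 0"
     "\<forall>s t. t \<le> s \<longrightarrow> exp (P (- t) - P (- s)) \<le> k * exp (\<beta> * (t - s))"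
    using decaying_linearization_reflect[of p b "\<lambda>t. P (- t)" k \<beta>] by auto
  show "hyperbolic_repulsive (quad p) b"
    using h unfolding hyperbolic_repulsive_def solves_on_quad_UNIV
      LBINT_deriv_quad[OF global_solution_continuous[OF h(1)] h(2)] by blast
qed

context bounded_coefficient
begin

lemma reflected: "bounded_coefficient (\<lambda>t. q (- t)) M"
proof
  show "continuous_on UNIV (\<lambda>t. q (- t))"
    using continuous_on_compose2[OF cont, of UNIV uminus] by (simp add: continuous_on_minus)
qed (rule bound)

lemma global_solution_bound:
  assumes "\<And>t. (b has_real_derivative - (b t)\<^sup>2 + q t) (at t)"
  shows "\<bar>b t\<bar> \<le> M + 1"
proof -
  have "b t \<le> M + 1" by (rule upper_bound_left) (rule assms)
  moreover have "- b (- (- t)) \<le> M + 1"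
    by (rule bounded_coefficient.upper_bound_left[OF reflected, where x = "\<lambda>t. - b (- t)"])
      (rule reflected_solution, rule assms)
  ultimately show ?thesis by simp
qed

text \<open>
  The difference \<open>d = a1 - a2\<close> satisfies \<open>d' = -(a1 + a2) d\<close>, so its square decays like the product of
  the two linearizations. Global solutions are bounded, and starting from \<open>s \<rightarrow> -\<infinity>\<close> forces
  \<open>d = 0\<close>.
\<close>

lemma decaying_linearization_unique:
  assumes h1: "decaying_linearization q a1 P1 k1 \<beta>1" and h2: "decaying_linearization q a2 P2 k2 \<beta>2"
  shows "a1 = a2"
proof
  fix t
  have d1: "(a1 has_real_derivative - (a1 t)\<^sup>2 + q t) (at t)" "(P1 has_real_derivative - 2 * a1 t) (at t)"
    and d2: "(a2 has_real_derivative - (a2 t)\<^sup>2 + q t) (at t)" "(P2 has_real_derivative - 2 * a2 t) (at t)"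
    and k: "k1 \<ge> 1" "k2 \<ge> 1" "\<beta>1 > 0" "\<beta>2 > 0"
    and E1: "s \<le> t \<Longrightarrow> exp (P1 t - P1 s) \<le> k1 * exp (- \<beta>1 * (t - s))"
    and E2: "s \<le> t \<Longrightarrow> exp (P2 t - P2 s) \<le> k2 * exp (- \<beta>2 * (t - s))" for s t
    using h1 h2 by (simp_all add: decaying_linearization_def)
  define d where "d t = a1 t - a2 t" for t
  define F where "F t = (d t)\<^sup>2 * exp (- P1 t - P2 t)" for t
  have "(F has_real_derivative 0) (at t)" for t
    unfolding F_def d_def using d1[of t] d2[of t]
    by (auto intro!: derivative_eq_intros simp: algebra_simps power2_eq_square)
  then have const: "F s = F t" for s t using DERIV_isconst_all[of F] by blast
  define B where "B = (2 * (M + 1))\<^sup>2 * k1 * k2"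
  define \<gamma> where "\<gamma> = \<beta>1 + \<beta>2"
  have dec: "(d t)\<^sup>2 \<le> B * exp (- \<gamma> * (t - s))" if st: "s \<le> t" for s
  proof -
    have "\<bar>d s\<bar> \<le> 2 * (M + 1)"
      using global_solution_bound[OF d1(1), of s] global_solution_bound[OF d2(1), of s] by (simp add: d_def)
    then have ds: "(d s)\<^sup>2 \<le> (2 * (M + 1))\<^sup>2" by (metis abs_ge_zero power2_abs power_mono)
    have "(d t)\<^sup>2 = F t * exp (P1 t + P2 t)" by (simp add: F_def exp_add[symmetric] mult.assoc)
    also have "\<dots> = F s * exp (P1 t + P2 t)" using const by metis
    also have "\<dots> = (d s)\<^sup>2 * (exp (P1 t - P1 s) * exp (P2 t - P2 s))"
      by (simp add: F_def exp_add[symmetric] mult.assoc algebra_simps)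
    also have "\<dots> \<le> (2 * (M + 1))\<^sup>2 * ((k1 * exp (- \<beta>1 * (t - s))) * (k2 * exp (- \<beta>2 * (t - s))))"
      using ds E1[OF st] E2[OF st] k by (intro mult_mono) auto
    also have "\<dots> = B * (exp (- \<beta>1 * (t - s)) * exp (- \<beta>2 * (t - s)))" by (simp add: B_def)
    also have "\<dots> = B * exp (- \<gamma> * (t - s))" by (simp add: \<gamma>_def exp_add[symmetric] algebra_simps)
    finally show ?thesis .
  qed
  have "(d t)\<^sup>2 \<le> 0"
  proof (rule tendsto_lowerbound)
    have "\<gamma> > 0" using k by (simp add: \<gamma>_def)
    then have "((\<lambda>s. B * exp (- \<gamma> * t) * exp (\<gamma> * s)) \<longlongrightarrow> B * exp (- \<gamma> * t) * 0) at_bot"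
      by (intro tendsto_mult tendsto_const filterlim_compose[OF exp_at_bot]
          filterlim_tendsto_pos_mult_at_bot[OF tendsto_const _ filterlim_ident])
    moreover have "B * exp (- \<gamma> * t) * exp (\<gamma> * s) = B * exp (- \<gamma> * (t - s))" for s
      by (simp add: exp_add[symmetric] mult.assoc algebra_simps)
    ultimately show "((\<lambda>s. B * exp (- \<gamma> * (t - s))) \<longlongrightarrow> 0) at_bot"
      by (simp only: mult_zero_right)
    show "\<forall>\<^sub>F s in at_bot. (d t)\<^sup>2 \<le> B * exp (- \<gamma> * (t - s))"
      using dec by (auto simp: eventually_at_bot_linorder)
  qed simp
  then show "a1 t = a2 t" by (simp add: d_def)
qed

text \<open>
  If \<open>a \<le> r\<close>, the linearization \<open>-2a\<close> along \<open>a\<close> would be at least \<open>-2r\<close>, but the first integrates to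
  exponential decay and the second to exponential growth.
\<close>

lemma attractive_above_repulsive:
  assumes ha: "decaying_linearization q a P k \<beta>"
    and hr: "decaying_linearization (\<lambda>t. q (- t)) (\<lambda>t. - r (- t)) Q k' \<beta>'"
    and ne: "a \<noteq> r"
  shows "r t < a t"
proof (rule ccontr)
  define R where "R t = Q (- t)" for t
  have R: "Q = (\<lambda>t. R (- t))" by (simp add: R_def)
  have da: "(a has_real_derivative - (a t)\<^sup>2 + q t) (at t)" "(P has_real_derivative - 2 * a t) (at t)"
    and dr: "(r has_real_derivative - (r t)\<^sup>2 + q t) (at t)" "(R has_real_derivative - 2 * r t) (at t)"
    and k: "k \<ge> 1" "k' \<ge> 1" "\<beta> > 0" "\<beta>' > 0"
    and Ea: "s \<le> t \<Longrightarrow> exp (P t - P s) \<le> k * exp (- \<beta> * (t - s))"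
    and Er: "t \<le> s \<Longrightarrow> exp (R t - R s) \<le> k' * exp (\<beta>' * (t - s))" for s t
    using ha hr[unfolded R decaying_linearization_reflect] by (simp_all add: decaying_linearization_def)
  have ord: "a s < r s \<longleftrightarrow> a t < r t" "r s < a s \<longleftrightarrow> r t < a t" for s t
    by (rule riccati_order[of UNIV]; use da dr in simp)+
  assume "\<not> r t < a t"
  then have less: "a s \<le> r s" for s using ord(2)[of s t] by linarith
  define \<gamma> where "\<gamma> = \<beta> + \<beta>'"
  have \<gamma>: "\<gamma> > 0" using k by (simp add: \<gamma>_def)
  \<comment> \<open>Chosen so that \<open>k k' exp(-\<gamma>T) = exp(-\<gamma>) < 1\<close>.\<close>
  define T where "T = ln (k * k') / \<gamma> + 1"
  have kk: "k * k' \<ge> 1" using mult_mono[of 1 k 1 k'] k by simp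
  then have T: "T \<ge> 0" using \<gamma> by (simp add: T_def)
  have "(\<lambda>t. P t - R t) 0 \<le> (\<lambda>t. P t - R t) T"
  proof (rule DERIV_nonneg_imp_nondecreasing[OF T, where f = "\<lambda>t. P t - R t"])
    fix u
    have "((\<lambda>t. P t - R t) has_real_derivative 2 * (r u - a u)) (at u)"
      using da(2)[of u] dr(2)[of u] by (auto intro!: derivative_eq_intros)
    then show "\<exists>y. ((\<lambda>t. P t - R t) has_real_derivative y) (at u) \<and> 0 \<le> y"
      using less[of u] by (intro exI[of _ "2 * (r u - a u)"]) auto
  qed
  then have "1 \<le> exp (P T - P 0) * exp (R 0 - R T)"
    by (simp add: exp_add[symmetric])
  also have "\<dots> \<le> (k * exp (- \<beta> * (T - 0))) * (k' * exp (\<beta>' * (0 - T)))"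
    using Ea[OF T] Er[OF T] k by (intro mult_mono) auto
  also have "\<dots> = k * k' * exp (- \<gamma> * T)" by (simp add: \<gamma>_def exp_add[symmetric] algebra_simps)
  also have "- \<gamma> * T = - ln (k * k') - \<gamma>" using \<gamma> by (simp add: T_def field_simps)
  also have "k * k' * exp (- ln (k * k') - \<gamma>) = exp (- \<gamma>)"
    using kk k by (simp add: exp_diff exp_minus field_simps)
  also have "\<dots> < 1" using \<gamma> by simp
  finally show False by simp
qed

text \<open>
  The reciprocal \<open>u = 1/(a - r)\<close> satisfies the linear equation \<open>u' = 2 a u - 1\<close>; this is variation of
  constants, backwards from \<open>t\<close> to \<open>s\<close>.
\<close>

lemma gap_inverse_estimate:
  assumes ha: "decaying_linearization q a P k \<beta>"
    and dr: "\<And>t. (r has_real_derivative - (r t)\<^sup>2 + q t) (at t)"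
    and less: "\<And>t. r t < a t" and st: "s \<le> t"
  shows "1 / (a s - r s) \<le> k * exp (- \<beta> * (t - s)) * (1 / (a t - r t)) + k / \<beta>"
proof -
  have da: "(a has_real_derivative - (a t)\<^sup>2 + q t) (at t)" "(P has_real_derivative - 2 * a t) (at t)"
    and k: "k \<ge> 1" "\<beta> > 0"
    and Ea: "s \<le> t \<Longrightarrow> exp (P t - P s) \<le> k * exp (- \<beta> * (t - s))" for s t
    using ha by (simp_all add: decaying_linearization_def)
  define f where "f u = 1 / (a u - r u) * exp (P u - P s) - k / \<beta> * exp (- \<beta> * (u - s))" for u
  have "f s \<le> f t"
  proof (rule DERIV_nonneg_imp_nondecreasing[OF st])
    fix u assume u: "s \<le> u" "u \<le> t"
    have ne: "a u - r u \<noteq> 0" using less[of u] by simp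
    have "((\<lambda>u. 1 / (a u - r u)) has_real_derivative (a u + r u) * (1 / (a u - r u))) (at u)"
      using da(1)[of u] dr[of u] ne
      by (auto intro!: derivative_eq_intros simp: divide_simps) (simp add: algebra_simps power2_eq_square)
    moreover have "((\<lambda>u. exp (P u - P s)) has_real_derivative exp (P u - P s) * (- 2 * a u)) (at u)"
      using da(2)[of u] by (auto intro!: derivative_eq_intros)
    ultimately have "((\<lambda>u. 1 / (a u - r u) * exp (P u - P s)) has_real_derivative
        (a u + r u) * (1 / (a u - r u)) * exp (P u - P s) + exp (P u - P s) * (- 2 * a u) * (1 / (a u - r u))) (at u)"
      by (rule DERIV_mult)
    moreover have "(a u + r u) * (1 / (a u - r u)) * exp (P u - P s) + exp (P u - P s) * (- 2 * a u) * (1 / (a u - r u))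
        = - exp (P u - P s)"
    proof -
      have "(a u + r u) * i * e + e * (- 2 * a u) * i = - e * ((a u - r u) * i)" for i e :: real
        by (simp add: algebra_simps)
      from this[of "1 / (a u - r u)" "exp (P u - P s)"] show ?thesis using ne by (simp only:) simp
    qed
    ultimately have "((\<lambda>u. 1 / (a u - r u) * exp (P u - P s)) has_real_derivative - exp (P u - P s)) (at u)"
      by (simp only:)
    moreover have "((\<lambda>u. k / \<beta> * exp (- \<beta> * (u - s))) has_real_derivative - k * exp (- \<beta> * (u - s))) (at u)"
      using k by (auto intro!: derivative_eq_intros)
    ultimately have "(f has_real_derivative - exp (P u - P s) - (- k * exp (- \<beta> * (u - s)))) (at u)"
      unfolding f_def by (rule DERIV_diff)
    moreover have "- exp (P u - P s) - (- k * exp (- \<beta> * (u - s))) \<ge> 0" using Ea[OF u(1)] by simp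
    ultimately show "\<exists>y. (f has_real_derivative y) (at u) \<and> 0 \<le> y" by blast
  qed
  moreover have "f t \<le> 1 / (a t - r t) * (k * exp (- \<beta> * (t - s)))"
  proof -
    have "1 / (a t - r t) * exp (P t - P s) \<le> 1 / (a t - r t) * (k * exp (- \<beta> * (t - s)))"
      using Ea[OF st] less[of t] by (intro mult_left_mono) auto
    moreover have "k / \<beta> * exp (- \<beta> * (t - s)) \<ge> 0" using k by simp
    ultimately show ?thesis unfolding f_def by linarith
  qed
  ultimately show ?thesis by (simp add: f_def mult_ac)
qed

text \<open>
  Write \<open>u = 1/(a - r)\<close>. Attraction of \<open>a\<close> bounds \<open>u(s)\<close> by half of \<open>u(s + T)\<close> plus a constant, and
  repulsion of \<open>r\<close> bounds \<open>u(s + T)\<close> by half of \<open>u(s)\<close> plus a constant. Together these bound \<open>u\<close>.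
\<close>

lemma hyperbolic_gap:
  assumes ha: "decaying_linearization q a P k \<beta>"
    and hr: "decaying_linearization (\<lambda>t. q (- t)) (\<lambda>t. - r (- t)) Q k' \<beta>'"
    and ne: "a \<noteq> r"
  obtains d0 where "d0 > 0" "\<And>t. d0 \<le> a t - r t"
proof -
  have less: "r t < a t" for t by (rule attractive_above_repulsive[OF ha hr ne])
  have da: "(a has_real_derivative - (a t)\<^sup>2 + q t) (at t)" and k: "k \<ge> 1" "\<beta> > 0" for t
    using ha by (simp_all add: decaying_linearization_def)
  define R where "R t = Q (- t)" for t
  have R: "Q = (\<lambda>t. R (- t))" by (simp add: R_def)
  have dr: "(r has_real_derivative - (r t)\<^sup>2 + q t) (at t)" and k': "k' \<ge> 1" "\<beta>' > 0" for t
    using hr[unfolded R decaying_linearization_reflect] by simp_all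
  define u where "u t = 1 / (a t - r t)" for t
  have u: "u t > 0" for t using less by (simp add: u_def)
  \<comment> \<open>After time \<open>T\<close> both hyperbolic factors are at most \<open>1/2\<close>.\<close>
  define T where "T = max (ln (2 * k) / \<beta>) (ln (2 * k') / \<beta>')"
  have T: "T \<ge> 0" "\<beta> * T \<ge> ln (2 * k)" "\<beta>' * T \<ge> ln (2 * k')"
    using k k' by (auto simp: T_def max_def field_simps intro: order_trans)
  have half: "k * exp (- \<beta> * T) \<le> 1 / 2" "k' * exp (- \<beta>' * T) \<le> 1 / 2"
  proof -
    have "exp (- \<beta> * T) \<le> exp (- ln (2 * k))" "exp (- \<beta>' * T) \<le> exp (- ln (2 * k'))" using T by auto
    then show "k * exp (- \<beta> * T) \<le> 1 / 2" "k' * exp (- \<beta>' * T) \<le> 1 / 2"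
      using k k' by (auto simp: exp_minus field_simps)
  qed
  have 1: "u s \<le> u (s + T) / 2 + k / \<beta>" for s
  proof -
    have "u s \<le> k * exp (- \<beta> * T) * u (s + T) + k / \<beta>"
      using gap_inverse_estimate[OF ha dr less, of s "s + T"] T by (simp add: u_def)
    moreover have "k * exp (- \<beta> * T) * u (s + T) \<le> 1 / 2 * u (s + T)"
      using half(1) u[of "s + T"] by (intro mult_right_mono) auto
    ultimately show ?thesis by simp
  qed
  have 2: "u (s + T) \<le> u s / 2 + k' / \<beta>'" for s
  proof -
    have da': "((\<lambda>t. - a (- t)) has_real_derivative - (- a (- t))\<^sup>2 + q (- t)) (at t)" for t
      by (rule reflected_solution) (rule da)
    have "u (s + T) \<le> k' * exp (- \<beta>' * T) * u s + k' / \<beta>'"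
      using bounded_coefficient.gap_inverse_estimate[OF reflected hr da', of "- (s + T)" "- s"] T less
      by (simp add: u_def add.commute)
    moreover have "k' * exp (- \<beta>' * T) * u s \<le> 1 / 2 * u s"
      using half(2) u[of s] by (intro mult_right_mono) auto
    ultimately show ?thesis by simp
  qed
  define B where "B = 2 * (k / \<beta> + k' / \<beta>')"
  have B: "B > 0" "k / \<beta> > 0" "k' / \<beta>' > 0" using k k' by (auto simp: B_def intro!: add_pos_pos)
  have "u s \<le> B" for s
    using 1[of s] 2[of s] B unfolding B_def by argo
  then have "1 / B \<le> a s - r s" for s
    using le_imp_inverse_le[of "u s" B] u[of s] by (simp add: u_def inverse_eq_divide)
  then show ?thesis using that[of "1 / B"] B(1) by simp
qed

end

section \<open>Perturbation by a vanishing negative forcing\<close>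

locale perturbed_riccati =
  fixes p \<epsilon> a r :: "real \<Rightarrow> real" and M N d0 :: real
  assumes contp: "continuous_on UNIV p" and boundp: "\<And>t. \<bar>p t\<bar> \<le> M"
    and cont\<epsilon>: "continuous_on UNIV \<epsilon>" and \<epsilon>pos: "\<And>t. 0 < \<epsilon> t" and \<epsilon>bound: "\<And>t. \<epsilon> t \<le> N"
    and \<epsilon>lim: "(\<epsilon> \<longlongrightarrow> 0) at_bot"
    and da: "\<And>t. (a has_real_derivative - (a t)\<^sup>2 + p t) (at t)"
    and dr: "\<And>t. (r has_real_derivative - (r t)\<^sup>2 + p t) (at t)"
    and d0: "d0 > 0" and gap: "\<And>t. d0 \<le> a t - r t"
begin

sublocale bounded_coefficient "\<lambda>t. p t - \<epsilon> t" "M + N"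
proof
  show "continuous_on UNIV (\<lambda>t. p t - \<epsilon> t)" by (intro continuous_intros contp cont\<epsilon>)
  show "\<bar>p t - \<epsilon> t\<bar> \<le> M + N" for t using boundp[of t] \<epsilon>pos[of t] \<epsilon>bound[of t] by linarith
qed

lemma a_bound: "\<bar>a t\<bar> \<le> M + 1" and r_bound: "\<bar>r t\<bar> \<le> M + 1"
proof -
  interpret p: bounded_coefficient p M by unfold_locales (rule contp, rule boundp)
  show "\<bar>a t\<bar> \<le> M + 1" "\<bar>r t\<bar> \<le> M + 1"
    using p.global_solution_bound da dr by blast+
qed

lemma MN: "0 \<le> M" "0 < N"
  using boundp[of 0] \<epsilon>pos[of 0] \<epsilon>bound[of 0] by linarith+

lemma gap_pos: "0 < a t - r t" and gap_ne: "a t - r t \<noteq> 0" and gap_bound: "a t - r t \<le> 2 * (M + 1)"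
proof -
  show "0 < a t - r t" using gap[of t] d0 by linarith
  then show "a t - r t \<noteq> 0" by simp
  have "a t \<le> M + 1" "- r t \<le> M + 1"
    using abs_le_D1[OF a_bound] abs_le_D2[OF r_bound] by blast+
  then show "a t - r t \<le> 2 * (M + 1)" by simp
qed

lemma gap_deriv: "((\<lambda>t. a t - r t) has_real_derivative - (a t + r t) * (a t - r t)) (at t)"
  using da[of t] dr[of t] by (auto intro!: derivative_eq_intros simp: algebra_simps power2_eq_square)

text \<open>
  Dividing by \<open>a - r\<close> removes the oscillation of the coefficients: \<open>a + r\<close> itself has no sign, but in the
  three ratios below only differences of solutions remain, and these have one where it is needed.
\<close>

lemma ratio_deriv:
  assumes "(f has_real_derivative f') (at t)"
  shows "((\<lambda>t. f t / (a t - r t)) has_real_derivative (f' + (a t + r t) * f t) / (a t - r t)) (at t)"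
proof -
  have "((\<lambda>t. f t / (a t - r t)) has_real_derivative
      (f' * (a t - r t) - f t * (- (a t + r t) * (a t - r t))) / ((a t - r t) * (a t - r t))) (at t)"
    by (rule DERIV_divide[OF assms gap_deriv gap_ne])
  moreover have "f' * (a t - r t) - f t * (- (a t + r t) * (a t - r t)) = (f' + (a t + r t) * f t) * (a t - r t)"
    by (simp add: algebra_simps)
  ultimately show ?thesis using gap_ne[of t] by simp
qed

lemma ratio_deriv_solutions:
  assumes y: "(y has_real_derivative - (y t)\<^sup>2 + (p t - \<epsilon> t)) (at t)"
    and x: "(x has_real_derivative - (x t)\<^sup>2 + (p t - \<epsilon> t)) (at t)"
  shows "((\<lambda>t. (y t - x t) / (a t - r t)) has_real_derivative
    - (y t - a t + (x t - r t)) * ((y t - x t) / (a t - r t))) (at t)"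
proof -
  have "((\<lambda>t. y t - x t) has_real_derivative - (y t + x t) * (y t - x t)) (at t)"
    using y x by (auto intro!: derivative_eq_intros simp: algebra_simps power2_eq_square)
  from ratio_deriv[OF this] show ?thesis
    by (simp add: algebra_simps)
qed

lemma ratio_deriv_above_a:
  assumes x: "(x has_real_derivative - (x t)\<^sup>2 + (p t - \<epsilon> t)) (at t)"
  shows "((\<lambda>t. (x t - a t) / (a t - r t)) has_real_derivative
    - (x t - r t) * ((x t - a t) / (a t - r t)) - \<epsilon> t / (a t - r t)) (at t)"
proof -
  have "((\<lambda>t. x t - a t) has_real_derivative - (x t + a t) * (x t - a t) - \<epsilon> t) (at t)"
    using x da[of t] by (auto intro!: derivative_eq_intros simp: algebra_simps power2_eq_square)
  from ratio_deriv[OF this] show ?thesis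
    by (simp add: algebra_simps diff_divide_distrib add_divide_distrib)
qed

lemma ratio_deriv_below_r:
  assumes x: "(x has_real_derivative - (x t)\<^sup>2 + (p t - \<epsilon> t)) (at t)"
  shows "((\<lambda>t. (r t - x t) / (a t - r t)) has_real_derivative
    (a t - x t) * ((r t - x t) / (a t - r t)) + \<epsilon> t / (a t - r t)) (at t)"
proof -
  have "((\<lambda>t. r t - x t) has_real_derivative - (x t + r t) * (r t - x t) + \<epsilon> t) (at t)"
    using x dr[of t] by (auto intro!: derivative_eq_intros simp: algebra_simps power2_eq_square)
  from ratio_deriv[OF this] show ?thesis
    by (simp add: algebra_simps diff_divide_distrib add_divide_distrib)
qed

text \<open>
  Going backwards, a solution above \<open>a\<close> stays above it and its distance, measured relative to \<open>a - r\<close>,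
  grows at rate at least \<open>d0\<close>.
\<close>

lemma left_global_le_a:
  assumes lg: "left_global s x0" and ts: "t \<le> s"
  shows "X s x0 t \<le> a t"
proof (rule ccontr)
  let ?x = "X s x0"
  define m where "m t = (?x t - a t) / (a t - r t)" for t
  assume "\<not> ?x t \<le> a t"
  then have mt: "m t > 0" using gap_pos[of t] by (simp add: m_def)
  have dm: "(m has_real_derivative - (?x u - r u) * m u - \<epsilon> u / (a u - r u)) (at u)" if "u \<le> t" for u
    unfolding m_def by (rule ratio_deriv_above_a[OF X_deriv]) (use left_globalD[OF lg] that ts in auto)
  have nonneg: "m u \<ge> 0" if u: "u \<le> t" for u
    by (rule nonneg_barrier_backward[OF u dm]) (use mt gap_pos \<epsilon>pos in auto)
  have "m t \<le> 0"
  proof (rule no_backward_growth[OF dm _ d0])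
    fix u assume u: "u \<le> t"
    have "?x u - a u \<ge> 0" using nonneg[OF u] gap_pos[of u] by (simp add: m_def zero_le_divide_iff)
    then have "d0 \<le> ?x u - r u" using gap[of u] by simp
    then have "d0 * m u \<le> (?x u - r u) * m u" using nonneg[OF u] by (rule mult_right_mono)
    moreover have "0 < \<epsilon> u / (a u - r u)" using \<epsilon>pos gap_pos by simp
    ultimately show "- (?x u - r u) * m u - \<epsilon> u / (a u - r u) \<le> - d0 * m u"
      unfolding mult_minus_left by linarith
    have "?x u \<le> M + N + 1" using left_global_upper[OF lg, of u] u ts by simp
    then have "?x u - a u \<le> 2 * (M + 1) + N" using a_bound[of u] by (auto simp: abs_le_iff)
    then have "m u \<le> (2 * (M + 1) + N) / (a u - r u)" unfolding m_def using gap_pos[of u] by (simp add: divide_right_mono)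
    also have "\<dots> \<le> (2 * (M + 1) + N) / d0" using gap[of u] d0 MN by (intro divide_left_mono) auto
    finally show "m u \<le> (2 * (M + 1) + N) / d0" .
  qed
  then show False using mt by simp
qed

text \<open>
  These curves are barriers: a solution of the perturbed equation meeting one of them crosses it
  with relative slope \<open>\<kappa>(1 - \<kappa>)(a - r)\<^sup>2 - \<epsilon>\<close>, which is positive once \<open>\<epsilon>\<close> is small.
\<close>

definition between :: "real \<Rightarrow> real \<Rightarrow> real" where
  "between \<kappa> t = r t + \<kappa> * (a t - r t)"

lemma between_deriv_diff:
  assumes x: "(x has_real_derivative - (x t)\<^sup>2 + (p t - \<epsilon> t)) (at t)"
  shows "((\<lambda>t. x t - between \<kappa> t) has_real_derivative
    - (x t)\<^sup>2 + (r t)\<^sup>2 + \<kappa> * (a t + r t) * (a t - r t) - \<epsilon> t) (at t)"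
proof -
  have "((\<lambda>t. x t - between \<kappa> t) has_real_derivative - (x t)\<^sup>2 + (p t - \<epsilon> t)
      - (- (r t)\<^sup>2 + p t + \<kappa> * (- (a t + r t) * (a t - r t)))) (at t)"
    unfolding between_def by (intro DERIV_diff DERIV_add DERIV_cmult gap_deriv x dr)
  then show ?thesis by (simp add: algebra_simps)
qed

lemma between_crossing:
  assumes \<kappa>: "0 < \<kappa>" "\<kappa> < 1" and small: "\<epsilon> t < \<kappa> * (1 - \<kappa>) * d0\<^sup>2" and eq: "x = between \<kappa> t"
  shows "- x\<^sup>2 + (r t)\<^sup>2 + \<kappa> * (a t + r t) * (a t - r t) - \<epsilon> t > 0"
proof -
  have "d0\<^sup>2 \<le> (a t - r t)\<^sup>2" using gap[of t] d0 by (intro power_mono) auto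
  then have "\<kappa> * (1 - \<kappa>) * d0\<^sup>2 \<le> \<kappa> * (1 - \<kappa>) * (a t - r t)\<^sup>2" using \<kappa> by (intro mult_left_mono) auto
  moreover have "- x\<^sup>2 + (r t)\<^sup>2 + \<kappa> * (a t + r t) * (a t - r t) = \<kappa> * (1 - \<kappa>) * (a t - r t)\<^sup>2"
    unfolding eq between_def by (simp add: algebra_simps power2_eq_square)
  ultimately show ?thesis using small by simp
qed

lemma small_perturbation:
  assumes "0 < \<kappa>" "\<kappa> < 1"
  obtains T where "\<And>t. t \<le> T \<Longrightarrow> \<epsilon> t < \<kappa> * (1 - \<kappa>) * d0\<^sup>2"
proof -
  have "\<kappa> * (1 - \<kappa>) * d0\<^sup>2 > 0" using assms d0 by simp
  from order_tendstoD(2)[OF \<epsilon>lim this] show ?thesis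
    using that by (auto simp: eventually_at_bot_linorder)
qed

lemma stays_above_between:
  assumes \<kappa>: "0 < \<kappa>" "\<kappa> < 1" and small: "\<And>t. t \<le> T \<Longrightarrow> \<epsilon> t < \<kappa> * (1 - \<kappa>) * d0\<^sup>2"
    and st: "s \<le> t" "t \<le> T" and x: "\<And>u. s \<le> u \<Longrightarrow> u \<le> t \<Longrightarrow> (x has_real_derivative - (x u)\<^sup>2 + (p u - \<epsilon> u)) (at u)"
    and xs: "between \<kappa> s \<le> x s"
  shows "between \<kappa> t \<le> x t"
proof -
  have "0 \<le> x t - between \<kappa> t"
  proof (rule nonneg_barrier[OF st(1), where f = "\<lambda>t. x t - between \<kappa> t"])
    show "((\<lambda>t. x t - between \<kappa> t) has_real_derivative
      - (x u)\<^sup>2 + (r u)\<^sup>2 + \<kappa> * (a u + r u) * (a u - r u) - \<epsilon> u) (at u)" if "s \<le> u" "u \<le> t" for u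
      by (rule between_deriv_diff[OF x[OF that]])
    show "- (x u)\<^sup>2 + (r u)\<^sup>2 + \<kappa> * (a u + r u) * (a u - r u) - \<epsilon> u > 0"
      if "s \<le> u" "u \<le> t" "x u - between \<kappa> u = 0" for u
      by (rule between_crossing[OF \<kappa>]) (use small[of u] that st in auto)
  qed (use xs in simp)
  then show ?thesis by simp
qed

lemma stays_below_between:
  assumes \<kappa>: "0 < \<kappa>" "\<kappa> < 1" and small: "\<And>t. t \<le> T \<Longrightarrow> \<epsilon> t < \<kappa> * (1 - \<kappa>) * d0\<^sup>2"
    and st: "s \<le> t" "t \<le> T" and x: "\<And>u. s \<le> u \<Longrightarrow> u \<le> t \<Longrightarrow> (x has_real_derivative - (x u)\<^sup>2 + (p u - \<epsilon> u)) (at u)"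
    and xt: "x t \<le> between \<kappa> t"
  shows "x s \<le> between \<kappa> s"
proof -
  have "0 \<le> - (x s - between \<kappa> s)"
  proof (rule nonneg_barrier_backward[OF st(1), where f = "\<lambda>t. - (x t - between \<kappa> t)"])
    show "((\<lambda>t. - (x t - between \<kappa> t)) has_real_derivative
      - (- (x u)\<^sup>2 + (r u)\<^sup>2 + \<kappa> * (a u + r u) * (a u - r u) - \<epsilon> u)) (at u)" if "s \<le> u" "u \<le> t" for u
      by (rule DERIV_minus[OF between_deriv_diff[OF x[OF that]]])
    show "- (- (x u)\<^sup>2 + (r u)\<^sup>2 + \<kappa> * (a u + r u) * (a u - r u) - \<epsilon> u) < 0"
      if "s \<le> u" "u \<le> t" "- (x u - between \<kappa> u) = 0" for u
      using between_crossing[OF \<kappa>, of u "x u"] small[of u] that st by auto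
  qed (use xt in simp)
  then show ?thesis by simp
qed

lemma between_bound:
  assumes \<kappa>: "0 < \<kappa>" "\<kappa> < 1"
  shows "\<bar>between \<kappa> t\<bar> \<le> M + 1"
proof -
  have "between \<kappa> t = (1 - \<kappa>) * r t + \<kappa> * a t" by (simp add: between_def algebra_simps)
  moreover have "\<bar>(1 - \<kappa>) * r t\<bar> \<le> (1 - \<kappa>) * (M + 1)" "\<bar>\<kappa> * a t\<bar> \<le> \<kappa> * (M + 1)"
    using \<kappa> a_bound[of t] r_bound[of t] by (simp_all add: abs_mult mult_left_mono)
  moreover have "(1 - \<kappa>) * (M + 1) + \<kappa> * (M + 1) = M + 1" by (simp add: algebra_simps)
  ultimately show ?thesis by linarith
qed

text \<open>
  A solution started on the barrier stays below it backwards in time, hence is bounded above.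
\<close>

lemma left_global_between:
  assumes \<kappa>: "0 < \<kappa>" "\<kappa> < 1" and small: "\<And>t. t \<le> T \<Longrightarrow> \<epsilon> t < \<kappa> * (1 - \<kappa>) * d0\<^sup>2" and s: "s \<le> T"
  shows "left_global s (between \<kappa> s)"
proof (rule left_global_if_bdd_above, rule bdd_aboveI2)
  fix t assume t: "t \<in> Dom s (between \<kappa> s) \<inter> {..s}"
  have "X s (between \<kappa> s) t \<le> between \<kappa> t"
  proof (rule stays_below_between[OF \<kappa> small _ s])
    fix u assume "t \<le> u" "u \<le> s"
    then have "u \<in> Dom s (between \<kappa> s)" using Dom_between[of t s _ s u] t by auto
    then show "(X s (between \<kappa> s) has_real_derivative
        - (X s (between \<kappa> s) u)\<^sup>2 + (p u - \<epsilon> u)) (at u)" by (rule X_deriv)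
  qed (use t in auto)
  then show "X s (between \<kappa> s) t \<le> M + 1" using between_bound[OF \<kappa>, of t] by (simp add: abs_le_iff)
qed

lemma left_domain_nonempty: "left_domain \<noteq> {}"
proof -
  obtain T where T: "\<And>t. t \<le> T \<Longrightarrow> \<epsilon> t < 1/2 * (1 - 1/2) * d0\<^sup>2"
    using small_perturbation[of "1/2"] by auto
  have "left_global T (between (1/2) T)" by (rule left_global_between[OF _ _ T]) auto
  then show ?thesis by (auto simp: left_domain_def)
qed

text \<open>
  Values on the barrier are good, so \<open>top_left\<close> is squeezed between the barrier and \<open>a\<close>. Here \<open>\<kappa>\<close> is
  chosen so close to \<open>1\<close> that the two differ by at most \<open>\<eta>\<close>.
\<close>

lemma top_left_near_a:
  assumes \<eta>: "\<eta> > 0"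
  obtains T where "\<And>t. t \<le> T \<Longrightarrow> t \<in> left_domain" "\<And>t. t \<le> T \<Longrightarrow> top_left t \<le> a t"
    "\<And>t. t \<le> T \<Longrightarrow> a t - top_left t \<le> \<eta>"
proof -
  define \<eta>' where "\<eta>' = min (1/2) (\<eta> / (2 * (M + 1)))"
  have \<eta>': "0 < \<eta>'" "\<eta>' < 1" "\<eta>' * (2 * (M + 1)) \<le> \<eta>"
  proof -
    show "0 < \<eta>'" "\<eta>' < 1" using \<eta> MN by (auto simp: \<eta>'_def)
    have "\<eta>' \<le> \<eta> / (2 * (M + 1))" by (simp add: \<eta>'_def)
    then show "\<eta>' * (2 * (M + 1)) \<le> \<eta>" using MN by (simp add: pos_le_divide_eq)
  qed
  define \<kappa> where "\<kappa> = 1 - \<eta>'"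
  have \<kappa>: "0 < \<kappa>" "\<kappa> < 1" using \<eta>' by (auto simp: \<kappa>_def)
  obtain T where T: "\<And>t. t \<le> T \<Longrightarrow> \<epsilon> t < \<kappa> * (1 - \<kappa>) * d0\<^sup>2" using small_perturbation[OF \<kappa>] by blast
  have lg: "left_global t (between \<kappa> t)" if "t \<le> T" for t by (rule left_global_between[OF \<kappa> T that])
  have dom: "t \<in> left_domain" if "t \<le> T" for t using lg[OF that] by (auto simp: left_domain_def)
  show ?thesis
  proof (rule that[of T])
    fix t assume t: "t \<le> T"
    show "t \<in> left_domain" by (rule dom[OF t])
    show "top_left t \<le> a t" using left_global_le_a[OF left_global_top[OF dom[OF t]], of t] by simp
    have "between \<kappa> t \<le> top_left t" using lg[OF t] left_global_iff_le_top[OF dom[OF t]] by simp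
    then have "a t - top_left t \<le> \<eta>' * (a t - r t)" by (simp add: between_def \<kappa>_def algebra_simps)
    also have "\<dots> \<le> \<eta>' * (2 * (M + 1))" using gap_bound[of t] \<eta>' by (intro mult_left_mono) auto
    also have "\<dots> \<le> \<eta>" by (rule \<eta>'(3))
    finally show "a t - top_left t \<le> \<eta>" .
  qed
qed

lemma top_left_tendsto_a: "((\<lambda>t. \<bar>a t - top_left t\<bar>) \<longlongrightarrow> 0) at_bot"
proof (rule tendstoI)
  fix e :: real assume "e > 0"
  then have "e / 2 > 0" by simp
  then obtain T where T: "\<And>t. t \<le> T \<Longrightarrow> top_left t \<le> a t" "\<And>t. t \<le> T \<Longrightarrow> a t - top_left t \<le> e / 2"
    by (rule top_left_near_a) blast
  have "\<bar>a t - top_left t\<bar> < e" if "t \<le> T" for t using T[OF that] \<open>e > 0\<close> by simp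
  then show "\<forall>\<^sub>F t in at_bot. dist \<bar>a t - top_left t\<bar> 0 < e"
    by (auto simp: eventually_at_bot_linorder)
qed

lemma top_left_deriv:
  assumes s: "s \<in> left_domain" and t: "t \<le> s"
  shows "(X s (top_left s) has_real_derivative - (top_left t)\<^sup>2 + (p t - \<epsilon> t)) (at t)"
    "X s (top_left s) t = top_left t"
proof -
  have d: "t \<in> Dom s (top_left s)" using left_globalD[OF left_global_top[OF s] t] .
  show eq: "X s (top_left s) t = top_left t" by (rule top_left_flow(2)[OF s d, symmetric])
  show "(X s (top_left s) has_real_derivative - (top_left t)\<^sup>2 + (p t - \<epsilon> t)) (at t)"
    using X_deriv[OF d] unfolding eq .
qed

text \<open>
  If a solution below \<open>top_left\<close> stayed above the barrier for all negative times, its distance to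
  \<open>top_left\<close> relative to \<open>a - r\<close> would grow exponentially backwards although it is at most \<open>1\<close>.
\<close>

lemma eventually_below_between:
  assumes s: "s \<in> left_domain" and lg: "left_global s x0" and less: "x0 < top_left s"
    and \<kappa>: "0 < \<kappa>" "\<kappa> < 1"
  obtains t1 where "t1 \<le> s" "\<And>t. t \<le> t1 \<Longrightarrow> X s x0 t \<le> between \<kappa> t"
proof -
  let ?x = "X s x0" and ?\<alpha> = "X s (top_left s)"
  obtain T1 where T1: "\<And>t. t \<le> T1 \<Longrightarrow> \<epsilon> t < \<kappa> * (1 - \<kappa>) * d0\<^sup>2" using small_perturbation[OF \<kappa>] by blast
  have "\<kappa> * d0 / 2 > 0" using \<kappa> d0 by simp
  then obtain T2 where T2: "\<And>t. t \<le> T2 \<Longrightarrow> top_left t \<le> a t" "\<And>t. t \<le> T2 \<Longrightarrow> a t - top_left t \<le> \<kappa> * d0 / 2"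
    using top_left_near_a by metis
  define T where "T = min s (min T1 T2)"
  have T: "T \<le> s" "T \<le> T1" "T \<le> T2" by (auto simp: T_def)
  have dx: "(?x has_real_derivative - (?x u)\<^sup>2 + (p u - \<epsilon> u)) (at u)" if "u \<le> s" for u
    by (rule X_deriv) (rule left_globalD[OF lg that])
  have "\<exists>t1\<le>T. ?x t1 \<le> between \<kappa> t1"
  proof (rule ccontr)
    assume "\<not> (\<exists>t1\<le>T. ?x t1 \<le> between \<kappa> t1)"
    then have above: "between \<kappa> t < ?x t" if "t \<le> T" for t using that by (meson not_le)
    define m where "m t = (?\<alpha> t - ?x t) / (a t - r t)" for t
    have \<alpha>: "?\<alpha> t = top_left t" if "t \<le> s" for t by (rule top_left_deriv(2)[OF s that])
    have d\<alpha>: "(?\<alpha> has_real_derivative - (?\<alpha> u)\<^sup>2 + (p u - \<epsilon> u)) (at u)" if "u \<le> s" for u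
      using top_left_deriv[OF s that] by simp
    have dm: "(m has_real_derivative - (?\<alpha> u - a u + (?x u - r u)) * m u) (at u)" if "u \<le> T" for u
      unfolding m_def by (rule ratio_deriv_solutions; rule d\<alpha> dx) (use that T in auto)
    have xa: "?x u < ?\<alpha> u" if "u \<le> s" for u
    proof -
      have "?x s < ?\<alpha> s \<longleftrightarrow> ?x u < ?\<alpha> u"
        by (rule X_less_iff[of "{u..s}"])
          (use that left_globalD[OF lg] left_globalD[OF left_global_top[OF s]] in \<open>auto simp: is_interval_cc\<close>)
      then show ?thesis using less by simp
    qed
    have mpos: "m u > 0" if "u \<le> s" for u using xa[OF that] gap_pos[of u] by (simp add: m_def)
    have "m T \<le> 0"
    proof (rule no_backward_growth[OF dm])
      fix u assume u: "u \<le> T"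
      have "\<kappa> * d0 \<le> \<kappa> * (a u - r u)" using gap[of u] \<kappa> by (intro mult_left_mono) auto
      then have "\<kappa> * d0 / 2 \<le> ?\<alpha> u - a u + (?x u - r u)"
        using above[OF u] T2(2)[of u] \<alpha>[of u] u T by (simp add: between_def)
      then have "(\<kappa> * d0 / 2) * m u \<le> (?\<alpha> u - a u + (?x u - r u)) * m u"
        using mpos[of u] u T by (intro mult_right_mono) auto
      then show "- (?\<alpha> u - a u + (?x u - r u)) * m u \<le> - (\<kappa> * d0 / 2) * m u"
        unfolding mult_minus_left by linarith
      have "?\<alpha> u - ?x u \<le> a u - r u"
      proof -
        have "0 \<le> \<kappa> * (a u - r u)" using \<kappa> gap_pos[of u] by simp
        then have "r u < ?x u" using above[OF u] by (simp add: between_def)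
        then show ?thesis using T2(1)[of u] \<alpha>[of u] u T by simp
      qed
      then show "m u \<le> 1" unfolding m_def using gap_pos[of u] by simp
    qed (use \<open>\<kappa> * d0 / 2 > 0\<close> in auto)
    then show False using mpos[of T] T by simp
  qed
  then obtain t1 where t1: "t1 \<le> T" "?x t1 \<le> between \<kappa> t1" by blast
  show ?thesis
  proof (rule that[of t1])
    show "t1 \<le> s" using t1 T by simp
    fix t assume t: "t \<le> t1"
    show "?x t \<le> between \<kappa> t"
    proof (rule stays_below_between[OF \<kappa> T1 t, where x = ?x])
      show "(?x has_real_derivative - (?x u)\<^sup>2 + (p u - \<epsilon> u)) (at u)" if "t \<le> u" "u \<le> t1" for u
        by (rule dx) (use that t1 T in simp)
    qed (use t1 T in auto)
  qed
qed

text \<open>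
  A solution below \<open>r\<close> at time \<open>t\<close> was pushed away from it: it remains below \<open>r\<close> up to time \<open>s\<close>, and its
  relative distance grows at rate at least \<open>d0\<close>. So at time \<open>t\<close> that distance was exponentially small.
\<close>

lemma eventually_above_r:
  assumes lg: "left_global s x0" and t: "t \<le> s"
  shows "r t - X s x0 t \<le> 2 * (M + 1) * (\<bar>r s - x0\<bar> / (a s - r s)) * exp (- d0 * (s - t))"
proof (cases "X s x0 t \<le> r t")
  case False
  have "0 \<le> 2 * (M + 1) * (\<bar>r s - x0\<bar> / (a s - r s)) * exp (- d0 * (s - t))"
    using MN gap_pos[of s] by simp
  then show ?thesis using False by linarith
next
  case True
  let ?x = "X s x0"
  define m where "m t = (r t - ?x t) / (a t - r t)" for t
  have dm: "(m has_real_derivative (a u - ?x u) * m u + \<epsilon> u / (a u - r u)) (at u)" if "u \<le> s" for u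
    unfolding m_def by (rule ratio_deriv_below_r[OF X_deriv]) (rule left_globalD[OF lg that])
  have m0: "m t \<ge> 0" using True gap_pos[of t] by (simp add: m_def)
  have nonneg: "m u \<ge> 0" if u: "t \<le> u" "u \<le> s" for u
    by (rule nonneg_barrier[OF u(1) dm]) (use u m0 gap_pos \<epsilon>pos in auto)
  have "m t * exp (d0 * (s - t)) \<le> m s"
  proof (rule exp_growth_ge[OF t dm])
    fix u assume u: "t \<le> u" "u \<le> s"
    have "?x u \<le> r u" using nonneg[OF u] gap_pos[of u] by (simp add: m_def zero_le_divide_iff)
    then have "d0 * m u \<le> (a u - ?x u) * m u" using gap[of u] nonneg[OF u] by (intro mult_right_mono) auto
    moreover have "0 < \<epsilon> u / (a u - r u)" using \<epsilon>pos gap_pos by simp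
    ultimately show "d0 * m u \<le> (a u - ?x u) * m u + \<epsilon> u / (a u - r u)" by simp
  qed simp
  also have "m s \<le> \<bar>r s - x0\<bar> / (a s - r s)" unfolding m_def using gap_pos[of s] by (simp add: divide_right_mono)
  finally have "m t * exp (d0 * (s - t)) * exp (- d0 * (s - t))
      \<le> \<bar>r s - x0\<bar> / (a s - r s) * exp (- d0 * (s - t))"
    by (rule mult_right_mono) simp
  then have mt: "m t \<le> \<bar>r s - x0\<bar> / (a s - r s) * exp (- d0 * (s - t))"
    by (simp add: mult.assoc exp_add[symmetric])
  have "r t - ?x t = (a t - r t) * m t" using gap_ne[of t] by (simp add: m_def)
  also have "\<dots> \<le> 2 * (M + 1) * (\<bar>r s - x0\<bar> / (a s - r s) * exp (- d0 * (s - t)))"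
    using gap_bound[of t] gap_pos[of t] MN m0 mt by (intro mult_mono) auto
  finally show ?thesis by (simp add: mult.assoc)
qed

lemma below_top_tendsto_r:
  assumes s: "s \<in> left_domain" and less: "x0 < top_left s"
  shows "((\<lambda>t. \<bar>r t - X s x0 t\<bar>) \<longlongrightarrow> 0) at_bot"
proof (rule tendstoI)
  fix e :: real assume e: "e > 0"
  have lg: "left_global s x0" using left_global_iff_le_top[OF s] less by simp
  define \<kappa> where "\<kappa> = min (1/2) (e / (4 * (M + 1)))"
  have \<kappa>: "0 < \<kappa>" "\<kappa> < 1" using e MN by (auto simp: \<kappa>_def)
  have \<kappa>e: "\<kappa> * (2 * (M + 1)) < e"
  proof -
    have "\<kappa> * (2 * (M + 1)) \<le> e / (4 * (M + 1)) * (2 * (M + 1))" using MN by (intro mult_right_mono) (auto simp: \<kappa>_def)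
    also have "\<dots> = e / 2" using MN by (simp add: field_simps)
    finally show ?thesis using e by simp
  qed
  obtain t1 where t1: "t1 \<le> s" "\<And>t. t \<le> t1 \<Longrightarrow> X s x0 t \<le> between \<kappa> t"
    using eventually_below_between[OF s lg less \<kappa>] by blast
  define C where "C = 2 * (M + 1) * (\<bar>r s - x0\<bar> / (a s - r s))"
  have "((\<lambda>t. C * exp (- d0 * s) * exp (d0 * t)) \<longlongrightarrow> C * exp (- d0 * s) * 0) at_bot"
    by (intro tendsto_mult tendsto_const filterlim_compose[OF exp_at_bot]
        filterlim_tendsto_pos_mult_at_bot[OF tendsto_const d0 filterlim_ident])
  then have "((\<lambda>t. C * exp (- d0 * s) * exp (d0 * t)) \<longlongrightarrow> 0) at_bot" by simp
  from order_tendstoD(2)[OF this e] obtain t2 where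
    t2: "\<And>t. t \<le> t2 \<Longrightarrow> C * exp (- d0 * s) * exp (d0 * t) < e"
    by (auto simp: eventually_at_bot_linorder)
  have "\<bar>r t - X s x0 t\<bar> < e" if t: "t \<le> min t1 t2" for t
  proof -
    have "X s x0 t - r t \<le> \<kappa> * (a t - r t)" using t1(2)[of t] t by (simp add: between_def)
    also have "\<dots> \<le> \<kappa> * (2 * (M + 1))" using gap_bound[of t] \<kappa> by (intro mult_left_mono) auto
    finally have "X s x0 t - r t < e" using \<kappa>e by simp
    moreover have "r t - X s x0 t \<le> C * exp (- d0 * (s - t))"
      unfolding C_def by (rule eventually_above_r[OF lg]) (use t t1 in auto)
    moreover have "C * exp (- d0 * (s - t)) = C * exp (- d0 * s) * exp (d0 * t)"
      by (simp add: exp_add[symmetric] mult.assoc algebra_simps)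
    moreover have "C * exp (- d0 * s) * exp (d0 * t) < e" using t2[of t] t by simp
    ultimately show ?thesis by linarith
  qed
  then show "\<forall>\<^sub>F t in at_bot. dist \<bar>r t - X s x0 t\<bar> 0 < e"
    unfolding eventually_at_bot_linorder by (intro exI[of _ "min t1 t2"]) (simp add: dist_real_def)
qed

text \<open>
  Solutions starting within \<open>d0/8\<close> of \<open>top_left\<close> lie above the middle barrier and remain there, so they
  cannot escape to \<open>-\<infinity>\<close>, and on that region the squared relative distance to \<open>top_left\<close> contracts.
\<close>

lemma top_left_pullback:
  obtains s0 \<delta> k B where "s0 \<in> left_domain" "\<delta> > 0" "k > 0"
    "\<And>s x0. s \<le> s0 \<Longrightarrow> \<bar>x0 - top_left s\<bar> \<le> \<delta> \<Longrightarrow> {s..s0} \<subseteq> Dom s x0"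
    "\<And>s t x0. s \<le> t \<Longrightarrow> t \<le> s0 \<Longrightarrow> \<bar>x0 - top_left s\<bar> \<le> \<delta> \<Longrightarrow>
      \<bar>top_left t - X s x0 t\<bar> \<le> B * exp (- k * (t - s))"
proof -
  obtain T1 where T1: "\<And>t. t \<le> T1 \<Longrightarrow> \<epsilon> t < 1/2 * (1 - 1/2) * d0\<^sup>2"
    using small_perturbation[of "1/2"] by auto
  define \<delta> where "\<delta> = d0 / 8"
  have \<delta>: "\<delta> > 0" using d0 by (simp add: \<delta>_def)
  obtain T2 where T2: "\<And>t. t \<le> T2 \<Longrightarrow> t \<in> left_domain" "\<And>t. t \<le> T2 \<Longrightarrow> top_left t \<le> a t"
    "\<And>t. t \<le> T2 \<Longrightarrow> a t - top_left t \<le> \<delta>"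
    using top_left_near_a[OF \<delta>] by blast
  define s0 where "s0 = min T1 T2"
  have s0: "s0 \<le> T1" "s0 \<le> T2" by (auto simp: s0_def)
  have half: "between (1/2) t = a t - (a t - r t) / 2" for t by (simp add: between_def field_simps)
  have start: "between (1/2) s \<le> x0" if "s \<le> s0" "\<bar>x0 - top_left s\<bar> \<le> \<delta>" for s x0
  proof -
    have "top_left s - x0 \<le> d0 / 8" using abs_le_D2[OF that(2)] by (simp add: \<delta>_def)
    moreover have "a s - top_left s \<le> d0 / 8" using T2(3)[of s] that s0 by (simp add: \<delta>_def)
    ultimately show ?thesis using gap[of s] d0 unfolding half by (simp add: field_simps)
  qed
  have above: "between (1/2) t \<le> X s x0 t"
    if "s \<le> t" "t \<le> s0" "\<bar>x0 - top_left s\<bar> \<le> \<delta>" "t \<in> Dom s x0" for s t x0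
  proof (rule stays_above_between[OF _ _ T1 that(1)])
    fix u assume "s \<le> u" "u \<le> t"
    then have "u \<in> Dom s x0" using Dom_between[OF s_in_Dom that(4)] by blast
    then show "(X s x0 has_real_derivative - (X s x0 u)\<^sup>2 + (p u - \<epsilon> u)) (at u)" by (rule X_deriv)
  qed (use that start s0 in auto)
  have dom: "{s..s0} \<subseteq> Dom s x0" if "s \<le> s0" "\<bar>x0 - top_left s\<bar> \<le> \<delta>" for s x0
  proof (rule continue_right[OF that(1)])
    fix t assume t: "t \<in> Dom s x0" "s \<le> t" "t \<le> s0"
    have "between (1/2) t \<le> X s x0 t" by (rule above) (use t that in auto)
    moreover have "- (M + 1) \<le> between (1/2) t" using between_bound[of "1/2" t] by (auto simp: abs_le_iff)
    ultimately show "- (M + 1) \<le> X s x0 t" by simp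
  qed
  \<comment> \<open>The contraction rate \<open>(top_left - a) + (x - r)\<close> is at least \<open>-d0/8 + d0/2\<close>.\<close>
  define k where "k = 3 * d0 / 8"
  have k: "k > 0" using d0 by (simp add: k_def)
  define B where "B = 2 * (M + 1) * (\<delta> / d0)"
  have est: "\<bar>top_left t - X s x0 t\<bar> \<le> B * exp (- k * (t - s))"
    if st: "s \<le> t" "t \<le> s0" and x0: "\<bar>x0 - top_left s\<bar> \<le> \<delta>" for s t x0
  proof -
    let ?x = "X s x0" and ?\<alpha> = "X t (top_left t)"
    have tl: "t \<in> left_domain" using T2(1) st s0 by simp
    have \<alpha>: "?\<alpha> u = top_left u" "(?\<alpha> has_real_derivative - (?\<alpha> u)\<^sup>2 + (p u - \<epsilon> u)) (at u)" if "u \<le> t" for u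
      using top_left_deriv[OF tl that] by simp_all
    have xd: "u \<in> Dom s x0" if "s \<le> u" "u \<le> t" for u using dom[of s x0] st x0 that by auto
    define m where "m u = (?\<alpha> u - ?x u) / (a u - r u)" for u
    define e where "e u = ?\<alpha> u - a u + (?x u - r u)" for u
    have dm: "(m has_real_derivative - e u * m u) (at u)" if "s \<le> u" "u \<le> t" for u
      unfolding m_def e_def by (rule ratio_deriv_solutions[OF \<alpha>(2)[OF that(2)] X_deriv[OF xd[OF that]]])
    \<comment> \<open>Squaring treats starting points above and below \<open>top_left\<close> at once.\<close>
    have dm2: "((\<lambda>u. (m u)\<^sup>2) has_real_derivative - 2 * e u * (m u)\<^sup>2) (at u)" if "s \<le> u" "u \<le> t" for u
      using dm[OF that] by (auto intro!: derivative_eq_intros simp: power2_eq_square)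
    have "(m t)\<^sup>2 \<le> (m s)\<^sup>2 * exp (- (2 * k) * (t - s))"
    proof (rule exp_growth_le[OF st(1) dm2])
      fix u assume u: "s \<le> u" "u \<le> t"
      have "between (1/2) u \<le> ?x u" by (rule above) (use u st x0 xd in auto)
      then have "k \<le> e u" using gap[of u] T2(3)[of u] \<alpha>(1)[OF u(2)] u st s0 d0
        unfolding half e_def k_def \<delta>_def by (simp add: field_simps)
      then show "- 2 * e u * (m u)\<^sup>2 \<le> - (2 * k) * (m u)\<^sup>2" by (simp add: mult_right_mono)
    qed
    also have "\<dots> = (\<bar>m s\<bar> * exp (- k * (t - s)))\<^sup>2"
      by (simp add: power_mult_distrib power2_eq_square[of "exp _"] exp_add[symmetric])
    finally have mt: "\<bar>m t\<bar> \<le> \<bar>m s\<bar> * exp (- k * (t - s))"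
      by (metis abs_ge_zero exp_ge_zero mult_nonneg_nonneg power2_abs power2_le_imp_le)
    have "\<bar>m s\<bar> = \<bar>x0 - top_left s\<bar> / (a s - r s)"
      using \<alpha>(1)[of s] st gap_pos[of s] by (simp add: m_def abs_divide abs_minus_commute)
    also have "\<dots> \<le> \<delta> / d0" using x0 gap[of s] d0 by (intro frac_le) auto
    finally have ms: "\<bar>m s\<bar> \<le> \<delta> / d0" .
    have "\<bar>top_left t - ?x t\<bar> = (a t - r t) * \<bar>m t\<bar>"
      using gap_pos[of t] \<alpha>(1)[of t] by (simp add: m_def abs_divide)
    also have "\<dots> \<le> 2 * (M + 1) * (\<delta> / d0 * exp (- k * (t - s)))"
      using gap_bound[of t] gap_pos[of t] MN order_trans[OF mt mult_right_mono[OF ms]]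
      by (intro mult_mono) auto
    finally show ?thesis by (simp add: B_def mult.assoc)
  qed
  show ?thesis using that[OF T2(1)[OF s0(2)] \<delta> k dom est] .
qed

end

section \<open>The transition equation near minus infinity\<close>

definition transition :: "real \<Rightarrow> real \<Rightarrow> real" where
  "transition c t = 2 / pi * arctan (c * t)"

definition transition_rate :: "real \<Rightarrow> real \<Rightarrow> real" where
  "transition_rate c t = 2 * c / pi / (1 + (c * t)\<^sup>2)"

lemma transition_deriv: "(transition c has_real_derivative transition_rate c t) (at t)"
proof -
  have "((\<lambda>t. 2 / pi * arctan (c * t)) has_real_derivative 2 / pi * (inverse (1 + (c * t)\<^sup>2) * c)) (at t)"
    by (intro DERIV_cmult DERIV_chain'[where f = "\<lambda>t. c * t"] DERIV_arctan) (auto intro!: derivative_eq_intros)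
  then show ?thesis
    by (simp add: transition_def[abs_def] transition_rate_def divide_inverse mult_ac)
qed

lemma transition_bound: "\<bar>transition c t\<bar> \<le> 1"
proof -
  have "\<bar>arctan (c * t)\<bar> \<le> pi / 2" using arctan_bounded[of "c * t"] by (auto simp: abs_le_iff)
  then have "2 / pi * \<bar>arctan (c * t)\<bar> \<le> 2 / pi * (pi / 2)" by (intro mult_left_mono) auto
  then show ?thesis by (simp add: transition_def abs_mult)
qed

lemma transition_at_bot:
  assumes "c > 0"
  shows "(transition c \<longlongrightarrow> - 1) at_bot"
proof -
  have "LIM t at_bot. c * t :> at_bot"
    by (rule filterlim_tendsto_pos_mult_at_bot[OF tendsto_const assms filterlim_ident])
  then have "((\<lambda>t. 2 / pi * arctan (c * t)) \<longlongrightarrow> 2 / pi * (- (pi / 2))) at_bot"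
    by (intro tendsto_mult tendsto_const filterlim_compose[OF tendsto_arctan_at_bot])
  then show ?thesis by (simp add: transition_def[abs_def])
qed

lemma transition_rate_pos: "c > 0 \<Longrightarrow> 0 < transition_rate c t"
  by (simp add: transition_rate_def add_pos_nonneg)

lemma transition_rate_le: "c > 0 \<Longrightarrow> transition_rate c t \<le> 2 * c / pi"
  unfolding transition_rate_def using divide_left_mono[of 1 "1 + (c * t)\<^sup>2" "2 * c / pi"]
  by (simp add: add_pos_nonneg)

lemma transition_rate_continuous: "continuous_on UNIV (transition_rate c)"
  unfolding transition_rate_def
  by (intro continuous_intros) (auto simp: add_nonneg_eq_0_iff)

lemma transition_rate_at_bot:
  assumes "c > 0"
  shows "(transition_rate c \<longlongrightarrow> 0) at_bot"
proof -
  have "LIM t at_bot. c * t :> at_bot"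
    by (rule filterlim_tendsto_pos_mult_at_bot[OF tendsto_const assms filterlim_ident])
  then have "LIM t at_bot. (c * t)\<^sup>2 :> at_top"
    by (intro filterlim_pow_at_bot_even) auto
  then have "LIM t at_bot. 1 + (c * t)\<^sup>2 :> at_top"
    by (intro filterlim_tendsto_add_at_top[OF tendsto_const])
  then show ?thesis unfolding transition_rate_def
    by (intro tendsto_divide_0[OF tendsto_const] filterlim_at_top_imp_at_infinity)
qed

text \<open>
  The shift \<open>x = y - transition c t\<close> trades the moving centre of the square for the forcing
  \<open>- transition_rate c t\<close>.
\<close>

lemma Ec_conjugate_quad:
  "conjugacy 1 1 (transition c) (transition_rate c) (quad (\<lambda>t. p t - transition_rate c t)) (Ec p c)"
proof
  show "Ec p c = conjugate_rhs 1 1 (transition c) (transition_rate c) (quad (\<lambda>t. p t - transition_rate c t))"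
    by (simp add: fun_eq_iff conjugate_rhs_def Ec_def quad_def transition_def)
qed (auto intro: transition_deriv)

locale transition_equation =
  fixes p a r :: "real \<Rightarrow> real" and M d0 c :: real
  assumes contp': "continuous_on UNIV p" and boundp': "\<And>t. \<bar>p t\<bar> \<le> M"
    and da': "\<And>t. (a has_real_derivative - (a t)\<^sup>2 + p t) (at t)"
    and dr': "\<And>t. (r has_real_derivative - (r t)\<^sup>2 + p t) (at t)"
    and d0': "d0 > 0" and gap': "\<And>t. d0 \<le> a t - r t" and c: "c > 0"
    and no_bounded: "\<not> (\<exists>y. bounded_solution (Ec p c) y)"
begin

sublocale perturbed_riccati p "transition_rate c" a r M "2 * c / pi" d0
  by unfold_locales (use c contp' boundp' da' dr' d0' gap' transition_rate_continuous transition_rate_pos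
    transition_rate_le transition_rate_at_bot in auto)

sublocale Ec: conjugacy 1 1 "transition c" "transition_rate c" "quad (\<lambda>t. p t - transition_rate c t)" "Ec p c"
  by (rule Ec_conjugate_quad)

abbreviation g :: "real \<Rightarrow> real" where "g \<equiv> transition c"

lemma unique_Ec: "unique_solutions (Ec p c)"
  by (rule Ec.unique_solutions_conjugate[OF unique_solutions_quad])

lemma maxdom_Ec: "maxdom (Ec p c) s y0 = Dom s (y0 - g s)"
  using Ec.maxdom_eq[of s "y0 - g s"] by simp

lemma maxsol_Ec: "t \<in> Dom s (y0 - g s) \<Longrightarrow> maxsol (Ec p c) t s y0 = X s (y0 - g s) t + g t"
  using Ec.maxsol_eq[OF unique_solutions_quad, of t s "y0 - g s"] by simp

lemma g_bounds: "- 1 \<le> g t" "g t \<le> 1"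
  using transition_bound[of c t] by (simp_all add: abs_le_iff)

text \<open>
  The shift is bounded, so boundedness of \<open>y\<close> and of \<open>x\<close> are the same.
\<close>

lemma bdd_above_left_iff: "bdd_above_left p c s y0 \<longleftrightarrow> left_global s (y0 - g s)"
proof -
  have "bdd_above ((\<lambda>t. maxsol (Ec p c) t s y0) ` (maxdom (Ec p c) s y0 \<inter> {..s})) \<longleftrightarrow>
      bdd_above (X s (y0 - g s) ` (Dom s (y0 - g s) \<inter> {..s}))" (is "?l \<longleftrightarrow> ?r")
  proof
    assume ?l
    then obtain K where K: "\<And>t. t \<in> Dom s (y0 - g s) \<Longrightarrow> t \<le> s \<Longrightarrow> maxsol (Ec p c) t s y0 \<le> K"
      by (auto simp: bdd_above_def maxdom_Ec)
    show ?r
    proof (rule bdd_aboveI2)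
      fix t assume "t \<in> Dom s (y0 - g s) \<inter> {..s}"
      then show "X s (y0 - g s) t \<le> K + 1" using K[of t] maxsol_Ec[of t s y0] g_bounds[of t] by simp
    qed
  next
    assume ?r
    then obtain K where K: "\<And>t. t \<in> Dom s (y0 - g s) \<Longrightarrow> t \<le> s \<Longrightarrow> X s (y0 - g s) t \<le> K"
      by (auto simp: bdd_above_def)
    show ?l
    proof (rule bdd_aboveI2)
      fix t assume "t \<in> maxdom (Ec p c) s y0 \<inter> {..s}"
      then show "maxsol (Ec p c) t s y0 \<le> K + 1"
        using K[of t] maxsol_Ec[of t s y0] g_bounds[of t] by (simp add: maxdom_Ec)
    qed
  qed
  then show ?thesis by (simp add: bdd_above_left_def left_global_iff_bdd_above)
qed

lemma bounded_left_iff: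
  "bounded ((\<lambda>t. maxsol (Ec p c) t s y0) ` (maxdom (Ec p c) s y0 \<inter> {..s})) \<longleftrightarrow> left_global s (y0 - g s)"
proof
  assume "bounded ((\<lambda>t. maxsol (Ec p c) t s y0) ` (maxdom (Ec p c) s y0 \<inter> {..s}))"
  then show "left_global s (y0 - g s)"
    using bounded_imp_bdd_above bdd_above_left_iff unfolding bdd_above_left_def by blast
next
  assume lg: "left_global s (y0 - g s)"
  then obtain K where K: "\<And>t. t \<le> s \<Longrightarrow> \<bar>X s (y0 - g s) t\<bar> \<le> K"
    using left_global_bounded[OF lg] by (auto simp: bounded_iff)
  show "bounded ((\<lambda>t. maxsol (Ec p c) t s y0) ` (maxdom (Ec p c) s y0 \<inter> {..s}))"
    unfolding bounded_iff
  proof (intro exI ballI)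
    fix z assume "z \<in> (\<lambda>t. maxsol (Ec p c) t s y0) ` (maxdom (Ec p c) s y0 \<inter> {..s})"
    then obtain t where t: "t \<in> Dom s (y0 - g s)" "t \<le> s" "z = maxsol (Ec p c) t s y0" by (auto simp: maxdom_Ec)
    have "\<bar>X s (y0 - g s) t + g t\<bar> \<le> \<bar>X s (y0 - g s) t\<bar> + \<bar>g t\<bar>" by (rule abs_triangle_ineq)
    then show "norm z \<le> K + 1" using K[OF t(2)] transition_bound[of c t] maxsol_Ec[OF t(1)] t(3) by simp
  qed
qed

lemma R_minus_eq: "R_minus p c = left_domain"
proof -
  have "(\<exists>y0. left_global s (y0 - g s)) \<longleftrightarrow> (\<exists>x0. left_global s x0)" for s
    by (metis add_diff_cancel_right')
  then show ?thesis by (simp add: R_minus_def left_domain_def bdd_above_left_iff)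
qed

lemma bdd_above_left_iff_le:
  assumes "s \<in> left_domain"
  shows "bdd_above_left p c s y0 \<longleftrightarrow> y0 \<le> top_left s + g s"
  using left_global_iff_le_top[OF assms, of "y0 - g s"] by (auto simp: bdd_above_left_iff)

lemma a_c_eq: "s \<in> left_domain \<Longrightarrow> a_c p c s = top_left s + g s"
  unfolding a_c_def by (rule Greatest_equality) (auto simp: bdd_above_left_iff_le)

lemma left_global_iff_le_a_c: "s \<in> left_domain \<Longrightarrow> left_global s (y0 - g s) \<longleftrightarrow> y0 \<le> a_c p c s"
  using bdd_above_left_iff_le[of s y0] by (simp add: a_c_eq bdd_above_left_iff)

text \<open>
  This is where the absence of bounded solutions enters: global solutions of a Riccati equation with
  bounded coefficient are automatically bounded.
\<close>

lemma no_global: "Dom 0 x0 \<noteq> UNIV"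
proof
  assume U: "Dom 0 x0 = UNIV"
  have "solves_ivp (Ec p c) 0 (x0 + g 0) UNIV (\<lambda>t. X 0 x0 t + g t)"
    using Ec.solves_ivp_forward[OF X_solves, of 0 x0] U by simp
  then have "solves_on (Ec p c) (\<lambda>t. X 0 x0 t + g t) UNIV" by (simp add: solves_ivp_def)
  moreover have "bounded (range (\<lambda>t. X 0 x0 t + g t))"
  proof -
    have "\<bar>X 0 x0 t\<bar> \<le> M + 2 * c / pi + 1" for t
      by (rule global_solution_bound) (rule X_deriv, simp add: U)
    then have "\<bar>X 0 x0 t + g t\<bar> \<le> M + 2 * c / pi + 1 + 1" for t
      using transition_bound[of c t] abs_triangle_ineq[of "X 0 x0 t" "g t"] by (meson add_mono order_trans)
    then show ?thesis by (auto simp: bounded_iff)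
  qed
  ultimately show False using no_bounded unfolding bounded_solution_def by blast
qed

lemma approaches_a: "((\<lambda>t. \<bar>a t - 1 - a_c p c t\<bar>) \<longlongrightarrow> 0) at_bot"
proof -
  obtain T where T: "\<And>t. t \<le> T \<Longrightarrow> t \<in> left_domain"
    by (rule top_left_near_a[OF zero_less_one]) blast
  have "((\<lambda>t. (a t - top_left t) - (1 + g t)) \<longlongrightarrow> 0 - (1 + - 1)) at_bot"
    by (intro tendsto_diff tendsto_add tendsto_const transition_at_bot c
        tendsto_rabs_zero_cancel[OF top_left_tendsto_a])
  then have "((\<lambda>t. \<bar>(a t - top_left t) - (1 + g t)\<bar>) \<longlongrightarrow> 0) at_bot"
    by (intro tendsto_rabs_zero) simp
  then show ?thesis
  proof (rule Lim_transform_eventually)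
    show "\<forall>\<^sub>F t in at_bot. \<bar>a t - top_left t - (1 + g t)\<bar> = \<bar>a t - 1 - a_c p c t\<bar>"
      unfolding eventually_at_bot_linorder
      by (rule exI[of _ T]) (use a_c_eq T in \<open>auto simp: algebra_simps\<close>)
  qed
qed

lemma maxsol_minus_asymptotics:
  assumes lg: "left_global s (y0 - g s)"
    and lim: "((\<lambda>t. \<bar>b t - X s (y0 - g s) t\<bar>) \<longlongrightarrow> 0) at_bot"
  shows "((\<lambda>t. \<bar>b t - 1 - maxsol (Ec p c) t s y0\<bar>) \<longlongrightarrow> 0) at_bot"
proof -
  have "((\<lambda>t. (b t - X s (y0 - g s) t) - (1 + g t)) \<longlongrightarrow> 0 - (1 + - 1)) at_bot"
    by (intro tendsto_diff tendsto_add tendsto_const transition_at_bot c tendsto_rabs_zero_cancel[OF lim])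
  then have "((\<lambda>t. \<bar>(b t - X s (y0 - g s) t) - (1 + g t)\<bar>) \<longlongrightarrow> 0) at_bot"
    by (intro tendsto_rabs_zero) simp
  then show ?thesis
  proof (rule Lim_transform_eventually)
    show "\<forall>\<^sub>F t in at_bot. \<bar>b t - X s (y0 - g s) t - (1 + g t)\<bar> = \<bar>b t - 1 - maxsol (Ec p c) t s y0\<bar>"
      unfolding eventually_at_bot_linorder
      by (rule exI[of _ s]) (use maxsol_Ec left_globalD[OF lg] in \<open>auto simp: algebra_simps\<close>)
  qed
qed

lemma bounded_to_minus_infinity_iff:
  assumes s: "s \<in> left_domain"
  shows "bounded_to_minus_infinity (Ec p c) s y0 \<longleftrightarrow> y0 \<le> a_c p c s"
proof -
  have "bounded_to_minus_infinity (Ec p c) s y0 \<longleftrightarrow> left_global s (y0 - g s)"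
  proof
    assume "bounded_to_minus_infinity (Ec p c) s y0"
    then show "left_global s (y0 - g s)"
      by (simp add: bounded_to_minus_infinity_def maxdom_Ec left_global_def)
  next
    assume lg: "left_global s (y0 - g s)"
    then have sub: "{..s} \<subseteq> maxdom (Ec p c) s y0" by (simp add: maxdom_Ec left_global_def)
    then have "maxdom (Ec p c) s y0 \<inter> {..s} = {..s}" by blast
    then show "bounded_to_minus_infinity (Ec p c) s y0"
      using lg sub bounded_left_iff[of s y0] by (simp add: bounded_to_minus_infinity_def)
  qed
  then show ?thesis by (simp add: left_global_iff_le_a_c[OF s])
qed

lemma approaches_r_iff:
  assumes s: "s \<in> left_domain"
  shows "approaches_at_minus_infinity (Ec p c) s y0 (\<lambda>t. r t - 1) \<longleftrightarrow> y0 < a_c p c s"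
proof
  assume "y0 < a_c p c s"
  then have less: "y0 - g s < top_left s" by (simp add: a_c_eq[OF s])
  then have lg: "left_global s (y0 - g s)" using left_global_iff_le_top[OF s] by simp
  show "approaches_at_minus_infinity (Ec p c) s y0 (\<lambda>t. r t - 1)"
    unfolding approaches_at_minus_infinity_def
    using lg maxsol_minus_asymptotics[OF lg below_top_tendsto_r[OF s less]]
    by (simp add: maxdom_Ec left_global_def)
next
  assume ap: "approaches_at_minus_infinity (Ec p c) s y0 (\<lambda>t. r t - 1)"
  then have lg: "left_global s (y0 - g s)"
    by (simp add: approaches_at_minus_infinity_def maxdom_Ec left_global_def)
  show "y0 < a_c p c s"
  proof (rule ccontr)
    assume "\<not> y0 < a_c p c s"
    then have eq: "y0 - g s = top_left s"
      using lg left_global_iff_le_top[OF s] a_c_eq[OF s] by fastforce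
    have "((\<lambda>t. \<bar>a t - X s (y0 - g s) t\<bar>) \<longlongrightarrow> 0) at_bot"
      using top_left_tendsto_a
    proof (rule Lim_transform_eventually)
      show "\<forall>\<^sub>F t in at_bot. \<bar>a t - top_left t\<bar> = \<bar>a t - X s (y0 - g s) t\<bar>"
        unfolding eventually_at_bot_linorder eq
        by (rule exI[of _ s]) (use top_left_deriv(2)[OF s] in simp)
    qed
    from tendsto_rabs_zero_cancel[OF maxsol_minus_asymptotics[OF lg this]]
    have 1: "((\<lambda>t. a t - 1 - maxsol (Ec p c) t s y0) \<longlongrightarrow> 0) at_bot" .
    have 2: "((\<lambda>t. r t - 1 - maxsol (Ec p c) t s y0) \<longlongrightarrow> 0) at_bot"
      using ap unfolding approaches_at_minus_infinity_def by (blast intro: tendsto_rabs_zero_cancel)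
    have "((\<lambda>t. a t - r t) \<longlongrightarrow> 0) at_bot" using tendsto_diff[OF 1 2] by simp
    then have "d0 \<le> 0" by (rule tendsto_lowerbound) (use gap in auto)
    then show False using d0 by simp
  qed
qed

lemma a_c_pullback_attractive:
  assumes l: "left_domain = {..<l}"
    and dtop: "\<And>t. t < l \<Longrightarrow> (top_left has_real_derivative - (top_left t)\<^sup>2 + (p t - transition_rate c t)) (at t)"
  shows "locally_pullback_attractive (Ec p c) (ereal l) (a_c p c)"
proof -
  have ac: "a_c p c t = top_left t + g t" if "t < l" for t using a_c_eq l that by simp
  have "solves_on (Ec p c) (a_c p c) {t. ereal t < ereal l}"
    unfolding solves_on_def
  proof
    fix t assume t: "t \<in> {t. ereal t < ereal l}"
    have "((\<lambda>t. top_left t + g t) has_real_derivative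
        - (top_left t)\<^sup>2 + (p t - transition_rate c t) + transition_rate c t) (at t)"
      by (intro DERIV_add dtop transition_deriv) (use t in simp)
    then have "((\<lambda>t. top_left t + g t) has_real_derivative Ec p c t (a_c p c t)) (at t)"
      using t by (simp add: ac Ec_def transition_def)
    then have "(a_c p c has_real_derivative Ec p c t (a_c p c t)) (at t)"
      by (rule has_field_derivative_transform_within_open[of _ _ _ "{..<l}"]) (use t ac in auto)
    then show "(a_c p c has_real_derivative Ec p c t (a_c p c t)) (at t within {t. ereal t < ereal l})"
      by (rule has_field_derivative_at_within)
  qed
  moreover obtain s0 \<delta> k B where s0: "s0 \<in> left_domain" and pos: "\<delta> > 0" "k > 0"
    and dom: "\<And>s x0. s \<le> s0 \<Longrightarrow> \<bar>x0 - top_left s\<bar> \<le> \<delta> \<Longrightarrow> {s..s0} \<subseteq> Dom s x0"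
    and est: "\<And>s t x0. s \<le> t \<Longrightarrow> t \<le> s0 \<Longrightarrow> \<bar>x0 - top_left s\<bar> \<le> \<delta> \<Longrightarrow>
      \<bar>top_left t - X s x0 t\<bar> \<le> B * exp (- k * (t - s))"
    by (rule top_left_pullback) blast
  have s0l: "s0 < l" using s0 l by simp
  have shift: "\<bar>(y0 - g s) - top_left s\<bar> = \<bar>y0 - a_c p c s\<bar>" if "s \<le> s0" for s y0
    using ac[of s] that s0l by (simp add: algebra_simps)
  have dom': "{s..s0} \<subseteq> maxdom (Ec p c) s y0" if "s \<le> s0" "\<bar>y0 - a_c p c s\<bar> \<le> \<delta>" for s y0
    using dom[OF that(1), of "y0 - g s"] that by (simp add: maxdom_Ec shift)
  have est': "\<bar>a_c p c t - maxsol (Ec p c) t s y0\<bar> \<le> B * exp (- k * (t - s))"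
    if "s \<le> t" "t \<le> s0" "\<bar>y0 - a_c p c s\<bar> \<le> \<delta>" for s t y0
  proof -
    have "t \<in> Dom s (y0 - g s)" using dom'[of s y0] that by (auto simp: maxdom_Ec)
    then have "a_c p c t - maxsol (Ec p c) t s y0 = top_left t - X s (y0 - g s) t"
      using ac[of t] that s0l by (simp add: maxsol_Ec)
    moreover have "\<bar>(y0 - g s) - top_left s\<bar> \<le> \<delta>" using shift[of s y0] that by simp
    ultimately show ?thesis using est[OF that(1,2), of "y0 - g s"] by simp
  qed
  have lim: "((\<lambda>s. SUP y0\<in>{a_c p c s - \<delta>..a_c p c s + \<delta>}. \<bar>a_c p c t - maxsol (Ec p c) t s y0\<bar>) \<longlongrightarrow> 0) at_bot"
    (is "(?S \<longlongrightarrow> 0) at_bot") if t: "t \<le> s0" for t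
  proof (rule real_tendsto_sandwich)
    have mem: "\<bar>y0 - a_c p c s\<bar> \<le> \<delta>" if "y0 \<in> {a_c p c s - \<delta>..a_c p c s + \<delta>}" for y0 s
      using that by (auto simp: abs_le_iff)
    have le: "\<bar>a_c p c t - maxsol (Ec p c) t s y0\<bar> \<le> B * exp (- k * (t - s))"
      if "s \<le> t" "y0 \<in> {a_c p c s - \<delta>..a_c p c s + \<delta>}" for s y0
      by (rule est'[OF that(1) t mem[OF that(2)]])
    have "0 \<le> ?S s" if "s \<le> t" for s
    proof (rule cSUP_upper2[where x = "a_c p c s"])
      show "bdd_above ((\<lambda>y0. \<bar>a_c p c t - maxsol (Ec p c) t s y0\<bar>) ` {a_c p c s - \<delta>..a_c p c s + \<delta>})"
        by (rule bdd_aboveI2) (rule le[OF that])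
    qed (use pos in auto)
    then show "\<forall>\<^sub>F s in at_bot. 0 \<le> ?S s" by (auto simp: eventually_at_bot_linorder)
    have "?S s \<le> B * exp (- k * (t - s))" if "s \<le> t" for s
      by (rule cSUP_least) (use pos le[OF that] in auto)
    then show "\<forall>\<^sub>F s in at_bot. ?S s \<le> B * exp (- k * (t - s))"
      by (auto simp: eventually_at_bot_linorder)
    have "((\<lambda>s. B * exp (- k * t) * exp (k * s)) \<longlongrightarrow> B * exp (- k * t) * 0) at_bot"
      by (intro tendsto_mult tendsto_const filterlim_compose[OF exp_at_bot]
          filterlim_tendsto_pos_mult_at_bot[OF tendsto_const pos(2) filterlim_ident])
    moreover have "B * exp (- k * t) * exp (k * s) = B * exp (- k * (t - s))" for s
      by (simp add: exp_add[symmetric] mult.assoc algebra_simps)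
    ultimately show "((\<lambda>s. B * exp (- k * (t - s))) \<longlongrightarrow> 0) at_bot"
      by (simp only: mult_zero_right)
  qed simp
  show ?thesis
    unfolding locally_pullback_attractive_def
  proof (rule conjI[OF _ exI[of _ s0, OF exI[of _ \<delta>]]]; (intro conjI allI impI)?)
    show "solves_on (Ec p c) (a_c p c) {t. ereal t < ereal l}" by fact
  qed (use s0l pos dom' lim in auto)
qed

theorem behaviour_at_minus_infinity:
  "\<exists>l. R_minus p c = {..<l} \<and> filterlim (a_c p c) at_bot (at_left l) \<and>
    locally_pullback_attractive (Ec p c) (ereal l) (a_c p c) \<and>
    ((\<lambda>t. \<bar>a t - 1 - a_c p c t\<bar>) \<longlongrightarrow> 0) at_bot \<and>
    (\<forall>s y0. s < l \<longrightarrow>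
      (bdd_above_left p c s y0 \<longleftrightarrow> y0 \<le> a_c p c s) \<and>
      (bounded_to_minus_infinity (Ec p c) s y0 \<longleftrightarrow> y0 \<le> a_c p c s) \<and>
      (approaches_at_minus_infinity (Ec p c) s y0 (\<lambda>t. r t - 1) \<longleftrightarrow> y0 < a_c p c s)) \<and>
    (\<forall>s y0. bounded ((\<lambda>t. maxsol (Ec p c) t s y0) ` (maxdom (Ec p c) s y0 \<inter> {..s})) \<longleftrightarrow>
      s < l \<and> y0 \<le> a_c p c s)"
proof -
  obtain l where l: "left_domain = {..<l}"
    and dtop: "\<And>t. t < l \<Longrightarrow> (top_left has_real_derivative - (top_left t)\<^sup>2 + (p t - transition_rate c t)) (at t)"
    and top: "filterlim top_left at_bot (at_left l)"
    using left_domain_halfline[OF left_domain_nonempty no_global] by blast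
  have mem: "s \<in> left_domain \<longleftrightarrow> s < l" for s by (simp add: l)
  have top_c: "filterlim (a_c p c) at_bot (at_left l)"
    unfolding filterlim_at_bot
  proof
    fix Z :: real
    have "\<forall>\<^sub>F t in at_left l. top_left t \<le> Z - 1" using top by (simp add: filterlim_at_bot)
    moreover have "\<forall>\<^sub>F t in at_left l. t < l" by (simp add: eventually_at_filter)
    ultimately show "\<forall>\<^sub>F t in at_left l. a_c p c t \<le> Z"
    proof eventually_elim
      case (elim t)
      then show ?case using a_c_eq[of t] g_bounds[of t] mem[of t] by simp
    qed
  qed
  have bdd: "bounded ((\<lambda>t. maxsol (Ec p c) t s y0) ` (maxdom (Ec p c) s y0 \<inter> {..s})) \<longleftrightarrow>
      s < l \<and> y0 \<le> a_c p c s" for s y0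
  proof (cases "s < l")
    case True then show ?thesis by (simp add: bounded_left_iff left_global_iff_le_a_c mem)
  next
    case False
    then have "\<not> left_global s (y0 - g s)" using mem[of s] by (auto simp: left_domain_def)
    then show ?thesis using False by (simp add: bounded_left_iff)
  qed
  have R: "R_minus p c = {..<l}" by (simp add: R_minus_eq l)
  show ?thesis
    using R top_c a_c_pullback_attractive[OF l dtop] approaches_a bdd
      left_global_iff_le_a_c bounded_to_minus_infinity_iff approaches_r_iff
    unfolding mem bdd_above_left_iff by blast
qed

end

section \<open>Reflection in time\<close>

lemma Ec_reflection: "conjugacy (- 1) (- 1) (\<lambda>_. 0) (\<lambda>_. 0) (Ec p c) (Ec (\<lambda>t. p (- t)) c)"
proof
  have "(- z + b)\<^sup>2 = (z - b)\<^sup>2" for z b :: real by (simp add: power2_eq_square algebra_simps)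
  then show "Ec (\<lambda>t. p (- t)) c = conjugate_rhs (- 1) (- 1) (\<lambda>_. 0) (\<lambda>_. 0) (Ec p c)"
    by (simp add: fun_eq_iff conjugate_rhs_def Ec_def arctan_minus)
qed auto

lemma sign_change: "conjugacy 1 (- 1) (\<lambda>_. 0) (\<lambda>_. 0) h (\<lambda>t y. - h t (- y))"
  by unfold_locales (auto simp: fun_eq_iff conjugate_rhs_def)

lemma solves_on_cong:
  assumes eq: "\<And>t. t \<in> I \<Longrightarrow> y t = z t" and y: "solves_on h y I"
  shows "solves_on h z I"
  unfolding solves_on_def
proof
  fix t assume t: "t \<in> I"
  have "(y has_real_derivative h t (z t)) (at t within I)"
    using y t eq[OF t] unfolding solves_on_def by metis
  then show "(z has_real_derivative h t (z t)) (at t within I)"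
    unfolding has_field_derivative_def by (rule has_derivative_transform[OF t, rotated]) (simp add: eq)
qed

lemma locally_pullback_attractive_cong:
  assumes eq: "\<And>t. ereal t < \<beta> \<Longrightarrow> b t = b' t" and lpa: "locally_pullback_attractive h \<beta> b"
  shows "locally_pullback_attractive h \<beta> b'"
proof -
  obtain s0 \<delta> where s0: "ereal s0 < \<beta>" "\<delta> > 0"
    and dom: "\<And>s y0. s \<le> s0 \<Longrightarrow> \<bar>y0 - b s\<bar> \<le> \<delta> \<Longrightarrow> {s..s0} \<subseteq> maxdom h s y0"
    and lim: "\<And>t. t \<le> s0 \<Longrightarrow> ((\<lambda>s. SUP y0\<in>{b s - \<delta>..b s + \<delta>}. \<bar>b t - maxsol h t s y0\<bar>) \<longlongrightarrow> 0) at_bot"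
    and sol: "solves_on h b {t. ereal t < \<beta>}"
    using lpa unfolding locally_pullback_attractive_def by blast
  have le: "b t = b' t" if "t \<le> s0" for t
    using eq[of t] that s0(1) by (meson ereal_less_eq(3) le_less_trans)
  show ?thesis
    unfolding locally_pullback_attractive_def
  proof (rule conjI[OF _ exI[of _ s0, OF exI[of _ \<delta>]]]; (intro conjI allI impI)?)
    show "solves_on h b' {t. ereal t < \<beta>}" by (rule solves_on_cong[OF _ sol]) (simp add: eq)
    show "{s..s0} \<subseteq> maxdom h s y0" if "s \<le> s0" "\<bar>y0 - b' s\<bar> \<le> \<delta>" for s y0
      using dom[of s y0] le[of s] that by simp
    show "((\<lambda>s. SUP y0\<in>{b' s - \<delta>..b' s + \<delta>}. \<bar>b' t - maxsol h t s y0\<bar>) \<longlongrightarrow> 0) at_bot"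
      if t: "t \<le> s0" for t
      using lim[OF t]
    proof (rule Lim_transform_eventually)
      show "\<forall>\<^sub>F s in at_bot. (SUP y0\<in>{b s - \<delta>..b s + \<delta>}. \<bar>b t - maxsol h t s y0\<bar>) =
          (SUP y0\<in>{b' s - \<delta>..b' s + \<delta>}. \<bar>b' t - maxsol h t s y0\<bar>)"
        unfolding eventually_at_bot_linorder by (rule exI[of _ s0]) (simp add: le t)
    qed
  qed (fact s0)+
qed

text \<open>
  The definition of pullback repulsion reverses time only, whereas \<open>(E_c)\<close> is invariant under reversing
  time and sign together; the sign has to be undone separately.
\<close>

lemma locally_pullback_attractive_sign_change:
  assumes u: "unique_solutions h" and lpa: "locally_pullback_attractive h \<beta> b"
  shows "locally_pullback_attractive (\<lambda>t y. - h t (- y)) \<beta> (\<lambda>t. - b t)"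
proof -
  interpret conjugacy 1 "- 1" "\<lambda>_. 0" "\<lambda>_. 0" h "\<lambda>t y. - h t (- y)" by (rule sign_change)
  obtain s0 \<delta> where s0: "ereal s0 < \<beta>" "\<delta> > 0"
    and dom: "\<And>s y0. s \<le> s0 \<Longrightarrow> \<bar>y0 - b s\<bar> \<le> \<delta> \<Longrightarrow> {s..s0} \<subseteq> maxdom h s y0"
    and lim: "\<And>t. t \<le> s0 \<Longrightarrow> ((\<lambda>s. SUP y0\<in>{b s - \<delta>..b s + \<delta>}. \<bar>b t - maxsol h t s y0\<bar>) \<longlongrightarrow> 0) at_bot"
    and sol: "solves_on h b {t. ereal t < \<beta>}"
    using lpa unfolding locally_pullback_attractive_def by blast
  have md: "maxdom (\<lambda>t y. - h t (- y)) s y0 = maxdom h s (- y0)" for s y0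
    using maxdom_eq[of s "- y0"] by simp
  have ms: "maxsol (\<lambda>t y. - h t (- y)) t s y0 = - maxsol h t s (- y0)" if "t \<in> maxdom h s (- y0)" for t s y0
    using maxsol_eq[OF u that] by simp
  have eq: "(SUP y0\<in>{- b s - \<delta>..- b s + \<delta>}. \<bar>- b t - maxsol (\<lambda>t y. - h t (- y)) t s y0\<bar>) =
      (SUP y0\<in>{b s - \<delta>..b s + \<delta>}. \<bar>b t - maxsol h t s y0\<bar>)" if st: "s \<le> t" "t \<le> s0" for s t
  proof -
    have img: "{- b s - \<delta>..- b s + \<delta>} = uminus ` {b s - \<delta>..b s + \<delta>}" by simp
    have "\<bar>- b t - maxsol (\<lambda>t y. - h t (- y)) t s (- y0)\<bar> = \<bar>b t - maxsol h t s y0\<bar>"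
      if "y0 \<in> {b s - \<delta>..b s + \<delta>}" for y0
    proof -
      have "\<bar>y0 - b s\<bar> \<le> \<delta>" using that by (auto simp: abs_le_iff)
      then have "t \<in> maxdom h s (- (- y0))" using dom[of s y0] st by auto
      from ms[OF this] show ?thesis by simp
    qed
    then show ?thesis unfolding img image_image by (intro SUP_cong) auto
  qed
  show ?thesis
    unfolding locally_pullback_attractive_def
  proof (rule conjI[OF _ exI[of _ s0, OF exI[of _ \<delta>]]]; (intro conjI allI impI)?)
    show "solves_on (\<lambda>t y. - h t (- y)) (\<lambda>t. - b t) {t. ereal t < \<beta>}"
      using sol unfolding solves_on_def by (auto intro: DERIV_minus)
    show "{s..s0} \<subseteq> maxdom (\<lambda>t y. - h t (- y)) s y0" if "s \<le> s0" "\<bar>y0 - - b s\<bar> \<le> \<delta>" for s y0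
      unfolding md using that by (intro dom) (auto simp: abs_le_iff)
    show "((\<lambda>s. SUP y0\<in>{- b s - \<delta>..- b s + \<delta>}. \<bar>- b t - maxsol (\<lambda>t y. - h t (- y)) t s y0\<bar>) \<longlongrightarrow> 0) at_bot"
      if t: "t \<le> s0" for t
      using lim[OF t]
    proof (rule Lim_transform_eventually)
      show "\<forall>\<^sub>F s in at_bot. (SUP y0\<in>{b s - \<delta>..b s + \<delta>}. \<bar>b t - maxsol h t s y0\<bar>) =
          (SUP y0\<in>{- b s - \<delta>..- b s + \<delta>}. \<bar>- b t - maxsol (\<lambda>t y. - h t (- y)) t s y0\<bar>)"
        unfolding eventually_at_bot_linorder by (rule exI[of _ t]) (use eq t in auto)
    qed
  qed (use s0 in auto)
qed

context transition_equation
begin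

lemma reflected_no_bounded: "\<not> (\<exists>y. bounded_solution (Ec (\<lambda>t. p (- t)) c) y)"
proof
  assume "\<exists>y. bounded_solution (Ec (\<lambda>t. p (- t)) c) y"
  then obtain y where y: "solves_on (Ec (\<lambda>t. p (- t)) c) y UNIV" "bounded (range y)"
    by (auto simp: bounded_solution_def)
  interpret R: conjugacy "- 1" "- 1" "\<lambda>_. 0" "\<lambda>_. 0" "Ec p c" "Ec (\<lambda>t. p (- t)) c" by (rule Ec_reflection)
  have "solves_ivp (Ec (\<lambda>t. p (- t)) c) 0 (y 0) UNIV y" using y(1) by (simp add: solves_ivp_def)
  from R.solves_ivp_backward[of 0 "- y 0" UNIV y] this
  have "solves_on (Ec p c) (\<lambda>t. - y (- t)) UNIV" by (simp add: solves_ivp_def)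
  moreover have "bounded (range (\<lambda>t. - y (- t)))"
    using y(2) by (auto simp: bounded_iff)
  ultimately show False using no_bounded by (auto simp: bounded_solution_def)
qed

text \<open>
  The reflected equation is of the same kind, with the roles of \<open>a\<close> and \<open>r\<close> interchanged.
\<close>

lemma reflected_equation: "transition_equation (\<lambda>t. p (- t)) (\<lambda>t. - r (- t)) (\<lambda>t. - a (- t)) M d0 c"
proof
  show "continuous_on UNIV (\<lambda>t. p (- t))"
    using continuous_on_compose2[OF contp', of UNIV uminus] by (simp add: continuous_on_minus)
  show "((\<lambda>t. - r (- t)) has_real_derivative - (- r (- t))\<^sup>2 + p (- t)) (at t)"
    "((\<lambda>t. - a (- t)) has_real_derivative - (- a (- t))\<^sup>2 + p (- t)) (at t)" for t
    by (rule reflected_solution, rule dr' da')+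
  show "d0 \<le> - r (- t) - - a (- t)" for t using gap'[of "- t"] by simp
qed (use boundp' d0' c reflected_no_bounded in auto)

end

context transition_equation
begin

abbreviation p' :: "real \<Rightarrow> real" where "p' \<equiv> \<lambda>t. p (- t)"

sublocale R: conjugacy "- 1" "- 1" "\<lambda>_. 0" "\<lambda>_. 0" "Ec p c" "Ec p' c"
  by (rule Ec_reflection)

lemma maxdom_reflect: "maxdom (Ec p' c) (- s) (- y0) = uminus ` maxdom (Ec p c) s y0"
proof -
  have "(*) (- 1) = (uminus :: real \<Rightarrow> real)" by (simp add: fun_eq_iff)
  then show ?thesis using R.maxdom_eq[of s y0] by simp
qed

lemma maxsol_reflect:
  "t \<in> maxdom (Ec p c) s y0 \<Longrightarrow> maxsol (Ec p' c) (- t) (- s) (- y0) = - maxsol (Ec p c) t s y0"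
  using R.maxsol_eq[OF unique_Ec, of t s y0] by simp

lemma orbit_reflect:
  "(\<lambda>t. maxsol (Ec p' c) t (- s) (- y0)) ` (maxdom (Ec p' c) (- s) (- y0) \<inter> {..- s}) =
     uminus ` (\<lambda>t. maxsol (Ec p c) t s y0) ` (maxdom (Ec p c) s y0 \<inter> {s..})"
proof -
  have "maxdom (Ec p' c) (- s) (- y0) \<inter> {..- s} = uminus ` (maxdom (Ec p c) s y0 \<inter> {s..})"
    by (auto simp: maxdom_reflect)
  then show ?thesis
    by (simp only: image_image) (rule image_cong[OF refl], simp add: maxsol_reflect)
qed

lemma bdd_below_right_reflect: "bdd_below_right p c s y0 \<longleftrightarrow> bdd_above_left p' c (- s) (- y0)"
  unfolding bdd_below_right_def bdd_above_left_def orbit_reflect by simp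

lemma mem_R_plus_reflect: "s \<in> R_plus p c \<longleftrightarrow> - s \<in> R_minus p' c"
proof -
  have "(\<exists>y0. bdd_above_left p' c (- s) (- y0)) \<longleftrightarrow> (\<exists>y0. bdd_above_left p' c (- s) y0)"
    by (metis add.inverse_inverse)
  then show ?thesis by (simp add: R_plus_def R_minus_def bdd_below_right_reflect)
qed

lemma bounded_to_plus_infinity_reflect:
  "bounded_to_plus_infinity (Ec p c) s y0 \<longleftrightarrow> bounded_to_minus_infinity (Ec p' c) (- s) (- y0)"
proof -
  have sub: "{s..} \<subseteq> maxdom (Ec p c) s y0 \<longleftrightarrow> {..- s} \<subseteq> maxdom (Ec p' c) (- s) (- y0)"
  proof -
    have "{..- s} = uminus ` {s..}" by simp
    then show ?thesis by (simp only: maxdom_reflect inj_image_subset_iff[OF inj_uminus])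
  qed
  show ?thesis
  proof (cases "{s..} \<subseteq> maxdom (Ec p c) s y0")
    case True
    then have "maxdom (Ec p c) s y0 \<inter> {s..} = {s..}" "maxdom (Ec p' c) (- s) (- y0) \<inter> {..- s} = {..- s}"
      using sub by blast+
    then have "(\<lambda>t. maxsol (Ec p' c) t (- s) (- y0)) ` {..- s} = uminus ` (\<lambda>t. maxsol (Ec p c) t s y0) ` {s..}"
      using orbit_reflect[of s y0] by simp
    then show ?thesis using sub True
      unfolding bounded_to_plus_infinity_def bounded_to_minus_infinity_def by (simp only: bounded_uminus)
  qed (use sub in \<open>auto simp: bounded_to_plus_infinity_def bounded_to_minus_infinity_def\<close>)
qed

lemma approaches_at_plus_infinity_reflect:
  "approaches_at_plus_infinity (Ec p c) s y0 b \<longleftrightarrow>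
     approaches_at_minus_infinity (Ec p' c) (- s) (- y0) (\<lambda>t. - b (- t))"
proof -
  have sub: "{s..} \<subseteq> maxdom (Ec p c) s y0 \<longleftrightarrow> {..- s} \<subseteq> maxdom (Ec p' c) (- s) (- y0)"
  proof -
    have "{..- s} = uminus ` {s..}" by simp
    then show ?thesis by (simp only: maxdom_reflect inj_image_subset_iff[OF inj_uminus])
  qed
  have "((\<lambda>t. \<bar>b t - maxsol (Ec p c) t s y0\<bar>) \<longlongrightarrow> 0) at_top \<longleftrightarrow>
      ((\<lambda>t. \<bar>- b (- t) - maxsol (Ec p' c) t (- s) (- y0)\<bar>) \<longlongrightarrow> 0) at_bot"
    if "{s..} \<subseteq> maxdom (Ec p c) s y0"
  proof -
    have "\<forall>\<^sub>F t in at_top. \<bar>b t - maxsol (Ec p c) t s y0\<bar> = \<bar>- b (- (- t)) - maxsol (Ec p' c) (- t) (- s) (- y0)\<bar>"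
      unfolding eventually_at_top_linorder
    proof (intro exI[of _ s] allI impI)
      fix t assume "s \<le> t"
      then have "t \<in> maxdom (Ec p c) s y0" using that by auto
      then show "\<bar>b t - maxsol (Ec p c) t s y0\<bar> = \<bar>- b (- (- t)) - maxsol (Ec p' c) (- t) (- s) (- y0)\<bar>"
        by (simp add: maxsol_reflect)
    qed
    then show ?thesis unfolding filterlim_at_bot_mirror by (rule filterlim_cong[OF refl refl])
  qed
  then show ?thesis
    unfolding approaches_at_plus_infinity_def approaches_at_minus_infinity_def using sub by blast
qed

theorem behaviour_at_plus_infinity:
  "\<exists>l. R_plus p c = {l<..} \<and> filterlim (r_c p c) at_top (at_right l) \<and>
    locally_pullback_repulsive (Ec p c) (ereal l) (r_c p c) \<and>
    ((\<lambda>t. \<bar>r t + 1 - r_c p c t\<bar>) \<longlongrightarrow> 0) at_top \<and>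
    (\<forall>s y0. l < s \<longrightarrow>
      (bounded_to_plus_infinity (Ec p c) s y0 \<longleftrightarrow> y0 \<ge> r_c p c s) \<and>
      (approaches_at_plus_infinity (Ec p c) s y0 (\<lambda>t. a t + 1) \<longleftrightarrow> y0 > r_c p c s)) \<and>
    (\<forall>s y0. bounded ((\<lambda>t. maxsol (Ec p c) t s y0) ` (maxdom (Ec p c) s y0 \<inter> {s..})) \<longleftrightarrow>
      l < s \<and> y0 \<ge> r_c p c s)"
proof -
  obtain l where Rm: "R_minus p' c = {..<l}" and top: "filterlim (a_c p' c) at_bot (at_left l)"
    and lpa: "locally_pullback_attractive (Ec p' c) (ereal l) (a_c p' c)"
    and lim: "((\<lambda>t. \<bar>- r (- t) - 1 - a_c p' c t\<bar>) \<longlongrightarrow> 0) at_bot"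
    and below: "\<forall>s y0. s < l \<longrightarrow>
      (bdd_above_left p' c s y0 \<longleftrightarrow> y0 \<le> a_c p' c s) \<and>
      (bounded_to_minus_infinity (Ec p' c) s y0 \<longleftrightarrow> y0 \<le> a_c p' c s) \<and>
      (approaches_at_minus_infinity (Ec p' c) s y0 (\<lambda>t. - a (- t) - 1) \<longleftrightarrow> y0 < a_c p' c s)"
    and bdd: "\<forall>s y0. bounded ((\<lambda>t. maxsol (Ec p' c) t s y0) ` (maxdom (Ec p' c) s y0 \<inter> {..s})) \<longleftrightarrow>
      s < l \<and> y0 \<le> a_c p' c s"
    using transition_equation.behaviour_at_minus_infinity[OF reflected_equation] by (elim exE conjE) (rule that)
  have bal: "bdd_above_left p' c s y0 \<longleftrightarrow> y0 \<le> a_c p' c s"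
    and bmi: "bounded_to_minus_infinity (Ec p' c) s y0 \<longleftrightarrow> y0 \<le> a_c p' c s"
    and ami: "approaches_at_minus_infinity (Ec p' c) s y0 (\<lambda>t. - a (- t) - 1) \<longleftrightarrow> y0 < a_c p' c s"
    if "s < l" for s y0
    using below that by blast+
  have rc: "r_c p c s = - a_c p' c (- s)" if s: "- l < s" for s
    unfolding r_c_def
  proof (rule Least_equality)
    show "bdd_below_right p c s (- a_c p' c (- s))"
      using bal[of "- s" "a_c p' c (- s)"] s by (simp add: bdd_below_right_reflect)
    show "- a_c p' c (- s) \<le> y0" if "bdd_below_right p c s y0" for y0
      using bal[of "- s" "- y0"] s that by (simp add: bdd_below_right_reflect)
  qed
  have R: "R_plus p c = {- l<..}"
  proof (rule set_eqI)
    show "s \<in> R_plus p c \<longleftrightarrow> s \<in> {- l<..}" for s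
      unfolding mem_R_plus_reflect Rm by (simp add: minus_less_iff)
  qed
  have blow: "filterlim (r_c p c) at_top (at_right (- l))"
  proof -
    have "filterlim (\<lambda>t. - a_c p' c t) at_top (at_left l)"
      using top by (simp only: filterlim_uminus_at_bot)
    then have "filterlim (\<lambda>t. - a_c p' c (- t)) at_top (at_right (- l))"
      by (simp only: filterlim_at_left_to_right[of _ _ l])
    then show ?thesis
    proof (rule filterlim_mono_eventually[OF _ order_refl order_refl])
      have "\<forall>\<^sub>F t in at_right (- l). - l < t" by (simp add: eventually_at_filter)
      then show "\<forall>\<^sub>F t in at_right (- l). - a_c p' c (- t) = r_c p c t"
        by eventually_elim (simp add: rc)
    qed
  qed
  have rep: "locally_pullback_repulsive (Ec p c) (ereal (- l)) (r_c p c)"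
    unfolding locally_pullback_repulsive_def
  proof
    have "unique_solutions (Ec p' c)" by (rule transition_equation.unique_Ec[OF reflected_equation])
    from locally_pullback_attractive_sign_change[OF this lpa]
    have "locally_pullback_attractive (\<lambda>t y. - Ec p' c t (- y)) (ereal l) (\<lambda>t. - a_c p' c t)" .
    moreover have "(\<lambda>t y. - Ec p' c t (- y)) = (\<lambda>t y. - Ec p c (- t) y)"
      unfolding R.h' by (simp add: fun_eq_iff conjugate_rhs_def)
    ultimately have lpa': "locally_pullback_attractive (\<lambda>t y. - Ec p c (- t) y) (ereal l) (\<lambda>t. - a_c p' c t)"
      by (simp only:)
    have "locally_pullback_attractive (\<lambda>t y. - Ec p c (- t) y) (ereal l) (\<lambda>t. r_c p c (- t))"
      by (rule locally_pullback_attractive_cong[OF _ lpa']) (simp add: rc)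
    then show "locally_pullback_attractive (\<lambda>t y. - Ec p c (- t) y) (- ereal (- l)) (\<lambda>t. r_c p c (- t))"
      by simp
    have sol: "solves_on (Ec p' c) (a_c p' c) {..<l}"
      using lpa by (simp add: locally_pullback_attractive_def lessThan_def)
    have "solves_ivp (Ec p' c) (- 1 * (1 - l)) (- 1 * - a_c p' c (l - 1) + 0) {..<l} (a_c p' c)"
      using sol by (simp add: solves_ivp_def is_interval_io)
    from R.solves_ivp_backward[OF this]
    have "solves_on (Ec p c) (\<lambda>t. - a_c p' c (- t)) ((*) (- 1) ` {..<l})"
      by (simp add: solves_ivp_def)
    moreover have "(*) (- 1) ` {..<l} = {t. ereal (- l) < ereal t}"
    proof -
      have "(*) (- 1) ` {..<l} = uminus ` {..<l}" by (rule image_cong) auto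
      then show ?thesis by (simp add: greaterThan_def)
    qed
    ultimately have "solves_on (Ec p c) (\<lambda>t. - a_c p' c (- t)) {t. ereal (- l) < ereal t}" by (simp only:)
    then show "solves_on (Ec p c) (r_c p c) {t. ereal (- l) < ereal t}"
      by (rule solves_on_cong[rotated]) (simp add: rc)
  qed
  have lim': "((\<lambda>t. \<bar>r t + 1 - r_c p c t\<bar>) \<longlongrightarrow> 0) at_top"
  proof -
    have "((\<lambda>t. \<bar>- r t - 1 - a_c p' c (- t)\<bar>) \<longlongrightarrow> 0) at_top"
      using lim by (simp add: filterlim_at_bot_mirror)
    then show ?thesis
    proof (rule Lim_transform_eventually)
      show "\<forall>\<^sub>F t in at_top. \<bar>- r t - 1 - a_c p' c (- t)\<bar> = \<bar>r t + 1 - r_c p c t\<bar>"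
        using eventually_gt_at_top[of "- l"] by eventually_elim (simp add: rc)
    qed
  qed
  have b: "bounded_to_plus_infinity (Ec p c) s y0 \<longleftrightarrow> y0 \<ge> r_c p c s" if "- l < s" for s y0
    using bmi[of "- s" "- y0"] that unfolding bounded_to_plus_infinity_reflect rc[OF that] by linarith
  have ap: "approaches_at_plus_infinity (Ec p c) s y0 (\<lambda>t. a t + 1) \<longleftrightarrow> y0 > r_c p c s"
    if "- l < s" for s y0
  proof -
    have "(\<lambda>t. - (a (- t) + 1)) = (\<lambda>t. - a (- t) - 1)" by (simp add: fun_eq_iff)
    then show ?thesis using ami[of "- s" "- y0"] that
      unfolding approaches_at_plus_infinity_reflect rc[OF that] by (simp only:) linarith
  qed
  have bd: "bounded ((\<lambda>t. maxsol (Ec p c) t s y0) ` (maxdom (Ec p c) s y0 \<inter> {s..})) \<longleftrightarrow>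
      - l < s \<and> y0 \<ge> r_c p c s" for s y0
  proof -
    have "bounded ((\<lambda>t. maxsol (Ec p c) t s y0) ` (maxdom (Ec p c) s y0 \<inter> {s..})) \<longleftrightarrow>
        - s < l \<and> - y0 \<le> a_c p' c (- s)"
      using bdd[rule_format, of "- s" "- y0"] unfolding orbit_reflect by (simp only: bounded_uminus)
    also have "\<dots> \<longleftrightarrow> - l < s \<and> y0 \<ge> r_c p c s"
    proof (cases "- l < s")
      case True then show ?thesis using rc[OF True] by linarith
    next
      case False then show ?thesis by linarith
    qed
    finally show ?thesis .
  qed
  show ?thesis
    by (intro exI[of _ "- l"] conjI allI impI R blow rep lim' b ap bd)
qed

end

section \<open>The case without bounded solutions\<close>

theorem theorem4p6:
  fixes p :: "real \<Rightarrow> real" and c :: real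
  assumes "bounded (range p)"
    and "uniformly_continuous_on UNIV p"
    and "card {b. hyperbolic (quad p) b} = 2"
    and "c > 0"
    and "\<not> (\<exists>y. bounded_solution (Ec p c) y)"
  shows "\<exists>lm lp :: real.
    (R_minus p c = {..<lm} \<and> R_plus p c = {lp<..} \<and>
      filterlim (a_c p c) at_bot (at_left lm) \<and>
      filterlim (r_c p c) at_top (at_right lp)) \<and>
    (locally_pullback_attractive (Ec p c) (ereal lm) (a_c p c) \<and>
      locally_pullback_repulsive (Ec p c) (ereal lp) (r_c p c)) \<and>
    (((\<lambda>t. \<bar>a_minus p t - a_c p c t\<bar>) \<longlongrightarrow> 0) at_bot \<and>
      ((\<lambda>t. \<bar>r_plus p t - r_c p c t\<bar>) \<longlongrightarrow> 0) at_top) \<and>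
    (\<forall>s\<in>R_minus p c. \<forall>y0.
      (bounded_to_minus_infinity (Ec p c) s y0 \<longleftrightarrow> y0 \<le> a_c p c s) \<and>
      (approaches_at_minus_infinity (Ec p c) s y0 (r_minus p) \<longleftrightarrow> y0 < a_c p c s)) \<and>
    (\<forall>s\<in>R_plus p c. \<forall>y0.
      (bounded_to_plus_infinity (Ec p c) s y0 \<longleftrightarrow> y0 \<ge> r_c p c s) \<and>
      (approaches_at_plus_infinity (Ec p c) s y0 (a_plus p) \<longleftrightarrow> y0 > r_c p c s)) \<and>
    ((\<exists>s y0. unbounded_at_both_ends (Ec p c) s y0) \<and>
      (\<forall>s y0. unbounded_at_both_ends (Ec p c) s y0 \<longleftrightarrow>
        (s < lm \<and> y0 > a_c p c s \<and> (lp < s \<longrightarrow> y0 < r_c p c s)) \<or>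
        (lm \<le> s \<and> s \<le> lp) \<or>
        (lp < s \<and> y0 < r_c p c s \<and> (s < lm \<longrightarrow> y0 > a_c p c s))))"
proof -
  obtain M where M: "\<And>t. \<bar>p t\<bar> \<le> M" using assms(1) by (auto simp: bounded_iff)
  have contp: "continuous_on UNIV p" using assms(2) by (rule uniformly_continuous_imp_continuous)
  interpret P: bounded_coefficient p M by unfold_locales (rule contp, rule M)
  interpret P': bounded_coefficient "\<lambda>t. p (- t)" M by (rule P.reflected)
  have attr_unique: "b1 = b2" if "hyperbolic_attractive (quad p) b1" "hyperbolic_attractive (quad p) b2" for b1 b2
    using that P.decaying_linearization_unique by (auto simp: hyperbolic_attractive_iff)
  have rep_unique: "b1 = b2" if "hyperbolic_repulsive (quad p) b1" "hyperbolic_repulsive (quad p) b2" for b1 b2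
  proof -
    have "(\<lambda>t. - b1 (- t)) = (\<lambda>t. - b2 (- t))"
      using that P'.decaying_linearization_unique by (auto simp: hyperbolic_repulsive_iff hyperbolic_attractive_iff)
    then have "- b1 (- (- t)) = - b2 (- (- t))" for t by metis
    then show ?thesis by (simp add: fun_eq_iff)
  qed
  obtain b1 b2 where b: "{b. hyperbolic (quad p) b} = {b1, b2}" "b1 \<noteq> b2"
    using assms(3) by (auto simp: card_2_iff)
  have hyp: "hyperbolic (quad p) b1" "hyperbolic (quad p) b2" using b(1) by auto
  obtain a r where ar: "hyperbolic_attractive (quad p) a" "hyperbolic_repulsive (quad p) r" "a \<noteq> r"
  proof (cases "hyperbolic_attractive (quad p) b1")
    case True
    then have "hyperbolic_repulsive (quad p) b2"
      using hyp(2) b(2) attr_unique unfolding hyperbolic_def by blast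
    then show ?thesis using that[of b1 b2] True b(2) by blast
  next
    case False
    then have "hyperbolic_repulsive (quad p) b1" "hyperbolic_attractive (quad p) b2"
      using hyp b(2) rep_unique unfolding hyperbolic_def by blast+
    then show ?thesis using that[of b2 b1] b(2) by blast
  qed
  have at: "a_tilde p = a" and rt: "r_tilde p = r"
    unfolding a_tilde_def r_tilde_def using ar attr_unique rep_unique by (auto intro!: the_equality)
  obtain P k \<beta> where la: "decaying_linearization p a P k \<beta>" using ar(1) by (auto simp: hyperbolic_attractive_iff)
  obtain Q k' \<beta>' where lr: "decaying_linearization (\<lambda>t. p (- t)) (\<lambda>t. - r (- t)) Q k' \<beta>'"
    using ar(2) by (auto simp: hyperbolic_repulsive_iff hyperbolic_attractive_iff)
  obtain d0 where d0: "d0 > 0" "\<And>t. d0 \<le> a t - r t" using P.hyperbolic_gap[OF la lr ar(3)] by blast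
  have da: "(a has_real_derivative - (a t)\<^sup>2 + p t) (at t)" for t using la by (simp add: decaying_linearization_def)
  have dr: "(r has_real_derivative - (r t)\<^sup>2 + p t) (at t)" for t
    using ar(2) by (simp add: hyperbolic_repulsive_def solves_on_quad_UNIV)
  interpret E: transition_equation p a r M d0 c
    by unfold_locales (fact contp M da dr d0 assms)+
  obtain lm where m: "R_minus p c = {..<lm}" "filterlim (a_c p c) at_bot (at_left lm)"
    "locally_pullback_attractive (Ec p c) (ereal lm) (a_c p c)"
    "((\<lambda>t. \<bar>a t - 1 - a_c p c t\<bar>) \<longlongrightarrow> 0) at_bot"
    "\<forall>s y0. s < lm \<longrightarrow>
      (bdd_above_left p c s y0 \<longleftrightarrow> y0 \<le> a_c p c s) \<and>
      (bounded_to_minus_infinity (Ec p c) s y0 \<longleftrightarrow> y0 \<le> a_c p c s) \<and>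
      (approaches_at_minus_infinity (Ec p c) s y0 (\<lambda>t. r t - 1) \<longleftrightarrow> y0 < a_c p c s)"
    "\<forall>s y0. bounded ((\<lambda>t. maxsol (Ec p c) t s y0) ` (maxdom (Ec p c) s y0 \<inter> {..s})) \<longleftrightarrow>
      s < lm \<and> y0 \<le> a_c p c s"
    using E.behaviour_at_minus_infinity by (elim exE conjE) (rule that)
  obtain lp where q: "R_plus p c = {lp<..}" "filterlim (r_c p c) at_top (at_right lp)"
    "locally_pullback_repulsive (Ec p c) (ereal lp) (r_c p c)"
    "((\<lambda>t. \<bar>r t + 1 - r_c p c t\<bar>) \<longlongrightarrow> 0) at_top"
    "\<forall>s y0. lp < s \<longrightarrow>
      (bounded_to_plus_infinity (Ec p c) s y0 \<longleftrightarrow> y0 \<ge> r_c p c s) \<and>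
      (approaches_at_plus_infinity (Ec p c) s y0 (\<lambda>t. a t + 1) \<longleftrightarrow> y0 > r_c p c s)"
    "\<forall>s y0. bounded ((\<lambda>t. maxsol (Ec p c) t s y0) ` (maxdom (Ec p c) s y0 \<inter> {s..})) \<longleftrightarrow>
      lp < s \<and> y0 \<ge> r_c p c s"
    using E.behaviour_at_plus_infinity by (elim exE conjE) (rule that)
  have shifts: "a_minus p = (\<lambda>t. a t - 1)" "r_minus p = (\<lambda>t. r t - 1)"
    "a_plus p = (\<lambda>t. a t + 1)" "r_plus p = (\<lambda>t. r t + 1)"
    by (simp_all add: fun_eq_iff a_minus_def r_minus_def a_plus_def r_plus_def at rt)
  have unbounded: "unbounded_at_both_ends (Ec p c) s y0 \<longleftrightarrow>
      \<not> (s < lm \<and> y0 \<le> a_c p c s) \<and> \<not> (lp < s \<and> y0 \<ge> r_c p c s)" for s y0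
    unfolding unbounded_at_both_ends_def using m(6) q(6) by blast
  show ?thesis
  proof (rule exI[of _ lm], rule exI[of _ lp], intro conjI)
    show "\<exists>s y0. unbounded_at_both_ends (Ec p c) s y0"
    proof (intro exI)
      \<comment> \<open>Left of both \<open>lm\<close> and \<open>lp\<close> it suffices to start above \<open>a_c\<close>.\<close>
      let ?s = "min lm lp - 1"
      show "unbounded_at_both_ends (Ec p c) ?s (a_c p c ?s + 1)" unfolding unbounded by auto
    qed
    show "\<forall>s y0. unbounded_at_both_ends (Ec p c) s y0 \<longleftrightarrow>
        (s < lm \<and> y0 > a_c p c s \<and> (lp < s \<longrightarrow> y0 < r_c p c s)) \<or>
        (lm \<le> s \<and> s \<le> lp) \<or>
        (lp < s \<and> y0 < r_c p c s \<and> (s < lm \<longrightarrow> y0 > a_c p c s))"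
      unfolding unbounded by (auto simp: not_le not_less)
  qed (use m q in \<open>simp_all add: shifts\<close>)
qed

end
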